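(* Let $(M,\omega)$ be a compact symplectic monotone manifold, i.e. $2\pi c_1(M)=\lambda[\omega]$ for some constant $\lambda$. Let $G$ be a compact connected Lie subgroup of $Ham(M,\omega)$ and suppose that $J\in AK^G_\omega$ induces a GeAKRS for some non-trivial vector field $\xi$ (in the center of $Lie(G)$). Then $\lambda$ is positive.
   Context: Let $(M,\omega)$ be a symplectic manifold of real dimension $2n$. An almost-complex structure $J$ is compatible with $\omega$ if $\omega(J\cdot,J\cdot)=\omega(\cdot,\cdot)$ and $g:=\omega(\cdot,J\cdot)$ is a Riemannian metric, called the almost-Kähler metric induced by $J$. $D^g$ is the Levi-Civita connection. The canonical Hermitian connection is $\nabla_XY=D^g_XY-\frac12 J(D^g_XJ)Y$, with curvature $R^\nabla_{X,Y}=\nabla_{[X,Y]}-[\nabla_X,\nabla_Y]$; the first-Chern--Ricci form is $\rho^\nabla(X,Y)=\frac12\sum_{i=1}^{2n}g(R^\nabla_{X,Y}e_i,Je_i)$ for a $J$-adapted $g$-orthonormal local frame $\{e_i\}$; it represents $2\pi c_1(M)$. The Chern scalar curvature $s^c$ is defined by $s^c\omega^n=n\,\rho^\nabla\wedge\omega^{n-1}$. $\Delta^g=\delta^gd+d\delta^g$ is the Riemannian Laplacian. $Ham(M,\omega)$ is the group of Hamiltonian symplectomorphisms and $AK^G_\omega$ is the space of $G$-invariant almost-complex structures compatible with $\omega$. An element $\xi$ of the center of $\mathfrak g=Lie(G)$ is identified with the vector field it defines on $M$; $f_\xi$ is the potential defined by $\omega(\xi,\cdot)=-df_\xi$ and $\int_M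 f_\xi e^{-2f_\xi}\omega^n=0$. For $J\in AK^G_\omega$ inducing $g$, put $s^c_\xi(J)=s^c(J)-n-2\Delta^gf_\xi+2f_\xi-2|df_\xi|_g^2$. The metric $g$ is a generalized almost-Kähler--Ricci soliton (GeAKRS) for $\xi$ if $s^c_\xi(J)\equiv0$. *)

theory Defs
  imports "HOL-Analysis.Analysis" "HOL-Combinatorics.Permutations"
begin

section \<open>Smooth manifolds\<close>

text \<open>
  A manifold is a Hausdorff, second countable type \<open>'a\<close> together with an atlas of charts into a
  Euclidean space \<open>'e\<close>; its dimension is \<open>DIM('e)\<close>. A chart is a pair of its domain and the
  coordinate map, whose values outside the domain are irrelevant.
\<close>

type_synonym ('a, 'e) chart = "'a set \<times> ('a \<Rightarrow> 'e)"
type_synonym ('a, 'e) atlas = "('a, 'e) chart set"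

text \<open>\<open>Ck_on k S f\<close> is only used for open \<open>S\<close>. In finite dimension, continuity of all directional
  derivatives \<open>\<lambda>x. f' x v\<close> is continuity of the derivative.\<close>

primrec Ck_on :: "nat \<Rightarrow> 'e::real_normed_vector set \<Rightarrow> ('e \<Rightarrow> 'f::real_normed_vector) \<Rightarrow> bool" where
  "Ck_on 0 S f \<longleftrightarrow> continuous_on S f"
| "Ck_on (Suc k) S f \<longleftrightarrow>
     (\<exists>f'. (\<forall>x\<in>S. (f has_derivative f' x) (at x)) \<and> (\<forall>v. Ck_on k S (\<lambda>x. f' x v)))"

definition smooth_on :: "'e::real_normed_vector set \<Rightarrow> ('e \<Rightarrow> 'f::real_normed_vector) \<Rightarrow> bool" where
  "smooth_on S f \<longleftrightarrow> (\<forall>k. Ck_on k S f)"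

definition is_chart :: "('a::topological_space, 'e::euclidean_space) chart \<Rightarrow> bool" where
  "is_chart c \<longleftrightarrow> (case c of (U, \<phi>) \<Rightarrow>
     open U \<and> open (\<phi> ` U) \<and> homeomorphism U (\<phi> ` U) \<phi> (inv_into U \<phi>))"

definition smooth_compatible ::
    "('a::topological_space, 'e::euclidean_space) chart \<Rightarrow> ('a, 'e) chart \<Rightarrow> bool" where
  "smooth_compatible c d \<longleftrightarrow> (case (c, d) of ((U, \<phi>), (V, \<psi>)) \<Rightarrow>
     smooth_on (\<phi> ` (U \<inter> V)) (\<psi> \<circ> inv_into U \<phi>))"

definition smooth_manifold ::
    "('a::{t2_space,second_countable_topology}, 'e::euclidean_space) atlas \<Rightarrow> bool" where
  "smooth_manifold A \<longleftrightarrow>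
     (\<forall>c\<in>A. is_chart c) \<and> (\<Union>c\<in>A. fst c) = UNIV \<and> (\<forall>c\<in>A. \<forall>d\<in>A. smooth_compatible c d)"

definition euclidean_atlas :: "('e::euclidean_space, 'e) atlas" where
  "euclidean_atlas = {(UNIV, id)}"

definition prod_atlas :: "('a, 'e) atlas \<Rightarrow> ('b, 'f) atlas \<Rightarrow> ('a \<times> 'b, 'e \<times> 'f) atlas" where
  "prod_atlas A B = {(U \<times> V, map_prod \<phi> \<psi>) | U \<phi> V \<psi>. (U, \<phi>) \<in> A \<and> (V, \<psi>) \<in> B}"

definition smooth_map ::
    "('a::topological_space, 'e::euclidean_space) atlas \<Rightarrow>
     ('b::topological_space, 'f::euclidean_space) atlas \<Rightarrow> ('a \<Rightarrow> 'b) \<Rightarrow> bool" where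
  "smooth_map A B f \<longleftrightarrow> continuous_on UNIV f \<and>
     (\<forall>(U, \<phi>)\<in>A. \<forall>(V, \<psi>)\<in>B. smooth_on (\<phi> ` (U \<inter> f -` V)) (\<psi> \<circ> f \<circ> inv_into U \<phi>))"

definition cinf :: "('a::topological_space, 'e::euclidean_space) atlas \<Rightarrow> ('a \<Rightarrow> real) set" where
  "cinf A = {f. smooth_map A (euclidean_atlas :: (real, real) atlas) f}"

section \<open>Vector fields and differential forms\<close>

text \<open>
  Vector fields are derivations of \<open>C\<^sup>\<infinity>(M)\<close> and tensor fields are \<open>C\<^sup>\<infinity>(M)\<close>-multilinear maps on
  vector fields. Values on arguments outside \<open>C\<^sup>\<infinity>(M)\<close>, respectively on lists that are not lists of
  vector fields of the right length, are normalised to \<open>0\<close>, so that HOL equality is equality of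
  vector fields and of forms.
\<close>

type_synonym 'a vf = "('a \<Rightarrow> real) \<Rightarrow> 'a \<Rightarrow> real"
type_synonym 'a form = "'a vf list \<Rightarrow> 'a \<Rightarrow> real"

definition vfields :: "('a::topological_space, 'e::euclidean_space) atlas \<Rightarrow> 'a vf set" where
  "vfields A = {X.
     (\<forall>f\<in>cinf A. X f \<in> cinf A) \<and>
     (\<forall>f\<in>cinf A. \<forall>g\<in>cinf A. X (\<lambda>p. f p + g p) = (\<lambda>p. X f p + X g p)) \<and>
     (\<forall>c. \<forall>f\<in>cinf A. X (\<lambda>p. c * f p) = (\<lambda>p. c * X f p)) \<and>
     (\<forall>f\<in>cinf A. \<forall>g\<in>cinf A. X (\<lambda>p. f p * g p) = (\<lambda>p. X f p * g p + f p * X g p)) \<and>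
     (\<forall>f. f \<notin> cinf A \<longrightarrow> X f = (\<lambda>p. 0))}"

definition vf_zero :: "'a vf" where
  "vf_zero = (\<lambda>f p. 0)"

definition vf_add :: "'a vf \<Rightarrow> 'a vf \<Rightarrow> 'a vf" where
  "vf_add X Y = (\<lambda>f p. X f p + Y f p)"

definition vf_diff :: "'a vf \<Rightarrow> 'a vf \<Rightarrow> 'a vf" where
  "vf_diff X Y = (\<lambda>f p. X f p - Y f p)"

definition vf_scale :: "('a \<Rightarrow> real) \<Rightarrow> 'a vf \<Rightarrow> 'a vf" where
  "vf_scale h X = (\<lambda>f p. h p * X f p)"

definition vf_bracket :: "'a vf \<Rightarrow> 'a vf \<Rightarrow> 'a vf" where
  "vf_bracket X Y = (\<lambda>f p. X (Y f) p - Y (X f) p)"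

definition vf_push :: "('a \<Rightarrow> 'a) \<Rightarrow> 'a vf \<Rightarrow> 'a vf" where
  "vf_push \<phi> X = (\<lambda>f. X (f \<circ> \<phi>) \<circ> inv \<phi>)"

definition vanishes_at :: "'a vf \<Rightarrow> 'a \<Rightarrow> bool" where
  "vanishes_at X p \<longleftrightarrow> (\<forall>f. X f p = 0)"

definition is_form ::
    "('a::topological_space, 'e::euclidean_space) atlas \<Rightarrow> nat \<Rightarrow> 'a form \<Rightarrow> bool" where
  "is_form A k \<alpha> \<longleftrightarrow>
     (\<forall>Xs. length Xs = k \<and> set Xs \<subseteq> vfields A \<longrightarrow>
        \<alpha> Xs \<in> cinf A \<and>
        (\<forall>i<k. \<forall>Y\<in>vfields A.
           \<alpha> (Xs[i := vf_add (Xs ! i) Y]) = (\<lambda>p. \<alpha> Xs p + \<alpha> (Xs[i := Y]) p)) \<and>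
        (\<forall>i<k. \<forall>h\<in>cinf A. \<alpha> (Xs[i := vf_scale h (Xs ! i)]) = (\<lambda>p. h p * \<alpha> Xs p)) \<and>
        (\<forall>i<k. \<forall>j<i. Xs ! i = Xs ! j \<longrightarrow> \<alpha> Xs = (\<lambda>p. 0))) \<and>
     (\<forall>Xs. \<not> (length Xs = k \<and> set Xs \<subseteq> vfields A) \<longrightarrow> \<alpha> Xs = (\<lambda>p. 0))"

definition form_add :: "'a form \<Rightarrow> 'a form \<Rightarrow> 'a form" where
  "form_add \<alpha> \<beta> = (\<lambda>Xs p. \<alpha> Xs p + \<beta> Xs p)"

definition form_scale :: "real \<Rightarrow> 'a form \<Rightarrow> 'a form" where
  "form_scale c \<alpha> = (\<lambda>Xs p. c * \<alpha> Xs p)"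

definition zero_form_of :: "('a \<Rightarrow> real) \<Rightarrow> 'a form" where
  "zero_form_of f = (\<lambda>Xs p. if Xs = [] then f p else 0)"

text \<open>\<open>d\<alpha>(X\<^sub>0,\<dots>,X\<^sub>k) = \<Sum>\<^sub>i (-1)\<^sup>i X\<^sub>i(\<alpha>(\<dots>X\<^sub>i omitted\<dots>)) +
  \<Sum>\<^sub>i\<^sub><\<^sub>j (-1)\<^sup>i\<^sup>+\<^sup>j \<alpha>([X\<^sub>i,X\<^sub>j],\<dots>X\<^sub>i, X\<^sub>j omitted\<dots>)\<close>\<close>

definition ext_deriv ::
    "('a::topological_space, 'e::euclidean_space) atlas \<Rightarrow> 'a form \<Rightarrow> 'a form" where
  "ext_deriv A \<alpha> = (\<lambda>Xs p. if set Xs \<subseteq> vfields A then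
     (\<Sum>i<length Xs. (-1) ^ i * (Xs ! i) (\<alpha> (nths Xs (- {i}))) p) +
     (\<Sum>j<length Xs. \<Sum>i<j.
        (-1) ^ (i + j) * \<alpha> (vf_bracket (Xs ! i) (Xs ! j) # nths Xs (- {i, j})) p)
     else 0)"

definition wedge :: "nat \<Rightarrow> nat \<Rightarrow> 'a form \<Rightarrow> 'a form \<Rightarrow> 'a form" where
  "wedge k l \<alpha> \<beta> = (\<lambda>Xs p. if length Xs = k + l then
     (\<Sum>\<pi> | \<pi> permutes {..<k + l}.
        of_int (sign \<pi>) * \<alpha> (map (\<lambda>i. Xs ! \<pi> i) [0..<k]) p
                        * \<beta> (map (\<lambda>i. Xs ! \<pi> i) [k..<k + l]) p) / (fact k * fact l)
     else 0)"

primrec wedge_power :: "'a form \<Rightarrow> nat \<Rightarrow> 'a form" where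
  "wedge_power \<omega> 0 = zero_form_of (\<lambda>p. 1)"
| "wedge_power \<omega> (Suc m) = wedge 2 (2 * m) \<omega> (wedge_power \<omega> m)"

definition closed_form ::
    "('a::topological_space, 'e::euclidean_space) atlas \<Rightarrow> nat \<Rightarrow> 'a form \<Rightarrow> bool" where
  "closed_form A k \<alpha> \<longleftrightarrow> is_form A k \<alpha> \<and> (\<forall>Xs p. ext_deriv A \<alpha> Xs p = 0)"

definition de_rham_class ::
    "('a::topological_space, 'e::euclidean_space) atlas \<Rightarrow> nat \<Rightarrow> 'a form \<Rightarrow> 'a form set" where
  "de_rham_class A k \<alpha> =
     {\<beta>. closed_form A k \<beta> \<and> (\<exists>\<gamma>. is_form A (k - 1) \<gamma> \<and> \<beta> = form_add \<alpha> (ext_deriv A \<gamma>))}"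

section \<open>Symplectic manifolds and almost-Kaehler structures\<close>

definition symplectic_manifold ::
    "('a::{t2_space,second_countable_topology}, 'e::euclidean_space) atlas \<Rightarrow> nat \<Rightarrow> 'a form \<Rightarrow> bool"
  where
  "symplectic_manifold A n \<omega> \<longleftrightarrow>
     smooth_manifold A \<and> DIM('e) = 2 * n \<and> closed_form A 2 \<omega> \<and>
     (\<forall>X\<in>vfields A. \<forall>p. (\<forall>Y\<in>vfields A. \<omega> [X, Y] p = 0) \<longrightarrow> vanishes_at X p)"

definition endo_field ::
    "('a::topological_space, 'e::euclidean_space) atlas \<Rightarrow> ('a vf \<Rightarrow> 'a vf) \<Rightarrow> bool" where
  "endo_field A J \<longleftrightarrow>
     (\<forall>X\<in>vfields A. J X \<in> vfields A) \<and>
     (\<forall>X\<in>vfields A. \<forall>Y\<in>vfields A. J (vf_add X Y) = vf_add (J X) (J Y)) \<and>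
     (\<forall>h\<in>cinf A. \<forall>X\<in>vfields A. J (vf_scale h X) = vf_scale h (J X))"

definition almost_complex ::
    "('a::topological_space, 'e::euclidean_space) atlas \<Rightarrow> ('a vf \<Rightarrow> 'a vf) \<Rightarrow> bool" where
  "almost_complex A J \<longleftrightarrow>
     endo_field A J \<and> (\<forall>X\<in>vfields A. J (J X) = vf_scale (\<lambda>p. -1) X)"

type_synonym 'a metric_field = "'a vf \<Rightarrow> 'a vf \<Rightarrow> 'a \<Rightarrow> real"

definition riemannian_metric ::
    "('a::topological_space, 'e::euclidean_space) atlas \<Rightarrow> 'a metric_field \<Rightarrow> bool" where
  "riemannian_metric A g \<longleftrightarrow>
     (\<forall>X\<in>vfields A. \<forall>Y\<in>vfields A. g X Y \<in> cinf A \<and> g X Y = g Y X) \<and>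
     (\<forall>X\<in>vfields A. \<forall>Y\<in>vfields A. \<forall>Z\<in>vfields A.
        g (vf_add X Y) Z = (\<lambda>p. g X Z p + g Y Z p)) \<and>
     (\<forall>h\<in>cinf A. \<forall>X\<in>vfields A. \<forall>Y\<in>vfields A. g (vf_scale h X) Y = (\<lambda>p. h p * g X Y p)) \<and>
     (\<forall>X\<in>vfields A. \<forall>p. \<not> vanishes_at X p \<longrightarrow> g X X p > 0)"

definition ak_metric :: "'a form \<Rightarrow> ('a vf \<Rightarrow> 'a vf) \<Rightarrow> 'a metric_field" where
  "ak_metric \<omega> J = (\<lambda>X Y. \<omega> [X, J Y])"

definition compatible ::
    "('a::topological_space, 'e::euclidean_space) atlas \<Rightarrow> 'a form \<Rightarrow> ('a vf \<Rightarrow> 'a vf) \<Rightarrow> bool" where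
  "compatible A \<omega> J \<longleftrightarrow>
     almost_complex A J \<and>
     (\<forall>X\<in>vfields A. \<forall>Y\<in>vfields A. \<omega> [J X, J Y] = \<omega> [X, Y]) \<and>
     riemannian_metric A (ak_metric \<omega> J)"

definition AK ::
    "('a::topological_space, 'e::euclidean_space) atlas \<Rightarrow> 'a form \<Rightarrow> ('a \<Rightarrow> 'a) set \<Rightarrow>
     ('a vf \<Rightarrow> 'a vf) set" where
  "AK A \<omega> G =
     {J. compatible A \<omega> J \<and> (\<forall>\<phi>\<in>G. \<forall>X\<in>vfields A. J (vf_push \<phi> X) = vf_push \<phi> (J X))}"

section \<open>Connections and curvature\<close>

type_synonym 'a connection = "'a vf \<Rightarrow> 'a vf \<Rightarrow> 'a vf"

definition is_connection ::
    "('a::topological_space, 'e::euclidean_space) atlas \<Rightarrow> 'a connection \<Rightarrow> bool" where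
  "is_connection A D \<longleftrightarrow>
     (\<forall>X\<in>vfields A. \<forall>Y\<in>vfields A. D X Y \<in> vfields A) \<and>
     (\<forall>X\<in>vfields A. \<forall>Y\<in>vfields A. \<forall>Z\<in>vfields A.
        D (vf_add X Y) Z = vf_add (D X Z) (D Y Z) \<and>
        D X (vf_add Y Z) = vf_add (D X Y) (D X Z)) \<and>
     (\<forall>h\<in>cinf A. \<forall>X\<in>vfields A. \<forall>Y\<in>vfields A.
        D (vf_scale h X) Y = vf_scale h (D X Y) \<and>
        D X (vf_scale h Y) = vf_add (vf_scale (X h) Y) (vf_scale h (D X Y)))"

definition levi_civita ::
    "('a::topological_space, 'e::euclidean_space) atlas \<Rightarrow> 'a metric_field \<Rightarrow> 'a connection \<Rightarrow> bool"
  where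
  "levi_civita A g D \<longleftrightarrow>
     is_connection A D \<and>
     (\<forall>X\<in>vfields A. \<forall>Y\<in>vfields A. vf_diff (D X Y) (D Y X) = vf_bracket X Y) \<and>
     (\<forall>X\<in>vfields A. \<forall>Y\<in>vfields A. \<forall>Z\<in>vfields A.
        X (g Y Z) = (\<lambda>p. g (D X Y) Z p + g Y (D X Z) p))"

definition canonical_hermitian ::
    "('a vf \<Rightarrow> 'a vf) \<Rightarrow> 'a connection \<Rightarrow> 'a connection" where
  "canonical_hermitian J D =
     (\<lambda>X Y. vf_diff (D X Y) (vf_scale (\<lambda>p. 1 / 2) (J (vf_diff (D X (J Y)) (J (D X Y))))))"

text \<open>Note the sign convention \<open>R\<^sub>X\<^sub>,\<^sub>Y = \<nabla>\<^sub>[\<^sub>X\<^sub>,\<^sub>Y\<^sub>] - [\<nabla>\<^sub>X, \<nabla>\<^sub>Y]\<close>.\<close>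

definition curvature :: "'a connection \<Rightarrow> 'a vf \<Rightarrow> 'a vf \<Rightarrow> 'a vf \<Rightarrow> 'a vf" where
  "curvature N X Y Z = vf_diff (N (vf_bracket X Y) Z) (vf_diff (N X (N Y Z)) (N Y (N X Z)))"

text \<open>Local frames are represented by globally defined vector fields that form a frame on an open
  set \<open>U\<close>; every local frame around a point is of this kind after shrinking its domain.\<close>

definition orthonormal_frame_on ::
    "('a::topological_space, 'e::euclidean_space) atlas \<Rightarrow> 'a metric_field \<Rightarrow> 'a set \<Rightarrow>
     (nat \<Rightarrow> 'a vf) \<Rightarrow> bool" where
  "orthonormal_frame_on A g U e \<longleftrightarrow>
     (\<forall>i<DIM('e). e i \<in> vfields A) \<and>
     (\<forall>i<DIM('e). \<forall>j<DIM('e). \<forall>p\<in>U. g (e i) (e j) p = (if i = j then 1 else 0))"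

definition adapted_frame_on ::
    "('a::topological_space, 'e::euclidean_space) atlas \<Rightarrow> nat \<Rightarrow> 'a form \<Rightarrow> ('a vf \<Rightarrow> 'a vf) \<Rightarrow>
     'a set \<Rightarrow> (nat \<Rightarrow> 'a vf) \<Rightarrow> bool" where
  "adapted_frame_on A n \<omega> J U e \<longleftrightarrow>
     orthonormal_frame_on A (ak_metric \<omega> J) U e \<and>
     (\<forall>i<n. \<forall>p\<in>U. vanishes_at (vf_diff (e (n + i)) (J (e i))) p)"

definition orthonormal_frame_at ::
    "('a::topological_space, 'e::euclidean_space) atlas \<Rightarrow> 'a metric_field \<Rightarrow> 'a \<Rightarrow> nat \<Rightarrow> 'a vf"
  where
  "orthonormal_frame_at A g p = (SOME e. \<exists>U. open U \<and> p \<in> U \<and> orthonormal_frame_on A g U e)"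

definition adapted_frame_at ::
    "('a::topological_space, 'e::euclidean_space) atlas \<Rightarrow> nat \<Rightarrow> 'a form \<Rightarrow> ('a vf \<Rightarrow> 'a vf) \<Rightarrow>
     'a \<Rightarrow> nat \<Rightarrow> 'a vf" where
  "adapted_frame_at A n \<omega> J p = (SOME e. \<exists>U. open U \<and> p \<in> U \<and> adapted_frame_on A n \<omega> J U e)"

text \<open>\<open>\<rho>(X,Y) = 1/2 \<Sum>\<^sub>i g(R\<^sub>X\<^sub>,\<^sub>Y e\<^sub>i, J e\<^sub>i)\<close>, a trace and hence independent of the frame.\<close>

definition chern_ricci ::
    "('a::topological_space, 'e::euclidean_space) atlas \<Rightarrow> nat \<Rightarrow> 'a form \<Rightarrow> ('a vf \<Rightarrow> 'a vf) \<Rightarrow>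
     'a connection \<Rightarrow> 'a form" where
  "chern_ricci A n \<omega> J N = (\<lambda>Xs p.
     if length Xs = 2 \<and> set Xs \<subseteq> vfields A then
       (let e = adapted_frame_at A n \<omega> J p in
        (\<Sum>i<2 * n. ak_metric \<omega> J (curvature N (Xs ! 0) (Xs ! 1) (e i)) (J (e i)) p) / 2)
     else 0)"

text \<open>
  \<open>2\<pi>c\<^sub>1(M)\<close> as a class in de Rham cohomology, by Chern--Weil theory for the complex vector bundle
  \<open>(TM, J)\<close>: for a connection \<open>N\<close> with \<open>N J = 0\<close>, the real 2-form representing \<open>2\<pi>c\<^sub>1\<close> is
  \<open>1/2 tr(J \<circ> [N\<^sub>X,N\<^sub>Y] - J \<circ> N\<^sub>[\<^sub>X\<^sub>,\<^sub>Y\<^sub>])\<close>, which is \<open>chern_ricci A n \<omega> J N\<close>. The class depends neither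
  on \<open>N\<close> nor on the compatible \<open>J\<close>, so the following set, the union over all choices, is a single
  de Rham class.
\<close>

definition two_pi_c1 ::
    "('a::topological_space, 'e::euclidean_space) atlas \<Rightarrow> nat \<Rightarrow> 'a form \<Rightarrow> 'a form set" where
  "two_pi_c1 A n \<omega> =
     \<Union>{de_rham_class A 2 (chern_ricci A n \<omega> J N) | J N.
         compatible A \<omega> J \<and> is_connection A N \<and>
         (\<forall>X\<in>vfields A. \<forall>Y\<in>vfields A. N X (J Y) = J (N X Y))}"

definition is_chern_scalar ::
    "('a::topological_space, 'e::euclidean_space) atlas \<Rightarrow> nat \<Rightarrow> 'a form \<Rightarrow> 'a form \<Rightarrow>
     ('a \<Rightarrow> real) \<Rightarrow> bool" where
  "is_chern_scalar A n \<omega> \<rho> s \<longleftrightarrow> s \<in> cinf A \<and>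
     (\<forall>Xs p. length Xs = 2 * n \<and> set Xs \<subseteq> vfields A \<longrightarrow>
        s p * wedge_power \<omega> n Xs p =
        real n * wedge 2 (2 * (n - 1)) \<rho> (wedge_power \<omega> (n - 1)) Xs p)"

text \<open>The codifferential of a 1-form, \<open>\<delta>\<alpha> = - \<Sum>\<^sub>i (D\<^sub>e\<^sub>i \<alpha>)(e\<^sub>i)\<close>, with \<open>D\<close> the Levi-Civita connection
  of \<open>g\<close>.\<close>

definition codiff ::
    "('a::topological_space, 'e::euclidean_space) atlas \<Rightarrow> 'a metric_field \<Rightarrow> 'a connection \<Rightarrow>
     'a form \<Rightarrow> 'a \<Rightarrow> real" where
  "codiff A g D \<alpha> p =
     (let e = orthonormal_frame_at A g p in
      - (\<Sum>i<DIM('e). e i (\<alpha> [e i]) p - \<alpha> [D (e i) (e i)] p))"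

text \<open>On functions the term \<open>d\<delta>\<close> of the Laplacian vanishes. In this sign convention the Laplacian is
  non-negative.\<close>

definition laplacian ::
    "('a::topological_space, 'e::euclidean_space) atlas \<Rightarrow> 'a metric_field \<Rightarrow> 'a connection \<Rightarrow>
     ('a \<Rightarrow> real) \<Rightarrow> 'a \<Rightarrow> real" where
  "laplacian A g D f = codiff A g D (ext_deriv A (zero_form_of f))"

definition norm_df_sq ::
    "('a::topological_space, 'e::euclidean_space) atlas \<Rightarrow> 'a metric_field \<Rightarrow> ('a \<Rightarrow> real) \<Rightarrow>
     'a \<Rightarrow> real" where
  "norm_df_sq A g f p =
     (\<Sum>i<DIM('e). (ext_deriv A (zero_form_of f) [orthonormal_frame_at A g p i] p)\<^sup>2)"

section \<open>Integration against the symplectic volume form\<close>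

text \<open>A vector field whose value at \<open>p\<close> has the coordinate vector \<open>v\<close> in the given chart.\<close>

definition coord_vf ::
    "('a::topological_space, 'e::euclidean_space) atlas \<Rightarrow> ('a, 'e) chart \<Rightarrow> 'a \<Rightarrow> 'e \<Rightarrow> 'a vf" where
  "coord_vf A c p v = (case c of (U, \<phi>) \<Rightarrow>
     (SOME X. X \<in> vfields A \<and>
        (\<forall>f\<in>cinf A. X f p = frechet_derivative (f \<circ> inv_into U \<phi>) (at (\<phi> p)) v)))"

definition basis_list :: "'e::euclidean_space list" where
  "basis_list = (SOME bs. distinct bs \<and> set bs = Basis)"

text \<open>
  \<open>\<integral> h \<omega>\<^sup>n = I\<close> on a compact manifold, by a partition of unity subordinate to finitely many charts.
  The manifold is oriented by \<open>\<omega>\<^sup>n\<close>; this is the reason for the absolute value of the coefficient of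
  \<open>\<omega>\<^sup>n\<close> in the (not necessarily oriented) charts, and makes the order of \<open>basis_list\<close> irrelevant.
\<close>

definition has_symplectic_integral ::
    "('a::topological_space, 'e::euclidean_space) atlas \<Rightarrow> nat \<Rightarrow> 'a form \<Rightarrow> ('a \<Rightarrow> real) \<Rightarrow>
     real \<Rightarrow> bool" where
  "has_symplectic_integral A n \<omega> h I \<longleftrightarrow>
     (\<exists>K w. finite K \<and> K \<subseteq> A \<and>
        (\<forall>c\<in>K. w c \<in> cinf A \<and> (\<forall>p. w c p \<ge> 0) \<and> closure {p. w c p \<noteq> 0} \<subseteq> fst c) \<and>
        (\<forall>p. (\<Sum>c\<in>K. w c p) = 1) \<and>
        I = (\<Sum>c\<in>K. integral (snd c ` fst c) (\<lambda>x.
               let p = inv_into (fst c) (snd c) x in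
               w c p * h p * \<bar>wedge_power \<omega> n (map (coord_vf A c p) basis_list) p\<bar>)))"

section \<open>Hamiltonian symplectomorphisms and Lie subgroups\<close>

definition hamiltonian_vf ::
    "('a::topological_space, 'e::euclidean_space) atlas \<Rightarrow> 'a form \<Rightarrow> ('a \<Rightarrow> real) \<Rightarrow> 'a vf \<Rightarrow> bool"
  where
  "hamiltonian_vf A \<omega> f X \<longleftrightarrow> X \<in> vfields A \<and> f \<in> cinf A \<and>
     (\<forall>Y\<in>vfields A. \<forall>p. \<omega> [X, Y] p = - ext_deriv A (zero_form_of f) [Y] p)"

text \<open>Time-one maps of flows \<open>\<Phi>\<close> of time-dependent Hamiltonians \<open>H\<close>. Taking all of \<open>\<real>\<close> instead of
  \<open>[0,1]\<close> as the time interval gives the same group, by reparametrisation of time.\<close>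

definition Ham ::
    "('a::topological_space, 'e::euclidean_space) atlas \<Rightarrow> 'a form \<Rightarrow> ('a \<Rightarrow> 'a) set" where
  "Ham A \<omega> = {\<phi>. \<exists>H \<Phi> X.
     smooth_map (prod_atlas (euclidean_atlas :: (real, real) atlas) A)
       (euclidean_atlas :: (real, real) atlas) H \<and>
     smooth_map (prod_atlas (euclidean_atlas :: (real, real) atlas) A) A \<Phi> \<and>
     (\<forall>t. hamiltonian_vf A \<omega> (\<lambda>p. H (t, p)) (X t)) \<and>
     (\<forall>p. \<Phi> (0, p) = p) \<and>
     (\<forall>t p. \<forall>f\<in>cinf A. ((\<lambda>s. f (\<Phi> (s, p))) has_real_derivative X t f (\<Phi> (t, p))) (at t)) \<and>
     \<phi> = (\<lambda>p. \<Phi> (1, p))}"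

definition lie_group ::
    "('g::{t2_space,second_countable_topology}, 'k::euclidean_space) atlas \<Rightarrow>
     ('g \<Rightarrow> 'g \<Rightarrow> 'g) \<Rightarrow> 'g \<Rightarrow> ('g \<Rightarrow> 'g) \<Rightarrow> bool" where
  "lie_group B mul one iv \<longleftrightarrow>
     smooth_manifold B \<and> Groups.group mul one iv \<and>
     smooth_map (prod_atlas B B) B (\<lambda>(a, b). mul a b) \<and> smooth_map B B iv"

text \<open>A Lie subgroup of \<open>Ham(M,\<omega>)\<close> is given by a Lie group \<open>'g\<close> and an injective homomorphism \<open>act\<close>
  into \<open>Ham(M,\<omega>)\<close> that is a smooth action; the subgroup itself is \<open>range act\<close>.\<close>

definition lie_subgroup_of_Ham ::
    "('a::topological_space, 'e::euclidean_space) atlas \<Rightarrow> 'a form \<Rightarrow>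
     ('g::{t2_space,second_countable_topology}, 'k::euclidean_space) atlas \<Rightarrow>
     ('g \<Rightarrow> 'g \<Rightarrow> 'g) \<Rightarrow> 'g \<Rightarrow> ('g \<Rightarrow> 'g) \<Rightarrow> ('g \<Rightarrow> 'a \<Rightarrow> 'a) \<Rightarrow> bool" where
  "lie_subgroup_of_Ham A \<omega> B mul one iv act \<longleftrightarrow>
     lie_group B mul one iv \<and>
     inj act \<and> range act \<subseteq> Ham A \<omega> \<and>
     act one = id \<and> (\<forall>a b. act (mul a b) = act a \<circ> act b) \<and>
     smooth_map (prod_atlas B A) A (\<lambda>(a, p). act a p)"

definition lie_algebra ::
    "('g::topological_space, 'k::euclidean_space) atlas \<Rightarrow> ('g \<Rightarrow> 'g \<Rightarrow> 'g) \<Rightarrow> 'g vf set" where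
  "lie_algebra B mul = {\<xi>\<in>vfields B. \<forall>a. vf_push (mul a) \<xi> = \<xi>}"

definition lie_center ::
    "('g::topological_space, 'k::euclidean_space) atlas \<Rightarrow> ('g \<Rightarrow> 'g \<Rightarrow> 'g) \<Rightarrow> 'g vf set" where
  "lie_center B mul =
     {\<xi>\<in>lie_algebra B mul. \<forall>\<eta>\<in>lie_algebra B mul. vf_bracket \<xi> \<eta> = vf_zero}"

text \<open>The vector field on \<open>M\<close> defined by \<open>\<xi>\<close>: its value at \<open>p\<close> is the image of \<open>\<xi>\<^sub>e\<close> under the
  differential of the orbit map \<open>a \<mapsto> a p\<close>, i.e. \<open>d/dt exp(t\<xi>) p\<close> at \<open>t = 0\<close>.\<close>

definition fundamental_vf ::
    "('a::topological_space, 'e::euclidean_space) atlas \<Rightarrow> 'g \<Rightarrow> ('g \<Rightarrow> 'a \<Rightarrow> 'a) \<Rightarrow> 'g vf \<Rightarrow> 'a vf"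
  where
  "fundamental_vf A one act \<xi> = (\<lambda>f p. if f \<in> cinf A then \<xi> (\<lambda>a. f (act a p)) one else 0)"

section \<open>Generalized almost-Kaehler--Ricci solitons\<close>

text \<open>Here \<open>V\<close> is the vector field on \<open>M\<close> defined by the element \<open>\<xi>\<close> of the Lie algebra.\<close>

definition is_potential ::
    "('a::topological_space, 'e::euclidean_space) atlas \<Rightarrow> nat \<Rightarrow> 'a form \<Rightarrow> 'a vf \<Rightarrow>
     ('a \<Rightarrow> real) \<Rightarrow> bool" where
  "is_potential A n \<omega> V f \<longleftrightarrow>
     hamiltonian_vf A \<omega> f V \<and> has_symplectic_integral A n \<omega> (\<lambda>p. f p * exp (- 2 * f p)) 0"

definition GeAKRS ::
    "('a::topological_space, 'e::euclidean_space) atlas \<Rightarrow> nat \<Rightarrow> 'a form \<Rightarrow> ('a vf \<Rightarrow> 'a vf) \<Rightarrow>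
     'a vf \<Rightarrow> bool" where
  "GeAKRS A n \<omega> J V \<longleftrightarrow>
     (let g = ak_metric \<omega> J in
      \<exists>D s f.
        levi_civita A g D \<and>
        is_chern_scalar A n \<omega> (chern_ricci A n \<omega> J (canonical_hermitian J D)) s \<and>
        is_potential A n \<omega> V f \<and>
        (\<forall>p. s p - real n - 2 * laplacian A g D f p + 2 * f p - 2 * norm_df_sq A g f p = 0))"

end

theory Submission
  imports Defs "HOL-Library.Function_Algebras"
begin

text \<open>
  Suppose \<open>\<lambda> \<le> 0\<close>. Let \<open>V\<close> be the vector field of \<open>\<xi>\<close> and \<open>f\<close> its potential, so that \<open>V\<close> is \<open>J\<close> times the
  gradient of \<open>f\<close>; let \<open>N\<close> be the canonical Hermitian connection and \<open>\<rho>\<close> its Chern--Ricci form.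

  The form \<open>\<rho>\<close> is \<open>- 1/2\<close> times the trace of \<open>J\<close> with the curvature. It is closed by the Bianchi identity
  (\<open>chern_ricci_closed\<close>), so the monotonicity gives a 1-form \<open>\<alpha>\<close> with \<open>\<rho> = \<lambda>\<omega> + d\<alpha>\<close>. The field \<open>V\<close> preserves \<open>J\<close>,
  \<open>\<omega>\<close> and hence \<open>N\<close>. By equivariant Chern--Weil theory the function \<open>\<mu> = - 1/2 tr (J (L\<^sub>V - N\<^sub>V))\<close> is then a
  moment map of \<open>V\<close> for \<open>\<rho>\<close> (\<open>mu_derivative\<close>). At a critical point of \<open>f\<close> it is half of the non-negative
  Laplacian of \<open>f\<close> (\<open>mu_at_zero\<close>), hence \<open>\<mu> \<ge> 0\<close> at a maximum \<open>p\<close> and \<open>\<mu> \<le> 0\<close> at a minimum \<open>q\<close>.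

  The function \<open>u = \<mu> - \<lambda>f\<close> is a moment map of \<open>V\<close> for the exact form \<open>d\<alpha>\<close>, that is, \<open>du = - \<iota>\<^sub>V d\<alpha>\<close>. It takes the
  same value at any two zeros of \<open>V\<close> that are joined by a curve \<open>\<gamma>\<close> (\<open>linked_zeros\<close>). Indeed, let \<open>H(a)\<close> be the
  integral of \<open>\<alpha>\<close> over the translate of \<open>\<gamma>\<close> by \<open>a \<in> G\<close>. Since \<open>d\<alpha>\<close> is \<open>G\<close>-invariant, Cartan's formula shows that
  the derivative of \<open>H\<close> in the direction of \<open>\<xi>\<close> is the constant \<open>u(\<gamma>(0)) - u(\<gamma>(1))\<close>; and it is zero where the
  continuous function \<open>H\<close> on the compact group \<open>G\<close> attains its maximum.

  Therefore \<open>\<mu>(p) - \<mu>(q) = \<lambda> (f(p) - f(q)) \<le> 0\<close>, which leaves only \<open>\<mu>(p) = 0\<close>. The Hessian of \<open>f\<close> at the maximum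
  \<open>p\<close> is negative semidefinite with trace zero, so it vanishes, and with it the first jet of \<open>V\<close> at \<open>p\<close>
  (\<open>flat_at_degenerate_maximum\<close>). Being a Killing field, \<open>V\<close> satisfies a linear equation of second order along
  curves, and so it vanishes on the component of \<open>p\<close> (\<open>flat_along_curve\<close>). For a component on which \<open>V\<close> is not
  zero this is a contradiction.

  The tensor calculus is carried out in the algebra of derivations of \<open>C\<^sup>\<infinity>(M)\<close>. On a compact manifold there are
  finitely many functions \<open>x\<^sub>i\<close> and vector fields \<open>E\<^sub>i\<close> with \<open>X f = \<Sum>\<^sub>i X(x\<^sub>i) E\<^sub>i f\<close> for all \<open>X\<close> and \<open>f\<close> (\<open>dual_basis\<close>, by
  Hadamard's lemma and a partition of unity). In such a dual basis traces, forms and their pull-backs are finite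
  sums of products of smooth functions, and coordinates are needed for analytic facts only.
\<close>

section \<open>Calculus of smooth functions\<close>

lemma Ck_on_subset: "Ck_on k S f \<Longrightarrow> T \<subseteq> S \<Longrightarrow> Ck_on k T f"
proof (induction k arbitrary: f)
  case 0
  then show ?case by (auto intro: continuous_on_subset)
next
  case (Suc k)
  then show ?case unfolding Ck_on.simps by blast
qed

lemma Ck_on_cong:
  assumes "open S" "\<And>x. x \<in> S \<Longrightarrow> f x = g x" "Ck_on k S f"
  shows "Ck_on k S g"
proof (cases k)
  case 0
  then show ?thesis using assms by (simp cong: continuous_on_cong)
next
  case (Suc m)
  from assms(3) obtain f' where f': "\<And>x. x \<in> S \<Longrightarrow> (f has_derivative f' x) (at x)" "\<And>v. Ck_on m S (\<lambda>x. f' x v)"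
    unfolding Suc by auto
  have "(g has_derivative f' x) (at x)" if "x \<in> S" for x
    using has_derivative_transform_within_open[OF f'(1)[OF that] assms(1) that] assms(2) by auto
  then show ?thesis using f'(2) unfolding Suc by auto
qed

lemma Ck_on_imp_continuous_on: "Ck_on k S f \<Longrightarrow> continuous_on S f"
  by (cases k) (auto intro!: continuous_at_imp_continuous_on dest: has_derivative_continuous)

lemma Ck_on_SucI:
  "(\<And>x. x \<in> S \<Longrightarrow> (f has_derivative f' x) (at x)) \<Longrightarrow> (\<And>v. Ck_on k S (\<lambda>x. f' x v)) \<Longrightarrow> Ck_on (Suc k) S f"
  unfolding Ck_on.simps by (intro exI[of _ f'] conjI ballI allI)

lemma Ck_on_SucE:
  assumes "Ck_on (Suc k) S f"
  obtains f' where "\<And>x. x \<in> S \<Longrightarrow> (f has_derivative f' x) (at x)" "\<And>v. Ck_on k S (\<lambda>x. f' x v)"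
  using assms unfolding Ck_on.simps by blast

lemma Ck_on_SucD: "Ck_on (Suc k) S f \<Longrightarrow> Ck_on k S f"
proof (induction k arbitrary: f)
  case 0
  then show ?case using Ck_on_imp_continuous_on[of "Suc 0" S f] by simp
next
  case (Suc k)
  obtain f' where f': "\<And>x. x \<in> S \<Longrightarrow> (f has_derivative f' x) (at x)" "\<And>v. Ck_on (Suc k) S (\<lambda>x. f' x v)"
    by (rule Ck_on_SucE[OF Suc.prems]) (rule that)
  show ?case by (rule Ck_on_SucI[OF f'(1) Suc.IH[OF f'(2)]])
qed

lemma Ck_on_Suc_iff:
  assumes "open S"
  shows "Ck_on (Suc k) S f \<longleftrightarrow>
    (\<forall>x\<in>S. f differentiable (at x)) \<and> (\<forall>v. Ck_on k S (\<lambda>x. frechet_derivative f (at x) v))"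
proof
  assume "Ck_on (Suc k) S f"
  then obtain f' where f': "\<And>x. x \<in> S \<Longrightarrow> (f has_derivative f' x) (at x)"
      "\<And>v. Ck_on k S (\<lambda>x. f' x v)"
    by (rule Ck_on_SucE) (rule that)
  have "Ck_on k S (\<lambda>x. frechet_derivative f (at x) v)" for v
    by (rule Ck_on_cong[OF assms _ f'(2)[of v]]) (simp add: frechet_derivative_at[OF f'(1)])
  then show "(\<forall>x\<in>S. f differentiable (at x)) \<and> (\<forall>v. Ck_on k S (\<lambda>x. frechet_derivative f (at x) v))"
    using f'(1) by (auto simp: differentiable_def)
next
  assume "(\<forall>x\<in>S. f differentiable (at x)) \<and> (\<forall>v. Ck_on k S (\<lambda>x. frechet_derivative f (at x) v))"
  then show "Ck_on (Suc k) S f"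
    by (auto simp: frechet_derivative_works intro!: exI[of _ "\<lambda>x. frechet_derivative f (at x)"])
qed

text \<open>The derivative in \<open>Ck_on\<close> is quantified existentially, so local derivatives are glued through
  the unique Frechet derivative.\<close>

lemma Ck_on_local:
  assumes "\<And>x. x \<in> S \<Longrightarrow> \<exists>T. open T \<and> x \<in> T \<and> Ck_on k T f"
  shows "Ck_on k S f"
  using assms
proof (induction k arbitrary: f)
  case 0
  then show ?case
    by (metis Ck_on.simps(1) continuous_at_imp_continuous_on continuous_on_eq_continuous_at)
next
  case (Suc k)
  have "(f has_derivative frechet_derivative f (at x)) (at x)" if "x \<in> S" for x
    using Suc.prems[OF that] by (auto simp: Ck_on_Suc_iff frechet_derivative_works simp del: Ck_on.simps)
  moreover have "Ck_on k S (\<lambda>x. frechet_derivative f (at x) v)" for v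
  proof (rule Suc.IH)
    fix x assume "x \<in> S"
    then obtain T where "open T" "x \<in> T" "Ck_on (Suc k) T f" using Suc.prems by blast
    then show "\<exists>T. open T \<and> x \<in> T \<and> Ck_on k T (\<lambda>x. frechet_derivative f (at x) v)"
      using Ck_on_Suc_iff by blast
  qed
  ultimately show ?case by (intro Ck_on_SucI) auto
qed

lemma Ck_on_const: "Ck_on k S (\<lambda>x. c)"
proof (induction k arbitrary: c)
  case (Suc k)
  show ?case using Suc by (auto intro!: exI[of _ "\<lambda>x v. 0"])
qed simp

lemma Ck_on_bounded_linear:
  assumes L: "bounded_linear L" and "Ck_on k S f"
  shows "Ck_on k S (\<lambda>x. L (f x))"
  using assms(2)
proof (induction k arbitrary: f)
  case 0
  then show ?case using bounded_linear.continuous_on[OF L] by auto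
next
  case (Suc k)
  obtain f' where f': "\<And>x. x \<in> S \<Longrightarrow> (f has_derivative f' x) (at x)"
      "\<And>v. Ck_on k S (\<lambda>x. f' x v)"
    by (rule Ck_on_SucE[OF Suc.prems]) (rule that)
  then have "\<And>x. x \<in> S \<Longrightarrow> ((\<lambda>x. L (f x)) has_derivative (\<lambda>v. L (f' x v))) (at x)"
    using bounded_linear.has_derivative[OF L] by blast
  then show ?case using Suc.IH f'(2) by (intro Ck_on_SucI) auto
qed

lemma Ck_on_id: "Ck_on k S (\<lambda>x. x)"
proof (cases k)
  case (Suc m)
  then show ?thesis by (auto intro!: exI[of _ "\<lambda>x v. v"] Ck_on_const)
qed simp

lemma Ck_on_add: "Ck_on k S f \<Longrightarrow> Ck_on k S g \<Longrightarrow> Ck_on k S (\<lambda>x. f x + g x)"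
proof (induction k arbitrary: f g)
  case 0
  then show ?case by (auto intro: continuous_on_add)
next
  case (Suc k)
  obtain f' where f': "\<And>x. x \<in> S \<Longrightarrow> (f has_derivative f' x) (at x)" "\<And>v. Ck_on k S (\<lambda>x. f' x v)"
    by (rule Ck_on_SucE[OF Suc.prems(1)]) (rule that)
  obtain g' where g': "\<And>x. x \<in> S \<Longrightarrow> (g has_derivative g' x) (at x)" "\<And>v. Ck_on k S (\<lambda>x. g' x v)"
    by (rule Ck_on_SucE[OF Suc.prems(2)]) (rule that)
  show ?case
    by (rule Ck_on_SucI[of _ _ "\<lambda>x v. f' x v + g' x v"]) (rule has_derivative_add f' g' Suc.IH | assumption)+
qed

lemma Ck_on_scaleR:
  fixes f :: "'e::real_normed_vector \<Rightarrow> real"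
  shows "Ck_on k S f \<Longrightarrow> Ck_on k S g \<Longrightarrow> Ck_on k S (\<lambda>x. f x *\<^sub>R g x)"
proof (induction k arbitrary: f g)
  case 0
  then show ?case by (auto intro: continuous_on_scaleR)
next
  case (Suc k)
  obtain f' where f': "\<And>x. x \<in> S \<Longrightarrow> (f has_derivative f' x) (at x)" "\<And>v. Ck_on k S (\<lambda>x. f' x v)"
    by (rule Ck_on_SucE[OF Suc.prems(1)]) (rule that)
  obtain g' where g': "\<And>x. x \<in> S \<Longrightarrow> (g has_derivative g' x) (at x)" "\<And>v. Ck_on k S (\<lambda>x. g' x v)"
    by (rule Ck_on_SucE[OF Suc.prems(2)]) (rule that)
  have "Ck_on k S (\<lambda>x. f x *\<^sub>R g' x v + f' x v *\<^sub>R g x)" for v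
    by (intro Ck_on_add Suc.IH f' g' Ck_on_SucD[OF Suc.prems(1)] Ck_on_SucD[OF Suc.prems(2)])
  then show ?case
    by (rule Ck_on_SucI[of _ _ "\<lambda>x v. f x *\<^sub>R g' x v + f' x v *\<^sub>R g x", rotated])
      (rule has_derivative_scaleR f' g' | assumption)+
qed

lemma Ck_on_sum:
  "(\<And>i. i \<in> I \<Longrightarrow> Ck_on k S (f i)) \<Longrightarrow> Ck_on k S (\<lambda>x. \<Sum>i\<in>I. f i x)"
  by (induction I rule: infinite_finite_induct) (auto intro: Ck_on_const Ck_on_add)

text \<open>By the chain rule the derivative is a bilinear expression in \<open>f'\<close> and \<open>F' \<circ> f\<close>. Expanding \<open>f'\<close> in the
  basis turns it into products to which the induction hypothesis applies.\<close>

lemma Ck_on_compose: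
  fixes f :: "'e::real_normed_vector \<Rightarrow> 'f::euclidean_space"
  assumes "Ck_on k T F" "Ck_on k S f" "f ` S \<subseteq> T"
  shows "Ck_on k S (\<lambda>x. F (f x))"
  using assms(1,2)
proof (induction k arbitrary: F)
  case 0
  then show ?case using assms(3) by (auto intro: continuous_on_compose2)
next
  case (Suc k)
  obtain f' where f': "\<And>x. x \<in> S \<Longrightarrow> (f has_derivative f' x) (at x)" "\<And>v. Ck_on k S (\<lambda>x. f' x v)"
    by (rule Ck_on_SucE[OF Suc.prems(2)]) (rule that)
  obtain F' where F': "\<And>y. y \<in> T \<Longrightarrow> (F has_derivative F' y) (at y)" "\<And>v. Ck_on k T (\<lambda>y. F' y v)"
    by (rule Ck_on_SucE[OF Suc.prems(1)]) (rule that)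
  have expand: "F' (f x) (f' x v) = (\<Sum>b\<in>Basis. (f' x v \<bullet> b) *\<^sub>R F' (f x) b)" if "x \<in> S" for x v
  proof -
    have "linear (F' (f x))"
      using F'(1)[of "f x"] that assms(3) by (auto intro: has_derivative_linear)
    from linear_sum[OF this, of "\<lambda>b. (f' x v \<bullet> b) *\<^sub>R b" Basis] show ?thesis
      by (simp add: euclidean_representation linear_scale[OF \<open>linear _\<close>])
  qed
  have "((\<lambda>x. F (f x)) has_derivative (\<lambda>v. \<Sum>b\<in>Basis. (f' x v \<bullet> b) *\<^sub>R F' (f x) b)) (at x)"
    if "x \<in> S" for x
  proof -
    have "(F \<circ> f has_derivative F' (f x) \<circ> f' x) (at x)"
      using f'(1)[OF that] F'(1)[of "f x"] that assms(3) by (intro diff_chain_at) auto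
    then show ?thesis using expand[OF that] by (simp add: o_def)
  qed
  moreover have "Ck_on k S (\<lambda>x. \<Sum>b\<in>Basis. (f' x v \<bullet> b) *\<^sub>R F' (f x) b)" for v
    by (intro Ck_on_sum Ck_on_scaleR Suc.IH f' F' Ck_on_SucD[OF Suc.prems(2)]
        Ck_on_bounded_linear[OF bounded_linear_inner_left])
  ultimately show ?case by (intro Ck_on_SucI) auto
qed

lemma Ck_on_Pair:
  assumes "Ck_on k S f" "Ck_on k S g"
  shows "Ck_on k S (\<lambda>x. (f x, g x))"
proof -
  have "Ck_on k S (\<lambda>x. (f x, 0) + (0, g x))"
    by (intro Ck_on_add Ck_on_bounded_linear[OF _ assms(1), of "\<lambda>y. (y, 0)"]
        Ck_on_bounded_linear[OF _ assms(2), of "\<lambda>y. (0, y)"] bounded_linear_Pair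
        bounded_linear_ident bounded_linear_zero)
  then show ?thesis by simp
qed

text \<open>Covers \<open>1/x\<close> and \<open>1/\<surd>x\<close>, which normalise partitions of unity and orthonormal frames.\<close>

lemma Ck_on_powr: "Ck_on k {0<..} (\<lambda>x::real. x powr a)"
proof (induction k arbitrary: a)
  case 0
  show ?case unfolding Ck_on.simps by (intro continuous_on_powr continuous_on_id continuous_on_const ballI) simp
next
  case (Suc k)
  have "((\<lambda>x. x powr a) has_derivative (\<lambda>v. (a * x powr (a - 1)) * v)) (at x)" if "x > 0" for x
    using has_real_derivative_powr[OF that, of a] by (simp add: has_field_derivative_def)
  moreover have "Ck_on k {0<..} (\<lambda>x. (a * x powr (a - 1)) * v)" for v :: real
    using Ck_on_bounded_linear[OF bounded_linear_mult_right[of "a * v"] Suc[of "a - 1"]]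
    by (simp add: mult_ac)
  ultimately show ?case by (intro Ck_on_SucI) auto
qed

lemma smooth_on_subset: "smooth_on S f \<Longrightarrow> T \<subseteq> S \<Longrightarrow> smooth_on T f"
  by (auto simp: smooth_on_def intro: Ck_on_subset)

lemma smooth_on_cong:
  "open S \<Longrightarrow> (\<And>x. x \<in> S \<Longrightarrow> f x = g x) \<Longrightarrow> smooth_on S f \<Longrightarrow> smooth_on S g"
  unfolding smooth_on_def using Ck_on_cong[of S f g] by blast

lemma smooth_on_local:
  "(\<And>x. x \<in> S \<Longrightarrow> \<exists>T. open T \<and> x \<in> T \<and> smooth_on T f) \<Longrightarrow> smooth_on S f"
  unfolding smooth_on_def by (intro allI Ck_on_local) blast

lemma smooth_on_imp_continuous_on: "smooth_on S f \<Longrightarrow> continuous_on S f"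
  unfolding smooth_on_def using Ck_on_imp_continuous_on by blast

lemma smooth_on_const: "smooth_on S (\<lambda>x. c)"
  unfolding smooth_on_def by (intro allI Ck_on_const)

lemma smooth_on_id: "smooth_on S (\<lambda>x. x)"
  unfolding smooth_on_def by (intro allI Ck_on_id)

lemma smooth_on_bounded_linear:
  "bounded_linear L \<Longrightarrow> smooth_on S f \<Longrightarrow> smooth_on S (\<lambda>x. L (f x))"
  unfolding smooth_on_def by (intro allI Ck_on_bounded_linear[of L]) auto

lemma smooth_on_add: "smooth_on S f \<Longrightarrow> smooth_on S g \<Longrightarrow> smooth_on S (\<lambda>x. f x + g x)"
  unfolding smooth_on_def by (intro allI Ck_on_add) auto

lemma smooth_on_scaleR:
  fixes f :: "'e::real_normed_vector \<Rightarrow> real"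
  shows "smooth_on S f \<Longrightarrow> smooth_on S g \<Longrightarrow> smooth_on S (\<lambda>x. f x *\<^sub>R g x)"
  unfolding smooth_on_def by (intro allI Ck_on_scaleR) auto

lemma smooth_on_mult:
  fixes f g :: "'e::real_normed_vector \<Rightarrow> real"
  shows "smooth_on S f \<Longrightarrow> smooth_on S g \<Longrightarrow> smooth_on S (\<lambda>x. f x * g x)"
  using smooth_on_scaleR[of S f g] by simp

lemma smooth_on_sum:
  "(\<And>i. i \<in> I \<Longrightarrow> smooth_on S (f i)) \<Longrightarrow> smooth_on S (\<lambda>x. \<Sum>i\<in>I. f i x)"
  unfolding smooth_on_def by (intro allI Ck_on_sum) auto

lemma smooth_on_diff:
  fixes f g :: "'e::real_normed_vector \<Rightarrow> 'f::real_normed_vector"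
  assumes "smooth_on S f" "smooth_on S g"
  shows "smooth_on S (\<lambda>x. f x - g x)"
  using smooth_on_add[OF assms(1) smooth_on_bounded_linear[OF bounded_linear_minus[OF bounded_linear_ident] assms(2)]]
  by simp

lemma smooth_on_compose:
  fixes f :: "'e::real_normed_vector \<Rightarrow> 'f::euclidean_space"
  shows "smooth_on T F \<Longrightarrow> smooth_on S f \<Longrightarrow> f ` S \<subseteq> T \<Longrightarrow> smooth_on S (\<lambda>x. F (f x))"
  unfolding smooth_on_def by (intro allI) (rule Ck_on_compose, blast+)

lemma smooth_on_Pair: "smooth_on S f \<Longrightarrow> smooth_on S g \<Longrightarrow> smooth_on S (\<lambda>x. (f x, g x))"
  unfolding smooth_on_def by (intro allI Ck_on_Pair) auto

lemma smooth_on_powr: "smooth_on {0<..} (\<lambda>x::real. x powr a)"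
  unfolding smooth_on_def by (intro allI Ck_on_powr)

abbreviation dir_deriv :: "('e::real_normed_vector \<Rightarrow> 'f::real_normed_vector) \<Rightarrow> 'e \<Rightarrow> 'e \<Rightarrow> 'f" where
  "dir_deriv f v x \<equiv> frechet_derivative f (at x) v"

lemma smooth_on_dir_deriv:
  assumes "open S" "smooth_on S f"
  shows "smooth_on S (dir_deriv f v)"
  using assms(2) Ck_on_Suc_iff[OF assms(1)] unfolding smooth_on_def by blast

lemma smooth_on_has_derivative:
  assumes "open S" "smooth_on S f" "x \<in> S"
  shows "(f has_derivative frechet_derivative f (at x)) (at x)"
proof -
  have "Ck_on (Suc 0) S f" using assms(2) by (simp only: smooth_on_def)
  then show ?thesis using Ck_on_Suc_iff[OF assms(1)] assms(3) frechet_derivative_works by blast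
qed

lemma smooth_on_line_derivative:
  fixes f :: "'e::real_normed_vector \<Rightarrow> real"
  assumes "open S" "smooth_on S f" "x + t *\<^sub>R v \<in> S"
  shows "((\<lambda>t. f (x + t *\<^sub>R v)) has_real_derivative dir_deriv f v (x + t *\<^sub>R v)) (at t)"
proof -
  let ?F = "frechet_derivative f (at (x + t *\<^sub>R v))"
  have F: "(f has_derivative ?F) (at (x + t *\<^sub>R v))"
    by (rule smooth_on_has_derivative[OF assms])
  have "((\<lambda>t. x + t *\<^sub>R v) has_derivative (\<lambda>h. h *\<^sub>R v)) (at t)"
    by (auto intro!: derivative_eq_intros)
  from diff_chain_at[OF this F]
  have "((\<lambda>t. f (x + t *\<^sub>R v)) has_derivative (\<lambda>h. ?F (h *\<^sub>R v))) (at t)"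
    by (simp add: o_def)
  moreover have "?F (h *\<^sub>R v) = ?F v * h" for h
    using linear_scale[OF has_derivative_linear[OF F]] by simp
  ultimately show ?thesis by (simp add: has_field_derivative_def)
qed

text \<open>The mean value theorem, applied first in direction \<open>v\<close> and then in direction \<open>w\<close>. The left-hand side
  is symmetric in \<open>v\<close> and \<open>w\<close>, which yields the symmetry of second derivatives in the limit.\<close>

lemma second_difference:
  fixes f :: "'e::real_normed_vector \<Rightarrow> real"
  assumes S: "open S" and f: "smooth_on S f" and h: "h > 0"
    and sub: "\<And>s t. s \<in> {0..h} \<Longrightarrow> t \<in> {0..h} \<Longrightarrow> x + s *\<^sub>R v + t *\<^sub>R w \<in> S"
  shows "\<exists>s\<in>{0..h}. \<exists>t\<in>{0..h}. f (x + h *\<^sub>R v + h *\<^sub>R w) - f (x + h *\<^sub>R v) - f (x + h *\<^sub>R w) + f x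
    = h * h * dir_deriv (dir_deriv f v) w (x + s *\<^sub>R v + t *\<^sub>R w)"
proof -
  let ?\<phi> = "\<lambda>s. f ((x + h *\<^sub>R w) + s *\<^sub>R v) - f (x + s *\<^sub>R v)"
  have "\<exists>s>0. s < h \<and> ?\<phi> h - ?\<phi> 0
      = (h - 0) * (dir_deriv f v ((x + h *\<^sub>R w) + s *\<^sub>R v) - dir_deriv f v (x + s *\<^sub>R v))"
    using sub[of _ h] sub[of _ 0] h
    by (intro MVT2 h DERIV_diff smooth_on_line_derivative[OF S f]) (auto simp: algebra_simps)
  then obtain s where s: "0 < s" "s < h" and 1: "?\<phi> h - ?\<phi> 0
      = h * (dir_deriv f v ((x + h *\<^sub>R w) + s *\<^sub>R v) - dir_deriv f v (x + s *\<^sub>R v))"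
    by auto
  let ?\<psi> = "\<lambda>t. dir_deriv f v ((x + s *\<^sub>R v) + t *\<^sub>R w)"
  have "\<exists>t>0. t < h \<and> ?\<psi> h - ?\<psi> 0 = (h - 0) * dir_deriv (dir_deriv f v) w ((x + s *\<^sub>R v) + t *\<^sub>R w)"
    using sub s h
    by (intro MVT2 h smooth_on_line_derivative[OF S smooth_on_dir_deriv[OF S f]]) auto
  then obtain t where "0 < t" "t < h"
      "?\<psi> h - ?\<psi> 0 = h * dir_deriv (dir_deriv f v) w ((x + s *\<^sub>R v) + t *\<^sub>R w)"
    by auto
  with 1 s show ?thesis
    by (intro bexI[of _ s] bexI[of _ t]) (auto simp: algebra_simps)
qed

lemma dir_deriv_commute:
  fixes f :: "'e::real_normed_vector \<Rightarrow> real"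
  assumes S: "open S" and f: "smooth_on S f" and x: "x \<in> S"
  shows "dir_deriv (dir_deriv f v) w x = dir_deriv (dir_deriv f w) v x"
proof (rule ccontr)
  let ?G = "dir_deriv (dir_deriv f v) w" and ?K = "dir_deriv (dir_deriv f w) v"
  assume ne: "?G x \<noteq> ?K x"
  define e where "e = \<bar>?G x - ?K x\<bar> / 2"
  have e: "e > 0" using ne by (simp add: e_def)
  have "continuous_on S ?G" "continuous_on S ?K"
    by (intro smooth_on_imp_continuous_on smooth_on_dir_deriv S f)+
  then have "isCont ?G x" "isCont ?K x" using S x by (auto simp: continuous_on_eq_continuous_at)
  then obtain d1 d2 where d: "d1 > 0" "d2 > 0"
    and d1: "\<And>y. dist y x < d1 \<Longrightarrow> dist (?G y) (?G x) < e"
    and d2: "\<And>y. dist y x < d2 \<Longrightarrow> dist (?K y) (?K x) < e"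
    using e unfolding continuous_at_eps_delta by metis
  obtain d3 where d3: "d3 > 0" "ball x d3 \<subseteq> S" using S x by (auto simp: open_contains_ball)
  define d where "d = min d1 (min d2 d3)"
  define h where "h = d / (2 * (norm v + norm w + 1))"
  have N: "norm v + norm w + 1 > 0" by (smt (verit) norm_ge_zero)
  have "d > 0" using d d3 by (simp add: d_def)
  then have h: "h > 0" using N by (simp add: h_def)
  have near: "dist (x + s *\<^sub>R v + t *\<^sub>R w) x < d" if "s \<in> {0..h}" "t \<in> {0..h}" for s t
  proof -
    have "dist (x + s *\<^sub>R v + t *\<^sub>R w) x = norm (s *\<^sub>R v + t *\<^sub>R w)"
      by (simp add: dist_norm algebra_simps)
    also have "\<dots> \<le> norm (s *\<^sub>R v) + norm (t *\<^sub>R w)"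
      by (rule norm_triangle_ineq)
    also have "\<dots> \<le> h * norm v + h * norm w"
      using that by (intro add_mono) (auto intro!: mult_right_mono)
    also have "\<dots> \<le> h * (norm v + norm w + 1)" using h by (simp add: algebra_simps)
    also have "\<dots> = d / 2" unfolding h_def using N by (simp add: field_simps)
    also have "\<dots> < d" using \<open>d > 0\<close> by simp
    finally show ?thesis .
  qed
  then have sub: "x + s *\<^sub>R v + t *\<^sub>R w \<in> S" "x + t *\<^sub>R w + s *\<^sub>R v \<in> S"
    if "s \<in> {0..h}" "t \<in> {0..h}" for s t
    using d3(2) that by (fastforce simp: d_def dist_commute ac_simps)+
  obtain s t where st: "s \<in> {0..h}" "t \<in> {0..h}"
    and 1: "f (x + h *\<^sub>R v + h *\<^sub>R w) - f (x + h *\<^sub>R v) - f (x + h *\<^sub>R w) + f x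
      = h * h * ?G (x + s *\<^sub>R v + t *\<^sub>R w)"
    using second_difference[OF S f h, of x v w] sub(1) by blast
  obtain s' t' where st': "s' \<in> {0..h}" "t' \<in> {0..h}"
    and 2: "f (x + h *\<^sub>R w + h *\<^sub>R v) - f (x + h *\<^sub>R w) - f (x + h *\<^sub>R v) + f x
      = h * h * ?K (x + t' *\<^sub>R w + s' *\<^sub>R v)"
    using second_difference[OF S f h, of x w v] sub(2) by blast
  have "h * h * ?G (x + s *\<^sub>R v + t *\<^sub>R w) = h * h * ?K (x + s' *\<^sub>R v + t' *\<^sub>R w)"
    using 1 2 by (simp add: algebra_simps del: mult_eq_0_iff mult_cancel_left)
  then have "?G (x + s *\<^sub>R v + t *\<^sub>R w) = ?K (x + s' *\<^sub>R v + t' *\<^sub>R w)" using h by simp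
  then show False
    using d1[of "x + s *\<^sub>R v + t *\<^sub>R w"] d2[of "x + s' *\<^sub>R v + t' *\<^sub>R w"] near[OF st] near[OF st']
    unfolding e_def d_def dist_real_def by (smt (verit) field_sum_of_halves)
qed

text \<open>Every differentiation in \<open>y\<close> produces one more factor \<open>t\<close>; the power \<open>t\<^sup>m\<close> makes the statement
  inductive.\<close>

lemma Ck_on_radial_integral:
  fixes F :: "'e::euclidean_space \<Rightarrow> real"
  assumes "open S" "convex S" "y0 \<in> S" "Ck_on k S F"
  shows "Ck_on k S (\<lambda>y. integral (cbox 0 1) (\<lambda>t::real. t ^ m * F (y0 + t *\<^sub>R (y - y0))))"
  using assms(4)
proof (induction k arbitrary: F m)
  have seg: "y0 + t *\<^sub>R (y - y0) \<in> S" if "y \<in> S" "t \<in> cbox 0 1" for y and t :: real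
    using convexD_alt[OF assms(2,3) that(1), of t] that(2) by (simp add: algebra_simps)
  {
    case 0
    have "continuous_on (S \<times> cbox 0 1) (\<lambda>(y, t::real). t ^ m * F (y0 + t *\<^sub>R (y - y0)))"
      unfolding split_beta using 0 seg
      by (auto intro!: continuous_intros continuous_on_compose2[of S F])
    then show ?case unfolding Ck_on.simps by (rule integral_continuous_on_param)
  next
    case (Suc k)
    obtain F' where F': "\<And>x. x \<in> S \<Longrightarrow> (F has_derivative F' x) (at x)" "\<And>v. Ck_on k S (\<lambda>x. F' x v)"
      by (rule Ck_on_SucE[OF Suc.prems]) (rule that)
    let ?fx = "\<lambda>y t::real. Blinfun (\<lambda>v. t ^ Suc m * F' (y0 + t *\<^sub>R (y - y0)) v)"
    have bl: "bounded_linear (\<lambda>v. t ^ Suc m * F' (y0 + t *\<^sub>R (y - y0)) v)"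
      if "y \<in> S" "t \<in> cbox 0 1" for y t
      using has_derivative_bounded_linear[OF F'(1)[OF seg[OF that]]]
      by (intro bounded_linear_const_mult)
    have app: "blinfun_apply (?fx y t) v = t ^ Suc m * F' (y0 + t *\<^sub>R (y - y0)) v"
      if "y \<in> S" "t \<in> cbox 0 1" for y t v
      using bounded_linear_Blinfun_apply[OF bl[OF that]] by simp
    have der: "((\<lambda>y. t ^ m * F (y0 + t *\<^sub>R (y - y0))) has_derivative blinfun_apply (?fx y t)) (at y within S)"
      if "y \<in> S" "t \<in> cbox 0 1" for y t
    proof -
      let ?D = "F' (y0 + t *\<^sub>R (y - y0))"
      have 1: "((\<lambda>y. y0 + t *\<^sub>R (y - y0)) has_derivative (\<lambda>v. t *\<^sub>R v)) (at y)"
        by (auto intro!: derivative_eq_intros)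
      have "((\<lambda>y. F (y0 + t *\<^sub>R (y - y0))) has_derivative (\<lambda>v. ?D (t *\<^sub>R v))) (at y)"
        using diff_chain_at[OF 1 F'(1)[OF seg[OF that]]] by (simp add: o_def)
      then have "((\<lambda>y. t ^ m * F (y0 + t *\<^sub>R (y - y0))) has_derivative (\<lambda>v. t ^ m * ?D (t *\<^sub>R v))) (at y)"
        by (intro has_derivative_mult_right)
      moreover have "(\<lambda>v. t ^ m * ?D (t *\<^sub>R v)) = blinfun_apply (?fx y t)"
        using app[OF that] linear_scale[OF has_derivative_linear[OF F'(1)[OF seg[OF that]]]]
        by (auto simp: fun_eq_iff)
      ultimately show ?thesis by (simp add: has_derivative_at_withinI)
    qed
    have contF: "continuous_on S F"
      using Suc.prems Ck_on_imp_continuous_on by blast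
    have int: "(\<lambda>t. t ^ m * F (y0 + t *\<^sub>R (y - y0))) integrable_on cbox 0 1" if "y \<in> S" for y
      using seg[OF that]
      by (intro integrable_continuous continuous_intros continuous_on_compose2[OF contF]) auto
    have cont_v: "continuous_on (S \<times> cbox 0 1) (\<lambda>z. snd z ^ Suc m * F' (y0 + snd z *\<^sub>R (fst z - y0)) v)" for v
    proof -
      have "continuous_on S (\<lambda>x. F' x v)"
        using F'(2) Ck_on_imp_continuous_on by blast
      then show ?thesis using seg
        by (auto intro!: continuous_intros continuous_on_compose2[of S "\<lambda>x. F' x v"])
    qed
    have cont: "continuous_on (S \<times> cbox 0 1) (\<lambda>(y, t). ?fx y t)"
    proof (rule continuous_on_blinfun_componentwise)
      fix b :: 'e
      show "continuous_on (S \<times> cbox 0 1) (\<lambda>x. blinfun_apply (case x of (y, t) \<Rightarrow> ?fx y t) b)"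
        by (rule continuous_on_cong[THEN iffD1, OF refl _ cont_v[of b]])
          (simp add: split_beta app mem_Times_iff del: power_Suc)
    qed
    have "((\<lambda>y. integral (cbox 0 1) (\<lambda>t. t ^ m * F (y0 + t *\<^sub>R (y - y0)))) has_derivative
        (\<lambda>v. integral (cbox 0 1) (\<lambda>t. t ^ Suc m * F' (y0 + t *\<^sub>R (y - y0)) v))) (at y)"
      if y: "y \<in> S" for y
    proof -
      have inty: "(\<lambda>t. ?fx y t) integrable_on cbox 0 1"
      proof (rule integrable_continuous)
        have "continuous_on (cbox 0 1) (\<lambda>t::real. (y, t))" by (intro continuous_intros)
        from continuous_on_compose2[OF cont this] y
        show "continuous_on (cbox 0 1) (\<lambda>t. ?fx y t)" by auto
      qed
      have "((\<lambda>y. integral (cbox 0 1) (\<lambda>t. t ^ m * F (y0 + t *\<^sub>R (y - y0)))) has_derivative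
          integral (cbox 0 1) (?fx y)) (at y within S)"
        by (rule leibniz_rule[OF der int cont y assms(2)]) auto
      moreover have "blinfun_apply (integral (cbox 0 1) (?fx y))
          = (\<lambda>v. integral (cbox 0 1) (\<lambda>t. t ^ Suc m * F' (y0 + t *\<^sub>R (y - y0)) v))"
      proof
        fix v
        have "blinfun_apply (integral (cbox 0 1) (?fx y)) v = integral (cbox 0 1) (\<lambda>t. blinfun_apply (?fx y t) v)"
          using blinfun_apply_integral[OF inty] by simp
        also have "\<dots> = integral (cbox 0 1) (\<lambda>t. t ^ Suc m * F' (y0 + t *\<^sub>R (y - y0)) v)"
          using app[OF y] by (intro integral_cong) auto
        finally show "blinfun_apply (integral (cbox 0 1) (?fx y)) v
          = integral (cbox 0 1) (\<lambda>t. t ^ Suc m * F' (y0 + t *\<^sub>R (y - y0)) v)" .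
      qed
      ultimately show ?thesis using at_within_open[OF y assms(1)] by simp
    qed
    then show ?case using Suc.IH[OF F'(2)] by (rule Ck_on_SucI)
  }
qed

text \<open>Hadamard's lemma: the coefficients are the integrals of the partial derivatives along the
  segments that start at \<open>y0\<close>.\<close>

lemma hadamard:
  fixes f :: "'e::euclidean_space \<Rightarrow> real"
  assumes S: "open S" "convex S" "y0 \<in> S" and f: "smooth_on S f"
  obtains g where "\<And>b. smooth_on S (g b)"
    and "\<And>y. y \<in> S \<Longrightarrow> f y = f y0 + (\<Sum>b\<in>Basis. ((y - y0) \<bullet> b) * g b y)"
    and "\<And>b. g b y0 = dir_deriv f b y0"
proof
  define g where "g b y = integral (cbox 0 1) (\<lambda>t::real. dir_deriv f b (y0 + t *\<^sub>R (y - y0)))" for b y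
  have sm: "smooth_on S (dir_deriv f b)" for b by (rule smooth_on_dir_deriv[OF S(1) f])
  show "smooth_on S (g b)" for b
    using Ck_on_radial_integral[OF S, of _ "dir_deriv f b" 0] sm[of b] unfolding smooth_on_def g_def
    by (simp add: cbox_interval)
  show "g b y0 = dir_deriv f b y0" for b by (simp add: g_def)
  show "f y = f y0 + (\<Sum>b\<in>Basis. ((y - y0) \<bullet> b) * g b y)" if y: "y \<in> S" for y
  proof -
    have seg: "y0 + t *\<^sub>R (y - y0) \<in> S" if "t \<in> {0..1}" for t :: real
      using convexD_alt[OF S(2,3) y, of t] that by (simp add: algebra_simps)
    have ftc: "((\<lambda>t. dir_deriv f (y - y0) (y0 + t *\<^sub>R (y - y0))) has_integral
        f (y0 + 1 *\<^sub>R (y - y0)) - f (y0 + 0 *\<^sub>R (y - y0))) {0..1}"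
    proof (rule fundamental_theorem_of_calculus)
      fix t :: real assume "t \<in> {0..1}"
      from smooth_on_line_derivative[OF S(1) f seg[OF this]]
      show "((\<lambda>t. f (y0 + t *\<^sub>R (y - y0))) has_vector_derivative
          dir_deriv f (y - y0) (y0 + t *\<^sub>R (y - y0))) (at t within {0..1})"
        by (simp add: has_real_derivative_iff_has_vector_derivative has_vector_derivative_at_within)
    qed simp
    have expand: "dir_deriv f (y - y0) (y0 + t *\<^sub>R (y - y0))
        = (\<Sum>b\<in>Basis. ((y - y0) \<bullet> b) * dir_deriv f b (y0 + t *\<^sub>R (y - y0)))" if "t \<in> {0..1}" for t
    proof -
      have "linear (frechet_derivative f (at (y0 + t *\<^sub>R (y - y0))))"
        using smooth_on_has_derivative[OF S(1) f seg[OF that]] by (rule has_derivative_linear)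
      from linear_sum[OF this, of "\<lambda>b. ((y - y0) \<bullet> b) *\<^sub>R b" Basis] show ?thesis
        by (simp add: euclidean_representation linear_scale[OF \<open>linear _\<close>])
    qed
    have int: "(\<lambda>t. dir_deriv f b (y0 + t *\<^sub>R (y - y0))) integrable_on {0..1}" for b
    proof (intro integrable_continuous_real continuous_on_compose2[OF smooth_on_imp_continuous_on[OF sm]])
      show "continuous_on {0..1} (\<lambda>t. y0 + t *\<^sub>R (y - y0))" by (intro continuous_intros)
    qed (use seg in auto)
    have "f y - f y0 = integral {0..1} (\<lambda>t. dir_deriv f (y - y0) (y0 + t *\<^sub>R (y - y0)))"
      using integral_unique[OF ftc] by simp
    also have "\<dots> = integral {0..1} (\<lambda>t. \<Sum>b\<in>Basis. ((y - y0) \<bullet> b) * dir_deriv f b (y0 + t *\<^sub>R (y - y0)))"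
      by (rule integral_cong) (rule expand)
    also have "\<dots> = (\<Sum>b\<in>Basis. ((y - y0) \<bullet> b) * g b y)"
      unfolding g_def cbox_interval using int
      by (subst integral_sum) (auto intro: integrable_on_mult_right simp: integral_mult_right)
    finally show ?thesis by simp
  qed
qed

lemma flat_exp_tendsto: "((\<lambda>x::real. exp (- 1 / x) / x ^ m) \<longlongrightarrow> 0) (at_right 0)"
proof -
  have "((\<lambda>x::real. inverse x ^ m / exp (inverse x)) \<longlongrightarrow> 0) (at_right 0)"
    by (rule filterlim_compose[OF tendsto_power_div_exp_0 filterlim_inverse_at_top_right])
  then show ?thesis by (simp add: exp_minus divide_simps power_inverse mult.commute)
qed

definition flat_exp :: "nat \<Rightarrow> real \<Rightarrow> real" where
  "flat_exp m x = (if x > 0 then exp (- 1 / x) / x ^ m else 0)"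

lemma flat_exp_derivative:
  "(flat_exp m has_real_derivative flat_exp (m + 2) x - of_nat m * flat_exp (m + 1) x) (at x)"
proof (cases x "0::real" rule: linorder_cases)
  case less
  have "((\<lambda>_. 0) has_real_derivative 0) (at x)" by simp
  then have "(flat_exp m has_real_derivative 0) (at x)"
    by (rule has_field_derivative_transform_within_open[of _ _ _ "{..<0}"])
      (use less in \<open>auto simp: flat_exp_def\<close>)
  then show ?thesis using less by (simp add: flat_exp_def)
next
  case equal
  have "((\<lambda>h. (flat_exp m (0 + h) - flat_exp m 0) / h) \<longlongrightarrow> 0) (at (0::real))"
  proof (rule filterlim_split_at)
    show "((\<lambda>h. (flat_exp m (0 + h) - flat_exp m 0) / h) \<longlongrightarrow> 0) (at_left 0)"
      by (rule tendsto_eventually) (auto simp: eventually_at_left_field flat_exp_def intro!: exI[of _ "-1"])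
    show "((\<lambda>h. (flat_exp m (0 + h) - flat_exp m 0) / h) \<longlongrightarrow> 0) (at_right 0)"
      by (rule Lim_transform_eventually[OF flat_exp_tendsto[of "Suc m"]])
        (auto simp: eventually_at_right_field flat_exp_def intro!: exI[of _ 1])
  qed
  then show ?thesis using equal by (simp add: DERIV_def flat_exp_def)
next
  case greater
  have "((\<lambda>x. exp (- inverse x) * inverse x ^ m) has_real_derivative
      exp (- inverse x) * inverse x ^ (m + 2) - of_nat m * (exp (- inverse x) * inverse x ^ (m + 1))) (at x)"
  proof -
    have "((\<lambda>x. inverse x ^ m) has_real_derivative - (of_nat m * inverse x ^ (m + 1))) (at x)"
    proof (cases m)
      case (Suc k)
      show ?thesis unfolding Suc
        by (rule DERIV_cong[OF DERIV_power_Suc[OF DERIV_inverse]]) (use greater in \<open>simp_all add: algebra_simps\<close>)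
    qed simp
    moreover have "((\<lambda>x. exp (- inverse x)) has_real_derivative exp (- inverse x) * inverse x ^ 2) (at x)"
      using greater by (auto intro!: derivative_eq_intros simp: power2_eq_square)
    ultimately show ?thesis
      by (rule DERIV_cong[OF DERIV_mult[rotated]]) (simp add: algebra_simps power2_eq_square)
  qed
  then have "((\<lambda>x. exp (- 1 / x) / x ^ m) has_real_derivative
      exp (- 1 / x) / x ^ (m + 2) - of_nat m * (exp (- 1 / x) / x ^ (m + 1))) (at x)"
    by (simp add: divide_inverse power_inverse)
  then have "(flat_exp m has_real_derivative
      exp (- 1 / x) / x ^ (m + 2) - of_nat m * (exp (- 1 / x) / x ^ (m + 1))) (at x)"
    by (rule has_field_derivative_transform_within_open[of _ _ _ "{0<..}"])
      (use greater in \<open>auto simp: flat_exp_def\<close>)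
  then show ?thesis using greater by (simp add: flat_exp_def)
qed

text \<open>The derivative of a member of the family \<open>x \<mapsto> exp (-1/x) / x\<^sup>m\<close> is a combination of two others,
  so the smoothness of all of them follows by one induction.\<close>

lemma Ck_on_flat_exp: "Ck_on k S (flat_exp m)"
proof (induction k arbitrary: m)
  case 0
  show ?case using DERIV_isCont[OF flat_exp_derivative] by (auto intro!: continuous_at_imp_continuous_on)
next
  case (Suc k)
  have "(flat_exp m has_derivative (\<lambda>v. v * flat_exp (m + 2) x + (- of_nat m * v) * flat_exp (m + 1) x)) (at x)" for x
    using flat_exp_derivative[of m x] unfolding has_field_derivative_def
    by (rule has_derivative_eq_rhs) (simp add: algebra_simps fun_eq_iff)
  moreover have "Ck_on k S (\<lambda>x. v * flat_exp (m + 2) x + (- of_nat m * v) * flat_exp (m + 1) x)" for v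
    by (intro Ck_on_add Ck_on_bounded_linear[OF bounded_linear_mult_right] Suc)
  ultimately show ?case by (intro Ck_on_SucI) auto
qed

lemma smooth_on_flat_exp: "smooth_on S (flat_exp m)"
  by (simp add: smooth_on_def Ck_on_flat_exp)

text \<open>The quotient \<open>a / (a + b)\<close>, where \<open>a\<close> vanishes off the large ball and \<open>b\<close> on the small one.\<close>

lemma bump_function:
  fixes c :: "'e::euclidean_space"
  assumes "0 < r"
  obtains \<eta> :: "'e \<Rightarrow> real" where "smooth_on UNIV \<eta>" "\<And>x. 0 \<le> \<eta> x"
    "\<And>x. x \<in> ball c (r / 2) \<Longrightarrow> \<eta> x = 1" "\<And>x. x \<notin> ball c r \<Longrightarrow> \<eta> x = 0"
proof
  define q where "q x = (x - c) \<bullet> (x - c)" for x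
  have q: "q x = (dist c x)\<^sup>2" for x by (simp add: q_def dist_norm norm_minus_commute[of c] power2_norm_eq_inner)
  let ?a = "\<lambda>x. flat_exp 0 (r\<^sup>2 - q x)" and ?b = "\<lambda>x. flat_exp 0 (q x - (r / 2)\<^sup>2)"
  define \<eta> where "\<eta> x = ?a x * (?a x + ?b x) powr (-1)" for x
  have nn: "flat_exp 0 t \<ge> 0" for t by (simp add: flat_exp_def)
  have pos: "?a x + ?b x > 0" for x
  proof (cases "q x < r\<^sup>2")
    case True
    then have "?a x > 0" by (simp add: flat_exp_def)
    then show ?thesis using nn by (simp add: add_pos_nonneg)
  next
    case False
    moreover have "(r / 2)\<^sup>2 < r\<^sup>2" using assms by (simp add: power_divide)
    ultimately have "?b x > 0" by (simp add: flat_exp_def)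
    then show ?thesis using nn by (simp add: add_nonneg_pos)
  qed
  have sq: "smooth_on UNIV q"
  proof -
    have "q = (\<lambda>x. \<Sum>b\<in>Basis. ((x - c) \<bullet> b) * ((x - c) \<bullet> b))"
      unfolding q_def by (rule ext) (rule euclidean_inner)
    then show ?thesis
      by (auto intro!: smooth_on_sum smooth_on_mult smooth_on_diff smooth_on_id smooth_on_const
          smooth_on_bounded_linear[OF bounded_linear_inner_left])
  qed
  have sa: "smooth_on UNIV ?a"
    by (rule smooth_on_compose[OF smooth_on_flat_exp smooth_on_diff[OF smooth_on_const sq] subset_UNIV])
  have sb: "smooth_on UNIV ?b"
    by (rule smooth_on_compose[OF smooth_on_flat_exp smooth_on_diff[OF sq smooth_on_const] subset_UNIV])
  show "smooth_on UNIV \<eta>" unfolding \<eta>_def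
    using pos by (intro smooth_on_mult sa smooth_on_compose[OF smooth_on_powr smooth_on_add[OF sa sb]]) auto
  show "0 \<le> \<eta> x" for x using nn by (simp add: \<eta>_def)
  show "\<eta> x = 1" if "x \<in> ball c (r / 2)" for x
  proof -
    have "q x < (r / 2)\<^sup>2" using that assms by (simp add: q power2_strict_mono)
    then have "?b x = 0" by (simp add: flat_exp_def)
    then show ?thesis using pos[of x] by (simp add: \<eta>_def powr_minus field_simps)
  qed
  show "\<eta> x = 0" if "x \<notin> ball c r" for x
  proof -
    have "r\<^sup>2 \<le> q x" using that assms by (simp add: q power_mono)
    then show ?thesis by (simp add: \<eta>_def flat_exp_def)
  qed
qed

section \<open>Smooth functions on a manifold\<close>

lemma sum_fun_apply: "(\<Sum>i\<in>I. f i) x = (\<Sum>i\<in>I. f i x)"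
  by (induction I rule: infinite_finite_induct) auto

locale manifold =
  fixes A :: "('a::{t2_space,second_countable_topology}, 'e::euclidean_space) atlas"
  assumes smooth_manifold: "smooth_manifold A"
begin

lemma chart:
  assumes "(U, \<phi>) \<in> A"
  shows chart_open: "open U" and chart_image: "open (\<phi> ` U)"
    and chart_continuous: "continuous_on U \<phi>"
    and chart_inv_continuous: "continuous_on (\<phi> ` U) (inv_into U \<phi>)"
    and chart_inj: "inj_on \<phi> U"
proof -
  have "is_chart (U, \<phi>)" using smooth_manifold assms by (auto simp: smooth_manifold_def)
  then have *: "open U" "open (\<phi> ` U)" "homeomorphism U (\<phi> ` U) \<phi> (inv_into U \<phi>)"
    by (auto simp: is_chart_def)
  then show "open U" "open (\<phi> ` U)" "continuous_on U \<phi>" "continuous_on (\<phi> ` U) (inv_into U \<phi>)"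
    by (auto simp: homeomorphism_def)
  show "inj_on \<phi> U"
    using *(3) by (metis homeomorphism_apply1 inj_on_inverseI)
qed

lemma chart_inv [simp]: "(U, \<phi>) \<in> A \<Longrightarrow> x \<in> U \<Longrightarrow> inv_into U \<phi> (\<phi> x) = x"
  using chart_inj by simp

lemma chart_at:
  obtains U \<phi> where "(U, \<phi>) \<in> A" "p \<in> U"
proof -
  have "p \<in> (\<Union>c\<in>A. fst c)" using smooth_manifold by (auto simp: smooth_manifold_def)
  then show ?thesis using that by auto
qed

lemma chart_image_open:
  assumes "(U, \<phi>) \<in> A" "open W" "W \<subseteq> U"
  shows "open (\<phi> ` W)"
proof -
  have "\<phi> ` W = \<phi> ` U \<inter> inv_into U \<phi> -` W"
    using assms(3) chart_inv[OF assms(1)] by (fastforce simp: image_iff)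
  then show ?thesis
    using continuous_open_preimage[OF chart_inv_continuous chart_image] assms by simp
qed

lemma chart_preimage_open:
  assumes "(U, \<phi>) \<in> A" "open T"
  shows "open (U \<inter> \<phi> -` T)"
  by (rule continuous_open_preimage[OF chart_continuous[OF assms(1)] chart_open[OF assms(1)] assms(2)])

lemma transition_smooth:
  assumes "(U, \<phi>) \<in> A" "(V, \<psi>) \<in> A"
  shows "smooth_on (\<phi> ` (U \<inter> V)) (\<lambda>y. \<psi> (inv_into U \<phi> y))"
  using smooth_manifold assms unfolding smooth_manifold_def smooth_compatible_def o_def by fastforce

lemma cinfD: "f \<in> cinf A \<Longrightarrow> (U, \<phi>) \<in> A \<Longrightarrow> smooth_on (\<phi> ` U) (\<lambda>y. f (inv_into U \<phi> y))"
  by (auto simp: cinf_def smooth_map_def euclidean_atlas_def o_def)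

lemma cinf_continuous: "f \<in> cinf A \<Longrightarrow> continuous_on S f"
  by (auto simp: cinf_def smooth_map_def intro: continuous_on_subset)

lemma cinfI:
  assumes "\<And>U \<phi>. (U, \<phi>) \<in> A \<Longrightarrow> smooth_on (\<phi> ` U) (\<lambda>y. f (inv_into U \<phi> y))"
  shows "f \<in> cinf A"
proof -
  have "isCont f p" for p
  proof -
    obtain U \<phi> where c: "(U, \<phi>) \<in> A" "p \<in> U" by (rule chart_at)
    have "continuous_on U (\<lambda>x. f (inv_into U \<phi> (\<phi> x)))"
      by (rule continuous_on_compose2[OF smooth_on_imp_continuous_on[OF assms[OF c(1)]] chart_continuous[OF c(1)]])
        simp
    then have "continuous_on U f"
      by (rule continuous_on_cong[THEN iffD1, OF refl, rotated]) (simp add: c)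
    then show ?thesis using chart_open[OF c(1)] c(2) continuous_on_eq_continuous_at by blast
  qed
  then have "continuous_on UNIV f" by (simp add: continuous_at_imp_continuous_on)
  then show ?thesis using assms by (auto simp: cinf_def smooth_map_def euclidean_atlas_def o_def)
qed

lemma smooth_chart_change:
  assumes "(U, \<phi>) \<in> A" "(V, \<psi>) \<in> A" "open W" "W \<subseteq> U"
    and "smooth_on (\<phi> ` W) (\<lambda>y. f (inv_into U \<phi> y))"
  shows "smooth_on (\<psi> ` (V \<inter> W)) (\<lambda>y. f (inv_into V \<psi> y))"
proof -
  have o: "open (\<psi> ` (V \<inter> W))"
    using chart_image_open[OF assms(2)] chart_open[OF assms(2)] assms(3) by (metis inf_le1 open_Int)
  have "smooth_on (\<psi> ` (V \<inter> W)) (\<lambda>y. f (inv_into U \<phi> (\<phi> (inv_into V \<psi> y))))"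
  proof (rule smooth_on_compose[OF assms(5)])
    show "smooth_on (\<psi> ` (V \<inter> W)) (\<lambda>y. \<phi> (inv_into V \<psi> y))"
      by (rule smooth_on_subset[OF transition_smooth[OF assms(2,1)]]) (use assms(4) in auto)
  qed (use assms(2) in auto)
  then show ?thesis
    by (rule smooth_on_cong[OF o, rotated]) (use assms in auto)
qed

lemma cinf_localI:
  assumes "\<And>p. \<exists>U \<phi> W. (U, \<phi>) \<in> A \<and> open W \<and> p \<in> W \<and> W \<subseteq> U \<and> smooth_on (\<phi> ` W) (\<lambda>y. f (inv_into U \<phi> y))"
  shows "f \<in> cinf A"
proof (rule cinfI, rule smooth_on_local)
  fix V \<psi> y assume V: "(V, \<psi>) \<in> A" and "y \<in> \<psi> ` V"
  then obtain p where p: "p \<in> V" "y = \<psi> p" by auto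
  obtain U \<phi> W where U: "(U, \<phi>) \<in> A" "open W" "p \<in> W" "W \<subseteq> U" "smooth_on (\<phi> ` W) (\<lambda>y. f (inv_into U \<phi> y))"
    using assms by metis
  show "\<exists>T. open T \<and> y \<in> T \<and> smooth_on T (\<lambda>y. f (inv_into V \<psi> y))"
    using smooth_chart_change[OF U(1) V U(2,4,5)] p U(3)
      chart_image_open[OF V, of "V \<inter> W"] chart_open[OF V] U(2)
    by (intro exI[of _ "\<psi> ` (V \<inter> W)"]) auto
qed

lemma cinf_const: "(\<lambda>p. c) \<in> cinf A"
  by (rule cinfI) (intro smooth_on_const)

lemma cinf_add: "f \<in> cinf A \<Longrightarrow> g \<in> cinf A \<Longrightarrow> (\<lambda>p. f p + g p) \<in> cinf A"
  by (rule cinfI) (intro smooth_on_add cinfD)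

lemma cinf_diff: "f \<in> cinf A \<Longrightarrow> g \<in> cinf A \<Longrightarrow> (\<lambda>p. f p - g p) \<in> cinf A"
  by (rule cinfI) (intro smooth_on_diff cinfD)

lemma cinf_mult: "f \<in> cinf A \<Longrightarrow> g \<in> cinf A \<Longrightarrow> (\<lambda>p. f p * g p) \<in> cinf A"
  by (rule cinfI) (intro smooth_on_mult cinfD)

lemma cinf_cmult: "f \<in> cinf A \<Longrightarrow> (\<lambda>p. c * f p) \<in> cinf A"
  by (rule cinf_mult[OF cinf_const])

lemma cinf_minus: "f \<in> cinf A \<Longrightarrow> (\<lambda>p. - f p) \<in> cinf A"
  using cinf_cmult[of f "-1"] by simp

lemma cinf_sum: "(\<And>i. i \<in> I \<Longrightarrow> f i \<in> cinf A) \<Longrightarrow> (\<lambda>p. \<Sum>i\<in>I. f i p) \<in> cinf A"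
  by (rule cinfI) (intro smooth_on_sum cinfD)

lemma cinf_compose:
  fixes F :: "real \<Rightarrow> real"
  assumes "f \<in> cinf A" "smooth_on T F" "range f \<subseteq> T"
  shows "(\<lambda>p. F (f p)) \<in> cinf A"
  by (rule cinfI, rule smooth_on_compose[OF assms(2) cinfD[OF assms(1)]]) (use assms(3) in auto)

lemmas cinf_intros = cinf_const cinf_add cinf_diff cinf_mult cinf_minus cinf_sum

text \<open>Extension by zero of a function that is smooth in a chart, after multiplication by a cut-off.\<close>

lemma cinf_extend:
  assumes U: "(U, \<phi>) \<in> A" and W: "open W" "W \<subseteq> U" and h: "smooth_on (\<phi> ` W) h"
    and \<eta>: "\<eta> \<in> cinf A" and K: "closed K" "K \<subseteq> W" "\<And>x. x \<notin> K \<Longrightarrow> \<eta> x = 0"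
  shows "(\<lambda>x. if x \<in> W then \<eta> x * h (\<phi> x) else 0) \<in> cinf A" (is "?f \<in> _")
proof (rule cinf_localI)
  fix p
  show "\<exists>U \<phi> W. (U, \<phi>) \<in> A \<and> open W \<and> p \<in> W \<and> W \<subseteq> U \<and> smooth_on (\<phi> ` W) (\<lambda>y. ?f (inv_into U \<phi> y))"
  proof (cases "p \<in> W")
    case True
    have "smooth_on (\<phi> ` W) (\<lambda>y. \<eta> (inv_into U \<phi> y) * h y)"
      by (rule smooth_on_mult[OF smooth_on_subset[OF cinfD[OF \<eta> U]] h]) (use W in auto)
    then have "smooth_on (\<phi> ` W) (\<lambda>y. ?f (inv_into U \<phi> y))"
      by (rule smooth_on_cong[OF chart_image_open[OF U W], rotated]) (use U W in auto)
    then show ?thesis using U W True by blast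
  next
    case False
    obtain V \<psi> where V: "(V, \<psi>) \<in> A" "p \<in> V" by (rule chart_at)
    have o: "open (V - K)" using chart_open[OF V(1)] K(1) by auto
    have "smooth_on (\<psi> ` (V - K)) (\<lambda>y. ?f (inv_into V \<psi> y))"
      by (rule smooth_on_cong[OF chart_image_open[OF V(1) o Diff_subset] _ smooth_on_const[of _ 0]])
        (use V(1) K(3) in auto)
    then show ?thesis using V o False K(2) by (intro exI[of _ V] exI[of _ \<psi>] exI[of _ "V - K"]) auto
  qed
qed

lemma bump:
  assumes "open W" "p \<in> W"
  obtains \<eta> N K where "\<eta> \<in> cinf A" "\<And>x. 0 \<le> \<eta> x" "open N" "p \<in> N" "N \<subseteq> W" "\<And>x. x \<in> N \<Longrightarrow> \<eta> x = 1"
    "closed K" "K \<subseteq> W" "\<And>x. x \<notin> K \<Longrightarrow> \<eta> x = 0"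
proof -
  obtain U \<phi> where U: "(U, \<phi>) \<in> A" "p \<in> U" by (rule chart_at)
  have oW: "open (U \<inter> W)" using chart_open[OF U(1)] assms by auto
  then obtain r where r: "r > 0" "cball (\<phi> p) r \<subseteq> \<phi> ` (U \<inter> W)"
    using chart_image_open[OF U(1) oW Int_lower1] U(2) assms(2) unfolding open_contains_cball by blast
  obtain \<beta> :: "'e \<Rightarrow> real" where \<beta>: "smooth_on UNIV \<beta>" "\<And>x. 0 \<le> \<beta> x"
    "\<And>x. x \<in> ball (\<phi> p) (r / 2) \<Longrightarrow> \<beta> x = 1" "\<And>x. x \<notin> ball (\<phi> p) r \<Longrightarrow> \<beta> x = 0"
    using bump_function[OF r(1)] by metis
  define K where "K = inv_into U \<phi> ` cball (\<phi> p) r"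
  define N where "N = U \<inter> \<phi> -` ball (\<phi> p) (r / 2)"
  define \<eta> where "\<eta> x = (if x \<in> U then \<beta> (\<phi> x) else 0)" for x
  have KW: "K \<subseteq> U \<inter> W"
    using r(2) U(1) unfolding K_def by (fastforce simp: image_iff subset_iff)
  have "compact K" unfolding K_def
    by (rule compact_continuous_image[OF continuous_on_subset[OF chart_inv_continuous[OF U(1)]]])
      (use r(2) in auto)
  then have K: "closed K" by (rule compact_imp_closed)
  have inK: "x \<in> K" if "x \<in> U" "\<phi> x \<in> cball (\<phi> p) r" for x
    using that U(1) unfolding K_def by (metis chart_inv image_eqI)
  have \<eta>0: "\<eta> x = 0" if "x \<notin> K" for x
  proof (cases "x \<in> U")
    case True
    then have "\<phi> x \<notin> ball (\<phi> p) r" using that inK by fastforce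
    then show ?thesis using \<beta>(4) by (simp add: \<eta>_def)
  qed (simp add: \<eta>_def)
  have "\<eta> \<in> cinf A"
  proof (rule cinf_localI)
    fix q
    show "\<exists>U \<phi> W. (U, \<phi>) \<in> A \<and> open W \<and> q \<in> W \<and> W \<subseteq> U \<and> smooth_on (\<phi> ` W) (\<lambda>y. \<eta> (inv_into U \<phi> y))"
    proof (cases "q \<in> U")
      case True
      have "smooth_on (\<phi> ` U) (\<lambda>y. \<eta> (inv_into U \<phi> y))"
        by (rule smooth_on_cong[OF chart_image[OF U(1)] _ smooth_on_subset[OF \<beta>(1)]])
          (use U(1) in \<open>auto simp: \<eta>_def\<close>)
      then show ?thesis using U(1) True chart_open by blast
    next
      case False
      obtain V \<psi> where V: "(V, \<psi>) \<in> A" "q \<in> V" by (rule chart_at)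
      have o: "open (V - K)" using chart_open[OF V(1)] K by auto
      have "smooth_on (\<psi> ` (V - K)) (\<lambda>y. \<eta> (inv_into V \<psi> y))"
        by (rule smooth_on_cong[OF chart_image_open[OF V(1) o Diff_subset] _ smooth_on_const[of _ 0]])
          (use V(1) \<eta>0 in auto)
      then show ?thesis using V o False KW by (intro exI[of _ V] exI[of _ \<psi>] exI[of _ "V - K"]) auto
    qed
  qed
  moreover have "0 \<le> \<eta> x" for x using \<beta>(2) by (simp add: \<eta>_def)
  moreover have "open N" unfolding N_def by (rule chart_preimage_open[OF U(1) open_ball])
  moreover have "p \<in> N" using U r(1) by (simp add: N_def)
  moreover have "N \<subseteq> W"
  proof
    fix x assume "x \<in> N"
    then have "x \<in> K" using r(1) by (intro inK) (auto simp: N_def)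
    then show "x \<in> W" using KW by auto
  qed
  moreover have "\<eta> x = 1" if "x \<in> N" for x using that \<beta>(3) by (simp add: \<eta>_def N_def)
  moreover have "K \<subseteq> W" using KW by auto
  ultimately show ?thesis using that K \<eta>0 by blast
qed

section \<open>Tangent vectors and vector fields\<close>

text \<open>Tangent vectors are derivations at a point. This covers the values of vector fields and also their
  images under the differential of a map, such as \<open>f \<mapsto> X (f \<circ> \<phi>) p\<close>.\<close>

definition tangent_at :: "'a \<Rightarrow> (('a \<Rightarrow> real) \<Rightarrow> real) \<Rightarrow> bool" where
  "tangent_at p \<delta> \<longleftrightarrow>
     (\<forall>f\<in>cinf A. \<forall>g\<in>cinf A. \<delta> (\<lambda>x. f x + g x) = \<delta> f + \<delta> g) \<and>
     (\<forall>c. \<forall>f\<in>cinf A. \<delta> (\<lambda>x. c * f x) = c * \<delta> f) \<and>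
     (\<forall>f\<in>cinf A. \<forall>g\<in>cinf A. \<delta> (\<lambda>x. f x * g x) = \<delta> f * g p + f p * \<delta> g)"

lemma tangent_add: "tangent_at p \<delta> \<Longrightarrow> f \<in> cinf A \<Longrightarrow> g \<in> cinf A \<Longrightarrow> \<delta> (\<lambda>x. f x + g x) = \<delta> f + \<delta> g"
  and tangent_cmult: "tangent_at p \<delta> \<Longrightarrow> f \<in> cinf A \<Longrightarrow> \<delta> (\<lambda>x. c * f x) = c * \<delta> f"
  and tangent_mult: "tangent_at p \<delta> \<Longrightarrow> f \<in> cinf A \<Longrightarrow> g \<in> cinf A \<Longrightarrow>
    \<delta> (\<lambda>x. f x * g x) = \<delta> f * g p + f p * \<delta> g"
  by (auto simp: tangent_at_def)

lemma tangent_const: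
  assumes "tangent_at p \<delta>"
  shows "\<delta> (\<lambda>x. c) = 0"
proof -
  have "\<delta> (\<lambda>x. 1) = 0" using tangent_mult[OF assms cinf_const cinf_const, of 1 1] by simp
  then show ?thesis using tangent_cmult[OF assms cinf_const, of c 1] by simp
qed

lemma tangent_diff:
  assumes "tangent_at p \<delta>" "f \<in> cinf A" "g \<in> cinf A"
  shows "\<delta> (\<lambda>x. f x - g x) = \<delta> f - \<delta> g"
  using tangent_add[OF assms(1,2) cinf_cmult[OF assms(3), of "-1"]] tangent_cmult[OF assms(1,3), of "-1"]
  by simp

lemma tangent_sum:
  assumes "tangent_at p \<delta>" "\<And>i. i \<in> I \<Longrightarrow> f i \<in> cinf A"
  shows "\<delta> (\<lambda>x. \<Sum>i\<in>I. f i x) = (\<Sum>i\<in>I. \<delta> (f i))"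
  using assms(2)
proof (induction I rule: infinite_finite_induct)
  case (insert i I)
  then have "\<delta> (\<lambda>x. \<Sum>i\<in>insert i I. f i x) = \<delta> (\<lambda>x. f i x + (\<Sum>i\<in>I. f i x))" by simp
  also have "\<dots> = \<delta> (f i) + \<delta> (\<lambda>x. \<Sum>i\<in>I. f i x)"
    using insert.prems by (intro tangent_add[OF assms(1)] cinf_sum) auto
  finally show ?case using insert by simp
qed (auto simp: tangent_const[OF assms(1)])

text \<open>Multiply \<open>f - g\<close> by a bump function that is supported where \<open>f\<close> and \<open>g\<close> agree.\<close>

lemma tangent_local:
  assumes \<delta>: "tangent_at p \<delta>" and f: "f \<in> cinf A" and g: "g \<in> cinf A"
    and W: "open W" "p \<in> W" "\<And>x. x \<in> W \<Longrightarrow> f x = g x"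
  shows "\<delta> f = \<delta> g"
proof -
  obtain \<eta> N K where \<eta>: "\<eta> \<in> cinf A" "p \<in> N" "\<And>x. x \<in> N \<Longrightarrow> \<eta> x = 1" "K \<subseteq> W" "\<And>x. x \<notin> K \<Longrightarrow> \<eta> x = 0"
    by (rule bump[OF W(1,2)]) blast
  have "(\<lambda>x. \<eta> x * (f x - g x)) = (\<lambda>x. 0)" using \<eta>(4,5) W(3) by (metis (no_types) diff_self mult_eq_0_iff subsetD)
  then have "0 = \<delta> \<eta> * (f p - g p) + \<eta> p * \<delta> (\<lambda>x. f x - g x)"
    using tangent_mult[OF \<delta> \<eta>(1) cinf_diff[OF f g]] tangent_const[OF \<delta>] by simp
  then show ?thesis using \<eta>(2,3) W(2,3) tangent_diff[OF \<delta> f g] by simp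
qed

lemma vf_tangent: "X \<in> vfields A \<Longrightarrow> tangent_at p (\<lambda>f. X f p)"
  by (auto simp: vfields_def tangent_at_def)

lemma vf_add: "X \<in> vfields A \<Longrightarrow> f \<in> cinf A \<Longrightarrow> g \<in> cinf A \<Longrightarrow> X (\<lambda>x. f x + g x) p = X f p + X g p"
  by (rule tangent_add[OF vf_tangent])

lemma vf_diff: "X \<in> vfields A \<Longrightarrow> f \<in> cinf A \<Longrightarrow> g \<in> cinf A \<Longrightarrow> X (\<lambda>x. f x - g x) p = X f p - X g p"
  by (rule tangent_diff[OF vf_tangent])

lemma vf_cmult: "X \<in> vfields A \<Longrightarrow> f \<in> cinf A \<Longrightarrow> X (\<lambda>x. c * f x) p = c * X f p"
  by (rule tangent_cmult[OF vf_tangent])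

lemma vf_mult: "X \<in> vfields A \<Longrightarrow> f \<in> cinf A \<Longrightarrow> g \<in> cinf A \<Longrightarrow>
    X (\<lambda>x. f x * g x) p = X f p * g p + f p * X g p"
  by (rule tangent_mult[OF vf_tangent])

lemma vf_const: "X \<in> vfields A \<Longrightarrow> X (\<lambda>x. c) p = 0"
  by (rule tangent_const[OF vf_tangent])

lemma vf_sum: "X \<in> vfields A \<Longrightarrow> (\<And>i. i \<in> I \<Longrightarrow> f i \<in> cinf A) \<Longrightarrow> X (\<lambda>x. \<Sum>i\<in>I. f i x) p = (\<Sum>i\<in>I. X (f i) p)"
  by (rule tangent_sum[OF vf_tangent])

lemmas vf_simps = vf_add vf_diff vf_cmult vf_mult vf_const vf_sum

lemma vf_cinf: "X \<in> vfields A \<Longrightarrow> X f \<in> cinf A"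
  by (cases "f \<in> cinf A") (auto simp: vfields_def cinf_const)

lemma vfieldsI:
  assumes "\<And>f. f \<in> cinf A \<Longrightarrow> X f \<in> cinf A" "\<And>p. tangent_at p (\<lambda>f. X f p)" "\<And>f. f \<notin> cinf A \<Longrightarrow> X f = (\<lambda>p. 0)"
  shows "X \<in> vfields A"
  using assms unfolding vfields_def tangent_at_def by (auto simp: fun_eq_iff)

lemma vf_outside: "X \<in> vfields A \<Longrightarrow> f \<notin> cinf A \<Longrightarrow> X f p = 0"
  by (auto simp: vfields_def)

lemma vf_eqI:
  assumes "X \<in> vfields A" "Y \<in> vfields A" "\<And>f p. f \<in> cinf A \<Longrightarrow> X f p = Y f p"
  shows "X = Y"
proof (intro ext)
  fix f p show "X f p = Y f p"
    using assms(3) vf_outside[OF assms(1)] vf_outside[OF assms(2)] by (cases "f \<in> cinf A") auto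
qed

lemma vf_zero_vfields: "0 \<in> vfields A"
  by (auto simp: vfields_def zero_fun_def cinf_const)

lemma vf_add_vfields: "X \<in> vfields A \<Longrightarrow> Y \<in> vfields A \<Longrightarrow> X + Y \<in> vfields A"
  by (rule vfieldsI)
    (simp_all add: plus_fun_def vf_outside tangent_at_def vf_simps algebra_simps cinf_add vf_cinf)

lemma vf_scale_vfields: "h \<in> cinf A \<Longrightarrow> X \<in> vfields A \<Longrightarrow> vf_scale h X \<in> vfields A"
  by (rule vfieldsI)
    (simp_all add: vf_scale_def vf_outside tangent_at_def vf_simps algebra_simps cinf_mult vf_cinf)

lemma vf_sum_vfields: "(\<And>i. i \<in> I \<Longrightarrow> X i \<in> vfields A) \<Longrightarrow> (\<Sum>i\<in>I. X i) \<in> vfields A"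
  by (induction I rule: infinite_finite_induct) (auto intro: vf_zero_vfields vf_add_vfields)

subsection \<open>Coordinate functions and coordinate fields\<close>

definition coord_fun :: "('a, 'e) chart \<Rightarrow> ('a \<Rightarrow> real) \<Rightarrow> 'e \<Rightarrow> 'a \<Rightarrow> real" where
  "coord_fun c \<eta> b = (\<lambda>x. if x \<in> fst c then \<eta> x * (snd c x \<bullet> b) else 0)"

definition coord_field :: "('a, 'e) chart \<Rightarrow> ('a \<Rightarrow> real) \<Rightarrow> 'e \<Rightarrow> 'a vf" where
  "coord_field c \<eta> v = (\<lambda>f x. if f \<in> cinf A \<and> x \<in> fst c
     then \<eta> x * dir_deriv (\<lambda>y. f (inv_into (fst c) (snd c) y)) v (snd c x) else 0)"

text \<open>A chart is cut off by a function that equals \<open>1\<close> on \<open>N\<close>; there the coordinate functions and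
  fields are those of the chart.\<close>

definition chart_cutoff :: "('a, 'e) chart \<Rightarrow> ('a \<Rightarrow> real) \<Rightarrow> 'a set \<Rightarrow> bool" where
  "chart_cutoff c \<eta> N \<longleftrightarrow> c \<in> A \<and> \<eta> \<in> cinf A \<and> open N \<and> N \<subseteq> fst c \<and> (\<forall>x\<in>N. \<eta> x = 1) \<and>
     (\<exists>K. closed K \<and> K \<subseteq> fst c \<and> (\<forall>x. x \<notin> K \<longrightarrow> \<eta> x = 0))"

lemma chart_cutoff_in:
  assumes U: "(U, \<phi>) \<in> A" "p \<in> U"
  obtains \<eta> N where "chart_cutoff (U, \<phi>) \<eta> N" "p \<in> N"
proof -
  obtain \<eta> N K where "\<eta> \<in> cinf A" "open N" "p \<in> N" "N \<subseteq> U" "\<And>x. x \<in> N \<Longrightarrow> \<eta> x = 1"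
    "closed K" "K \<subseteq> U" "\<And>x. x \<notin> K \<Longrightarrow> \<eta> x = 0"
    by (rule bump[OF chart_open[OF U(1)] U(2)]) blast
  then show ?thesis using U that[of \<eta> N] unfolding chart_cutoff_def by auto
qed

lemma chart_cutoff_at:
  obtains U \<phi> \<eta> N where "chart_cutoff (U, \<phi>) \<eta> N" "p \<in> N"
  using chart_at chart_cutoff_in by metis

context
  fixes U \<phi> \<eta> N
  assumes cut: "chart_cutoff (U, \<phi>) \<eta> N"
begin

lemma cutoff: "(U, \<phi>) \<in> A" "\<eta> \<in> cinf A" "open N" "N \<subseteq> U" "\<And>x. x \<in> N \<Longrightarrow> \<eta> x = 1"
  using cut by (auto simp: chart_cutoff_def)

lemma coord_fun_cinf: "coord_fun (U, \<phi>) \<eta> b \<in> cinf A"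
proof -
  obtain K where "closed K" "K \<subseteq> U" "\<And>x. x \<notin> K \<Longrightarrow> \<eta> x = 0" using cut by (auto simp: chart_cutoff_def)
  then show ?thesis unfolding coord_fun_def fst_conv snd_conv
    using cinf_extend[OF cutoff(1) chart_open[OF cutoff(1)] order_refl
        smooth_on_bounded_linear[OF bounded_linear_inner_left smooth_on_id] cutoff(2)] by blast
qed

lemma coord_fun_eq: "x \<in> N \<Longrightarrow> coord_fun (U, \<phi>) \<eta> b x = \<phi> x \<bullet> b"
  using cutoff by (auto simp: coord_fun_def)

lemma coord_field_eq:
  "x \<in> N \<Longrightarrow> f \<in> cinf A \<Longrightarrow> coord_field (U, \<phi>) \<eta> v f x = dir_deriv (\<lambda>y. f (inv_into U \<phi> y)) v (\<phi> x)"
  using cutoff by (auto simp: coord_field_def)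

lemma chart_rep_derivative:
  assumes "f \<in> cinf A" "x \<in> U"
  shows "((\<lambda>y. f (inv_into U \<phi> y)) has_derivative frechet_derivative (\<lambda>y. f (inv_into U \<phi> y)) (at (\<phi> x))) (at (\<phi> x))"
  using smooth_on_has_derivative[OF chart_image cinfD[OF assms(1)]] cutoff(1) assms(2) by blast

lemma coord_field_vfields: "coord_field (U, \<phi>) \<eta> v \<in> vfields A"
proof (rule vfieldsI)
  fix f assume f: "f \<in> cinf A"
  obtain K where "closed K" "K \<subseteq> U" "\<And>x. x \<notin> K \<Longrightarrow> \<eta> x = 0" using cut by (auto simp: chart_cutoff_def)
  then show "coord_field (U, \<phi>) \<eta> v f \<in> cinf A"
    using cinf_extend[OF cutoff(1) chart_open[OF cutoff(1)] order_refl
        smooth_on_dir_deriv[OF chart_image[OF cutoff(1)] cinfD[OF f cutoff(1)]] cutoff(2)] f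
    unfolding coord_field_def fst_conv snd_conv by simp
next
  fix p
  have "dir_deriv (\<lambda>y. f (inv_into U \<phi> y) + g (inv_into U \<phi> y)) v (\<phi> p)
      = dir_deriv (\<lambda>y. f (inv_into U \<phi> y)) v (\<phi> p) + dir_deriv (\<lambda>y. g (inv_into U \<phi> y)) v (\<phi> p)"
    "dir_deriv (\<lambda>y. c * f (inv_into U \<phi> y)) v (\<phi> p) = c * dir_deriv (\<lambda>y. f (inv_into U \<phi> y)) v (\<phi> p)"
    "dir_deriv (\<lambda>y. f (inv_into U \<phi> y) * g (inv_into U \<phi> y)) v (\<phi> p)
      = dir_deriv (\<lambda>y. f (inv_into U \<phi> y)) v (\<phi> p) * g p + f p * dir_deriv (\<lambda>y. g (inv_into U \<phi> y)) v (\<phi> p)"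
    if "f \<in> cinf A" "g \<in> cinf A" "p \<in> U" for f g c
    using fun_cong[OF frechet_derivative_at[OF has_derivative_add[OF
          chart_rep_derivative[OF that(1,3)] chart_rep_derivative[OF that(2,3)]]], of v]
      fun_cong[OF frechet_derivative_at[OF has_derivative_mult_right[OF chart_rep_derivative[OF that(1,3)]]], of c v]
      fun_cong[OF frechet_derivative_at[OF has_derivative_mult[OF
          chart_rep_derivative[OF that(1,3)] chart_rep_derivative[OF that(2,3)]]], of v]
      chart_inv[OF cutoff(1) that(3)] by (simp_all only: add.commute[of "f p * _"])
  then show "tangent_at p (\<lambda>f. coord_field (U, \<phi>) \<eta> v f p)"
    by (auto simp: tangent_at_def coord_field_def cinf_add cinf_mult cinf_cmult algebra_simps)
qed (auto simp: coord_field_def)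

lemma coord_field_coord_fun:
  assumes "x \<in> N"
  shows "coord_field (U, \<phi>) \<eta> v (coord_fun (U, \<phi>) \<eta> b) x = v \<bullet> b"
proof -
  have o: "open (\<phi> ` N)" by (rule chart_image_open[OF cutoff(1,3,4)])
  have "((\<lambda>y. y \<bullet> b) has_derivative (\<lambda>v. v \<bullet> b)) (at (\<phi> x))"
    by (auto intro!: derivative_eq_intros)
  then have "((\<lambda>y. coord_fun (U, \<phi>) \<eta> b (inv_into U \<phi> y)) has_derivative (\<lambda>v. v \<bullet> b)) (at (\<phi> x))"
    by (rule has_derivative_transform_within_open[OF _ o])
      (use assms cutoff coord_fun_eq in \<open>auto simp: subset_iff\<close>)
  from frechet_derivative_at[OF this] show ?thesis
    using assms by (simp add: coord_field_eq coord_fun_cinf fun_eq_iff)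
qed

text \<open>By Hadamard's lemma a tangent vector is determined by its values on the coordinate functions.\<close>

lemma tangent_expand_coord:
  assumes q: "q \<in> N" and \<delta>: "tangent_at q \<delta>" and f: "f \<in> cinf A"
  shows "\<delta> f = (\<Sum>b\<in>Basis. \<delta> (coord_fun (U, \<phi>) \<eta> b) * coord_field (U, \<phi>) \<eta> b f q)"
proof -
  have oN: "open (\<phi> ` N)" by (rule chart_image_open[OF cutoff(1,3,4)])
  then obtain r where r: "r > 0" "ball (\<phi> q) r \<subseteq> \<phi> ` N"
    using q by (auto simp: open_contains_ball)
  define S where "S = ball (\<phi> q) r"
  define W where "W = U \<inter> \<phi> -` S"
  have S: "open S" "convex S" "\<phi> q \<in> S" using r by (auto simp: S_def)
  have W: "open W" "q \<in> W" "W \<subseteq> U"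
    using chart_preimage_open[OF cutoff(1) S(1)] q cutoff(4) S(3) by (auto simp: W_def)
  have WN: "W \<subseteq> N"
  proof
    fix x assume x: "x \<in> W"
    then have "\<phi> x \<in> \<phi> ` N" using r by (auto simp: W_def S_def)
    then obtain z where "z \<in> N" "\<phi> x = \<phi> z" by auto
    then show "x \<in> N" using x chart_inj[OF cutoff(1)] cutoff(4) unfolding W_def inj_on_def by blast
  qed
  have \<phi>W: "\<phi> ` W \<subseteq> S" by (auto simp: W_def)
  have "smooth_on S (\<lambda>y. f (inv_into U \<phi> y))"
    by (rule smooth_on_subset[OF cinfD[OF f cutoff(1)]]) (use r cutoff(4) in \<open>auto simp: S_def\<close>)
  then obtain g where g: "\<And>b. smooth_on S (g b)"
    "\<And>y. y \<in> S \<Longrightarrow> f (inv_into U \<phi> y) = f (inv_into U \<phi> (\<phi> q)) + (\<Sum>b\<in>Basis. ((y - \<phi> q) \<bullet> b) * g b y)"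
    "\<And>b. g b (\<phi> q) = dir_deriv (\<lambda>y. f (inv_into U \<phi> y)) b (\<phi> q)"
    using hadamard[OF S] by blast
  obtain \<zeta> M K where \<zeta>: "\<zeta> \<in> cinf A" "open M" "q \<in> M" "M \<subseteq> W" "\<And>x. x \<in> M \<Longrightarrow> \<zeta> x = 1"
    "closed K" "K \<subseteq> W" "\<And>x. x \<notin> K \<Longrightarrow> \<zeta> x = 0"
    by (rule bump[OF W(1,2)]) blast
  define G where "G b = (\<lambda>x. if x \<in> W then \<zeta> x * g b (\<phi> x) else 0)" for b
  let ?x = "coord_fun (U, \<phi>) \<eta>"
  have G: "G b \<in> cinf A" for b unfolding G_def
    by (rule cinf_extend[OF cutoff(1) W(1,3) smooth_on_subset[OF g(1) \<phi>W] \<zeta>(1,6,7,8)])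
  have "f x = f q + (\<Sum>b\<in>Basis. (?x b x - ?x b q) * G b x)" if "x \<in> M" for x
  proof -
    have x: "x \<in> W" "x \<in> N" "x \<in> U" using that \<zeta>(4) WN W(3) by auto
    then have "\<phi> x \<in> S" using \<phi>W by auto
    from g(2)[OF this] show ?thesis
      using x q cutoff that \<zeta>(5) by (auto simp: coord_fun_eq G_def inner_diff_left subset_iff)
  qed
  then have "\<delta> f = \<delta> (\<lambda>x. f q + (\<Sum>b\<in>Basis. (?x b x - ?x b q) * G b x))"
    by (intro tangent_local[OF \<delta> f _ \<zeta>(2,3)] cinf_intros coord_fun_cinf G)
  also have "\<dots> = (\<Sum>b\<in>Basis. \<delta> (\<lambda>x. (?x b x - ?x b q) * G b x))"
    by (subst tangent_add[OF \<delta>] tangent_sum[OF \<delta>], (intro cinf_intros coord_fun_cinf G)+)+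
      (simp add: tangent_const[OF \<delta>])
  also have "\<dots> = (\<Sum>b\<in>Basis. \<delta> (?x b) * G b q)"
  proof (rule sum.cong[OF refl])
    fix b :: 'e
    have "\<delta> (\<lambda>x. (?x b x - ?x b q) * G b x) = \<delta> (\<lambda>x. ?x b x - ?x b q) * G b q + (?x b q - ?x b q) * \<delta> (G b)"
      by (rule tangent_mult[OF \<delta>]) (intro cinf_intros coord_fun_cinf G)+
    also have "\<delta> (\<lambda>x. ?x b x - ?x b q) = \<delta> (?x b)"
      by (subst tangent_diff[OF \<delta>], (intro cinf_intros coord_fun_cinf)+) (simp add: tangent_const[OF \<delta>])
    finally show "\<delta> (\<lambda>x. (?x b x - ?x b q) * G b x) = \<delta> (?x b) * G b q" by simp
  qed
  also have "\<dots> = (\<Sum>b\<in>Basis. \<delta> (?x b) * coord_field (U, \<phi>) \<eta> b f q)"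
    using W(2) \<zeta>(3,5) q f by (simp add: G_def coord_field_eq g(3))
  finally show ?thesis .
qed

end

text \<open>Coordinate fields of finitely many charts, weighted by a partition of unity, together with the coordinate
  functions of these charts.\<close>

lemma dual_basis:
  assumes "compact (UNIV :: 'a set)"
  obtains I :: "('a \<times> 'e) set" and x E where "finite I"
    "\<And>i. i \<in> I \<Longrightarrow> x i \<in> cinf A" "\<And>i. i \<in> I \<Longrightarrow> E i \<in> vfields A"
    "\<And>p \<delta> f. tangent_at p \<delta> \<Longrightarrow> f \<in> cinf A \<Longrightarrow> \<delta> f = (\<Sum>i\<in>I. \<delta> (x i) * E i f p)"
proof -
  have "\<exists>c \<eta> N \<psi> M. chart_cutoff c \<eta> N \<and> \<psi> \<in> cinf A \<and> (\<forall>x. 0 \<le> \<psi> x) \<and> open M \<and> p \<in> M \<and>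
      (\<forall>x\<in>M. \<psi> x = 1) \<and> (\<forall>x. x \<notin> N \<longrightarrow> \<psi> x = 0)" for p
  proof -
    obtain U \<phi> \<eta> N where c: "chart_cutoff (U, \<phi>) \<eta> N" "p \<in> N" by (rule chart_cutoff_at)
    obtain \<psi> M K where "\<psi> \<in> cinf A" "\<And>x. 0 \<le> \<psi> x" "open M" "p \<in> M" "\<And>x. x \<in> M \<Longrightarrow> \<psi> x = 1"
      "K \<subseteq> N" "\<And>x. x \<notin> K \<Longrightarrow> \<psi> x = 0"
      by (rule bump[OF cutoff(3)[OF c(1)] c(2)]) blast
    moreover from this have "\<psi> x = 0" if "x \<notin> N" for x using that by blast
    ultimately show ?thesis using c by blast
  qed
  then obtain c \<eta> N \<psi> M where cover: "\<And>p. chart_cutoff (c p) (\<eta> p) (N p)" "\<And>p. \<psi> p \<in> cinf A"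
    "\<And>p x. 0 \<le> \<psi> p x" "\<And>p. open (M p)" "\<And>p. p \<in> M p" "\<And>p x. x \<in> M p \<Longrightarrow> \<psi> p x = 1"
    "\<And>p x. x \<notin> N p \<Longrightarrow> \<psi> p x = 0"
    by metis
  have cover1: "chart_cutoff (fst (c p), snd (c p)) (\<eta> p) (N p)" for p using cover(1) by simp
  obtain P where P: "finite P" "(\<Union>p\<in>P. M p) = UNIV"
    proof -
    have "UNIV \<subseteq> (\<Union>p\<in>UNIV. M p)" using cover(5) by blast
    then obtain P where "finite P" "UNIV \<subseteq> (\<Union>p\<in>P. M p)"
      using compactE_image[OF assms, of UNIV M] cover(4) by metis
    then show ?thesis using that by blast
  qed
  define \<Psi> where "\<Psi> x = (\<Sum>p\<in>P. \<psi> p x)" for x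
  have \<Psi>: "\<Psi> x > 0" for x
  proof -
    obtain p where p: "p \<in> P" "x \<in> M p" using P(2) by blast
    have "\<psi> p x \<le> \<Psi> x" unfolding \<Psi>_def by (rule member_le_sum[OF p(1) cover(3) P(1)])
    then show ?thesis using cover(6)[OF p(2)] by simp
  qed
  define w where "w p = (\<lambda>x. \<psi> p x * \<Psi> x powr (-1))" for p
  have w_cinf: "w p \<in> cinf A" for p unfolding w_def \<Psi>_def
    using \<Psi> by (intro cinf_mult cover cinf_compose[OF _ smooth_on_powr] cinf_sum) (auto simp: \<Psi>_def)
  have w_sum: "(\<Sum>p\<in>P. w p x) = 1" for x
    using \<Psi>[of x] by (simp add: w_def powr_minus flip: sum_distrib_right \<Psi>_def)
  define x where "x i = coord_fun (c (fst i)) (\<eta> (fst i)) (snd i)" for i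
  define E where "E i = vf_scale (w (fst i)) (coord_field (c (fst i)) (\<eta> (fst i)) (snd i))" for i
  show ?thesis
  proof (rule that[of "P \<times> Basis" x E])
    show "x i \<in> cinf A" for i unfolding x_def using coord_fun_cinf[OF cover1] by simp
    show "E i \<in> vfields A" for i unfolding E_def
      using vf_scale_vfields[OF w_cinf coord_field_vfields[OF cover1]] by simp
    show "\<delta> f = (\<Sum>i\<in>P \<times> Basis. \<delta> (x i) * E i f q)" if \<delta>: "tangent_at q \<delta>" and f: "f \<in> cinf A" for q \<delta> f
    proof -
      have "w p q * \<delta> f = (\<Sum>b\<in>Basis. \<delta> (x (p, b)) * E (p, b) f q)" for p
      proof (cases "q \<in> N p")
        case True
        then show ?thesis using tangent_expand_coord[OF cover1 True \<delta> f]
          by (simp add: x_def E_def vf_scale_def sum_distrib_left algebra_simps)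
      next
        case False
        then show ?thesis using cover(7) by (simp add: E_def vf_scale_def w_def)
      qed
      then have "(\<Sum>p\<in>P. w p q) * \<delta> f = (\<Sum>p\<in>P. \<Sum>b\<in>Basis. \<delta> (x (p, b)) * E (p, b) f q)"
        by (simp add: sum_distrib_right)
      then show ?thesis by (simp add: w_sum sum.cartesian_product)
    qed
  qed (use P in auto)
qed

end

section \<open>Tensor calculus with a dual basis\<close>

lemma vf_ops [simp]: "vf_add X Y = X + Y" "vf_diff X Y = X - Y" "vf_zero = 0"
  by (auto simp: vf_add_def vf_diff_def vf_zero_def fun_eq_iff)

lemma vf_scale_fun [simp]: "vf_scale h X f = h * X f"
  by (simp add: vf_scale_def fun_eq_iff)

lemma vf_scale_add: "vf_scale h (X + Y) = vf_scale h X + vf_scale h Y"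
  by (simp add: fun_eq_iff algebra_simps)

lemma vf_scale_diff: "vf_scale h (X - Y) = vf_scale h X - vf_scale h Y"
  by (simp add: fun_eq_iff algebra_simps)

lemma vf_bracket_fun: "vf_bracket X Y f = X (Y f) - Y (X f)"
  by (simp add: vf_bracket_def fun_eq_iff)

lemma vf_bracket_swap: "vf_bracket Y X = - vf_bracket X Y"
  by (simp add: fun_eq_iff vf_bracket_fun)

context manifold
begin

lemma cinf_fun_ops:
  "f \<in> cinf A \<Longrightarrow> g \<in> cinf A \<Longrightarrow> f + g \<in> cinf A" "f \<in> cinf A \<Longrightarrow> g \<in> cinf A \<Longrightarrow> f - g \<in> cinf A"
  "f \<in> cinf A \<Longrightarrow> g \<in> cinf A \<Longrightarrow> f * g \<in> cinf A" "f \<in> cinf A \<Longrightarrow> - f \<in> cinf A"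
  unfolding plus_fun_def fun_diff_def times_fun_def fun_Compl_def
  by (rule cinf_intros; assumption)+

lemma vf_fun_ops:
  assumes "X \<in> vfields A"
  shows "f \<in> cinf A \<Longrightarrow> g \<in> cinf A \<Longrightarrow> X (f + g) = X f + X g" "f \<in> cinf A \<Longrightarrow> g \<in> cinf A \<Longrightarrow> X (f - g) = X f - X g"
    "f \<in> cinf A \<Longrightarrow> g \<in> cinf A \<Longrightarrow> X (f * g) = X f * g + f * X g" "f \<in> cinf A \<Longrightarrow> X (- f) = - X f" "X 0 = 0"
  using vf_add[OF assms, of f g] vf_diff[OF assms, of f g] vf_mult[OF assms, of f g]
    vf_cmult[OF assms, of f "-1"] vf_const[OF assms, of 0]
  by (simp_all add: fun_eq_iff plus_fun_def fun_diff_def times_fun_def fun_Compl_def zero_fun_def)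

lemma vf_uminus_vfields: "X \<in> vfields A \<Longrightarrow> - X \<in> vfields A"
  using vf_scale_vfields[OF cinf_const, of X "-1"] by (simp add: vf_scale_def fun_Compl_def)

lemma vf_diff_vfields: "X \<in> vfields A \<Longrightarrow> Y \<in> vfields A \<Longrightarrow> X - Y \<in> vfields A"
  using vf_add_vfields[OF _ vf_uminus_vfields, of X Y] by simp

lemma vf_bracket_vfields: "X \<in> vfields A \<Longrightarrow> Y \<in> vfields A \<Longrightarrow> vf_bracket X Y \<in> vfields A"
proof (rule vfieldsI)
  assume XY: "X \<in> vfields A" "Y \<in> vfields A"
  show "vf_bracket X Y f \<in> cinf A" for f
    using XY unfolding vf_bracket_def by (intro cinf_diff vf_cinf)
  have ops: "(\<lambda>x. f x + g x) = f + g" "(\<lambda>x. f x * g x) = f * g" "(\<lambda>x. c * f x) = (\<lambda>x. c) * f"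
    for f g :: "'a \<Rightarrow> real" and c by (simp_all add: fun_eq_iff)
  have c: "Z (\<lambda>x. c) = 0" if "Z \<in> vfields A" for Z c using that by (simp add: fun_eq_iff vf_const)
  show "tangent_at p (\<lambda>f. vf_bracket X Y f p)" for p
    using XY unfolding tangent_at_def vf_bracket_fun ops
    by (simp add: vf_fun_ops[OF XY(1)] vf_fun_ops[OF XY(2)] c[OF XY(1)] c[OF XY(2)] cinf_fun_ops cinf_const vf_cinf algebra_simps)
  show "vf_bracket X Y f = (\<lambda>p. 0)" if "f \<notin> cinf A" for f
  proof -
    have *: "X f = 0" "Y f = 0" using XY that by (auto simp: vfields_def zero_fun_def)
    show ?thesis by (simp add: fun_eq_iff vf_bracket_fun * vf_fun_ops[OF XY(1)] vf_fun_ops[OF XY(2)])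
  qed
qed

lemmas vfields_intros = vf_zero_vfields vf_add_vfields vf_diff_vfields vf_uminus_vfields vf_scale_vfields
  vf_bracket_vfields

lemma jacobi:
  assumes "X \<in> vfields A" "Y \<in> vfields A" "Z \<in> vfields A"
  shows "vf_bracket X (vf_bracket Y Z) = vf_bracket (vf_bracket X Y) Z + vf_bracket Y (vf_bracket X Z)"
  using assms by (intro vf_eqI)
    (simp_all add: vfields_intros vf_bracket_fun vf_fun_ops[OF assms(1)] vf_fun_ops[OF assms(2)]
      vf_fun_ops[OF assms(3)] cinf_fun_ops vf_cinf)

lemma vf_bracket_add:
  assumes "X \<in> vfields A" "Y \<in> vfields A" "Z \<in> vfields A"
  shows "vf_bracket X (Y + Z) = vf_bracket X Y + vf_bracket X Z"
  using assms by (intro vf_eqI)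
    (simp_all add: vfields_intros vf_bracket_fun vf_fun_ops[OF assms(1)] vf_fun_ops[OF assms(2)] vf_fun_ops[OF assms(3)] cinf_fun_ops vf_cinf algebra_simps)

lemma vf_bracket_add_left:
  assumes "X \<in> vfields A" "Y \<in> vfields A" "Z \<in> vfields A"
  shows "vf_bracket (X + Y) Z = vf_bracket X Z + vf_bracket Y Z"
  using assms by (intro vf_eqI)
    (simp_all add: vfields_intros vf_bracket_fun vf_fun_ops[OF assms(1)] vf_fun_ops[OF assms(2)] vf_fun_ops[OF assms(3)] cinf_fun_ops vf_cinf algebra_simps)

lemma vf_bracket_diff:
  assumes "X \<in> vfields A" "Y \<in> vfields A" "Z \<in> vfields A"
  shows "vf_bracket X (Y - Z) = vf_bracket X Y - vf_bracket X Z"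
  using assms by (intro vf_eqI)
    (simp_all add: vfields_intros vf_bracket_fun vf_fun_ops[OF assms(1)] vf_fun_ops[OF assms(2)] vf_fun_ops[OF assms(3)] cinf_fun_ops vf_cinf algebra_simps)

lemma vf_bracket_scale:
  assumes "h \<in> cinf A" "X \<in> vfields A" "Y \<in> vfields A"
  shows "vf_bracket X (vf_scale h Y) = vf_scale (X h) Y + vf_scale h (vf_bracket X Y)"
  using assms by (intro vf_eqI)
    (simp_all add: vfields_intros vf_bracket_fun vf_fun_ops[OF assms(2)] vf_fun_ops[OF assms(3)] cinf_fun_ops vf_cinf algebra_simps)

lemma vf_bracket_scale_left:
  assumes "h \<in> cinf A" "X \<in> vfields A" "Y \<in> vfields A"
  shows "vf_bracket (vf_scale h X) Y = vf_scale h (vf_bracket X Y) - vf_scale (Y h) X"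
  using assms by (intro vf_eqI)
    (simp_all add: vfields_intros vf_bracket_fun vf_fun_ops[OF assms(2)] vf_fun_ops[OF assms(3)] cinf_fun_ops vf_cinf algebra_simps)

definition covector :: "('a vf \<Rightarrow> 'a \<Rightarrow> real) \<Rightarrow> bool" where
  "covector \<theta> \<longleftrightarrow> (\<forall>X\<in>vfields A. \<theta> X \<in> cinf A) \<and>
     (\<forall>X\<in>vfields A. \<forall>Y\<in>vfields A. \<forall>p. \<theta> (X + Y) p = \<theta> X p + \<theta> Y p) \<and>
     (\<forall>h\<in>cinf A. \<forall>X\<in>vfields A. \<forall>p. \<theta> (vf_scale h X) p = h p * \<theta> X p)"

lemma covectorI:
  assumes "\<And>X. X \<in> vfields A \<Longrightarrow> \<theta> X \<in> cinf A"
    "\<And>X Y p. X \<in> vfields A \<Longrightarrow> Y \<in> vfields A \<Longrightarrow> \<theta> (X + Y) p = \<theta> X p + \<theta> Y p"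
    "\<And>h X p. h \<in> cinf A \<Longrightarrow> X \<in> vfields A \<Longrightarrow> \<theta> (vf_scale h X) p = h p * \<theta> X p"
  shows "covector \<theta>"
  using assms by (auto simp: covector_def)

lemma covector_cinf: "covector \<theta> \<Longrightarrow> X \<in> vfields A \<Longrightarrow> \<theta> X \<in> cinf A"
  and covector_add: "covector \<theta> \<Longrightarrow> X \<in> vfields A \<Longrightarrow> Y \<in> vfields A \<Longrightarrow> \<theta> (X + Y) p = \<theta> X p + \<theta> Y p"
  and covector_scale: "covector \<theta> \<Longrightarrow> h \<in> cinf A \<Longrightarrow> X \<in> vfields A \<Longrightarrow> \<theta> (vf_scale h X) p = h p * \<theta> X p"
  by (auto simp: covector_def)

lemma covector_zero: "covector \<theta> \<Longrightarrow> \<theta> (0 :: 'a vf) p = 0"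
  using covector_add[of \<theta> 0 0 p] vf_zero_vfields by simp

lemma covector_uminus: "covector \<theta> \<Longrightarrow> X \<in> vfields A \<Longrightarrow> \<theta> (- X) p = - \<theta> X p"
  using covector_add[of \<theta> X "- X" p] covector_zero[of \<theta> p] vf_uminus_vfields by simp

lemma covector_diff: "covector \<theta> \<Longrightarrow> X \<in> vfields A \<Longrightarrow> Y \<in> vfields A \<Longrightarrow> \<theta> (X - Y) p = \<theta> X p - \<theta> Y p"
  using covector_add[of \<theta> X "- Y" p] covector_uminus[of \<theta> Y p] vf_uminus_vfields by simp

lemma covector_sum: "covector \<theta> \<Longrightarrow> (\<And>i. i \<in> K \<Longrightarrow> X i \<in> vfields A) \<Longrightarrow> \<theta> (\<Sum>i\<in>K. X i) p = (\<Sum>i\<in>K. \<theta> (X i) p)"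
  by (induction K rule: infinite_finite_induct) (auto simp: covector_zero covector_add vf_sum_vfields)

definition endo :: "('a vf \<Rightarrow> 'a vf) \<Rightarrow> bool" where
  "endo T \<longleftrightarrow> (\<forall>X\<in>vfields A. T X \<in> vfields A) \<and> (\<forall>f\<in>cinf A. covector (\<lambda>X. T X f))"

lemma endo_vfields: "endo T \<Longrightarrow> X \<in> vfields A \<Longrightarrow> T X \<in> vfields A"
  by (auto simp: endo_def)

lemma endo_covector: "endo T \<Longrightarrow> f \<in> cinf A \<Longrightarrow> covector (\<lambda>X. T X f)"
  by (auto simp: endo_def)

lemma endoI:
  assumes "\<And>X. X \<in> vfields A \<Longrightarrow> T X \<in> vfields A"
    "\<And>X Y. X \<in> vfields A \<Longrightarrow> Y \<in> vfields A \<Longrightarrow> T (X + Y) = T X + T Y"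
    "\<And>h X. h \<in> cinf A \<Longrightarrow> X \<in> vfields A \<Longrightarrow> T (vf_scale h X) = vf_scale h (T X)"
  shows "endo T"
  unfolding endo_def covector_def using assms by (simp add: vf_cinf)

lemma endo_add:
  assumes "endo T" "X \<in> vfields A" "Y \<in> vfields A"
  shows "T (X + Y) = T X + T Y"
  using assms by (intro vf_eqI) (simp_all add: vfields_intros endo_vfields covector_add[OF endo_covector[OF assms(1)]])

lemma endo_scale:
  assumes "endo T" "h \<in> cinf A" "X \<in> vfields A"
  shows "T (vf_scale h X) = vf_scale h (T X)"
  using assms by (intro vf_eqI) (simp_all add: vfields_intros endo_vfields covector_scale[OF endo_covector[OF assms(1)]])

lemma endo_diff:
  assumes "endo T" "X \<in> vfields A" "Y \<in> vfields A"
  shows "T (X - Y) = T X - T Y"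
  using assms by (intro vf_eqI) (simp_all add: vfields_intros endo_vfields covector_diff[OF endo_covector[OF assms(1)]])

lemma endo_uminus:
  assumes "endo T" "X \<in> vfields A"
  shows "T (- X) = - T X"
  using assms by (intro vf_eqI) (simp_all add: vfields_intros endo_vfields covector_uminus[OF endo_covector[OF assms(1)]])

lemma endo_compose:
  assumes "endo S" "endo T"
  shows "endo (\<lambda>X. S (T X))"
  using endo_vfields[OF assms(2)]
  by (intro endoI) (simp_all add: endo_vfields[OF assms(1)] endo_add[OF assms(1)] endo_scale[OF assms(1)]
      endo_add[OF assms(2)] endo_scale[OF assms(2)])

end

text \<open>A finite dual basis \<open>(x\<^sub>i, E\<^sub>i)\<close> of the module of vector fields replaces local frames: it is global and
  every tensor is determined by its components, although the \<open>E\<^sub>i\<close> are not linearly independent.\<close>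

locale manifold_dual_basis = manifold A
  for A :: "('a::{t2_space,second_countable_topology}, 'e::euclidean_space) atlas" +
  fixes I :: "'i set" and x :: "'i \<Rightarrow> 'a \<Rightarrow> real" and E :: "'i \<Rightarrow> 'a vf"
  assumes finite_I: "finite I"
    and x_cinf: "\<And>i. i \<in> I \<Longrightarrow> x i \<in> cinf A" and E_vfields: "\<And>i. i \<in> I \<Longrightarrow> E i \<in> vfields A"
    and tangent_expand: "\<And>p \<delta> f. tangent_at p \<delta> \<Longrightarrow> f \<in> cinf A \<Longrightarrow> \<delta> f = (\<Sum>i\<in>I. \<delta> (x i) * E i f p)"
begin

lemma vf_expand: "X \<in> vfields A \<Longrightarrow> X = (\<Sum>i\<in>I. vf_scale (X (x i)) (E i))"
proof (rule vf_eqI)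
  assume X: "X \<in> vfields A"
  show "(\<Sum>i\<in>I. vf_scale (X (x i)) (E i)) \<in> vfields A"
    using X by (auto intro: vf_sum_vfields vf_scale_vfields vf_cinf E_vfields)
  show "X f p = (\<Sum>i\<in>I. vf_scale (X (x i)) (E i)) f p" if "f \<in> cinf A" for f p
    using tangent_expand[OF vf_tangent[OF X] that, of p] by (simp add: sum_fun_apply)
qed

lemma covector_expand:
  assumes "covector \<theta>" "X \<in> vfields A"
  shows "\<theta> X p = (\<Sum>i\<in>I. X (x i) p * \<theta> (E i) p)"
proof -
  have "\<theta> X p = \<theta> (\<Sum>i\<in>I. vf_scale (X (x i)) (E i)) p" using vf_expand[OF assms(2)] by simp
  also have "\<dots> = (\<Sum>i\<in>I. X (x i) p * \<theta> (E i) p)"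
    using covector_sum[OF assms(1), of I "\<lambda>i. vf_scale (X (x i)) (E i)"] assms(2)
    by (simp add: vf_scale_vfields vf_cinf E_vfields covector_scale[OF assms(1)] del: vf_scale_fun)
  finally show ?thesis .
qed

lemma covector_pointwise:
  assumes "covector \<theta>" "X \<in> vfields A" "Y \<in> vfields A" "\<And>f. f \<in> cinf A \<Longrightarrow> X f p = Y f p"
  shows "\<theta> X p = \<theta> Y p"
  using covector_expand[OF assms(1,2), of p] covector_expand[OF assms(1,3), of p] assms(4) x_cinf by simp

lemma endo_expand:
  assumes "endo T" "X \<in> vfields A" "f \<in> cinf A"
  shows "T X f p = (\<Sum>i\<in>I. X (x i) p * T (E i) f p)"
  using covector_expand[OF endo_covector[OF assms(1,3)] assms(2)] .

definition tr :: "('a vf \<Rightarrow> 'a vf) \<Rightarrow> 'a \<Rightarrow> real" where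
  "tr T = (\<lambda>p. \<Sum>i\<in>I. T (E i) (x i) p)"

lemma tr_cinf: "endo T \<Longrightarrow> tr T \<in> cinf A"
  unfolding tr_def by (intro cinf_sum) (rule vf_cinf[OF endo_vfields[OF _ E_vfields]])

text \<open>Both sides contract the same tensor \<open>T = \<Sum>\<^sub>a \<theta>\<^sub>a \<otimes> Y\<^sub>a\<close>: expanding each \<open>Y\<^sub>a\<close> in the dual basis turns one sum into
  the other. In this way traces in frames and traces of transported endomorphisms are computed without matrices.\<close>

lemma tr_eq:
  assumes "finite K" "\<And>a. a \<in> K \<Longrightarrow> covector (\<theta> a)" "\<And>a. a \<in> K \<Longrightarrow> Y a \<in> vfields A"
    and "\<And>X f. X \<in> vfields A \<Longrightarrow> f \<in> cinf A \<Longrightarrow> T X f p = (\<Sum>a\<in>K. \<theta> a X p * Y a f p)"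
  shows "tr T p = (\<Sum>a\<in>K. \<theta> a (Y a) p)"
proof -
  have "tr T p = (\<Sum>i\<in>I. \<Sum>a\<in>K. \<theta> a (E i) p * Y a (x i) p)"
    unfolding tr_def by (intro sum.cong refl assms(4) E_vfields x_cinf)
  also have "\<dots> = (\<Sum>a\<in>K. \<Sum>i\<in>I. Y a (x i) p * \<theta> a (E i) p)"
    by (subst sum.swap) (simp add: mult.commute)
  also have "\<dots> = (\<Sum>a\<in>K. \<theta> a (Y a) p)"
    using assms(2,3) by (intro sum.cong refl covector_expand[symmetric])
  finally show ?thesis .
qed

end

section \<open>Connections\<close>

locale connection = manifold A
  for A :: "('a::{t2_space,second_countable_topology}, 'e::euclidean_space) atlas" +
  fixes N :: "'a connection"
  assumes connection: "is_connection A N"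
begin

lemma conn_vfields: "X \<in> vfields A \<Longrightarrow> Y \<in> vfields A \<Longrightarrow> N X Y \<in> vfields A"
  and conn_add_left: "X \<in> vfields A \<Longrightarrow> Y \<in> vfields A \<Longrightarrow> Z \<in> vfields A \<Longrightarrow> N (X + Y) Z = N X Z + N Y Z"
  and conn_add: "X \<in> vfields A \<Longrightarrow> Y \<in> vfields A \<Longrightarrow> Z \<in> vfields A \<Longrightarrow> N X (Y + Z) = N X Y + N X Z"
  and conn_scale_left: "h \<in> cinf A \<Longrightarrow> X \<in> vfields A \<Longrightarrow> Y \<in> vfields A \<Longrightarrow> N (vf_scale h X) Y = vf_scale h (N X Y)"
  and conn_scale: "h \<in> cinf A \<Longrightarrow> X \<in> vfields A \<Longrightarrow> Y \<in> vfields A \<Longrightarrow>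
    N X (vf_scale h Y) = vf_scale (X h) Y + vf_scale h (N X Y)"
  using connection unfolding is_connection_def by auto

lemma conn_endo: "Y \<in> vfields A \<Longrightarrow> endo (\<lambda>X. N X Y)"
  by (rule endoI) (simp_all add: conn_vfields conn_add_left conn_scale_left)

lemma conn_diff_left: "X \<in> vfields A \<Longrightarrow> Y \<in> vfields A \<Longrightarrow> Z \<in> vfields A \<Longrightarrow> N (X - Y) Z = N X Z - N Y Z"
  by (rule endo_diff[OF conn_endo])

lemma conn_uminus_left: "X \<in> vfields A \<Longrightarrow> Z \<in> vfields A \<Longrightarrow> N (- X) Z = - N X Z"
  by (rule endo_uminus[OF conn_endo])

lemma conn_uminus:
  assumes "X \<in> vfields A" "Y \<in> vfields A"
  shows "N X (- Y) = - N X Y"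
proof -
  have *: "vf_scale (\<lambda>p. -1) Z = - Z" for Z :: "'a vf" by (simp add: fun_eq_iff)
  have "X (\<lambda>p. -1) = 0" using assms(1) by (simp add: fun_eq_iff vf_const)
  moreover have "vf_scale 0 Y = 0" by (simp add: fun_eq_iff)
  ultimately show ?thesis using conn_scale[OF cinf_const assms, of "-1"] by (simp add: *)
qed

lemma conn_diff: "X \<in> vfields A \<Longrightarrow> Y \<in> vfields A \<Longrightarrow> Z \<in> vfields A \<Longrightarrow> N X (Y - Z) = N X Y - N X Z"
  using conn_add[of X Y "- Z"] conn_uminus[of X Z] vf_uminus_vfields by simp

lemma curvature_eq: "curvature N X Y Z = N (vf_bracket X Y) Z - (N X (N Y Z) - N Y (N X Z))"
  by (simp add: curvature_def)

lemma curvature_vfields: "X \<in> vfields A \<Longrightarrow> Y \<in> vfields A \<Longrightarrow> Z \<in> vfields A \<Longrightarrow> curvature N X Y Z \<in> vfields A"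
  unfolding curvature_eq by (intro vfields_intros conn_vfields)

lemma curvature_swap: "X \<in> vfields A \<Longrightarrow> Y \<in> vfields A \<Longrightarrow> Z \<in> vfields A \<Longrightarrow> curvature N Y X Z = - curvature N X Y Z"
  unfolding curvature_eq vf_bracket_swap[of Y X] by (simp add: conn_uminus_left vf_bracket_vfields)

lemma curvature_endo: "X \<in> vfields A \<Longrightarrow> Y \<in> vfields A \<Longrightarrow> endo (curvature N X Y)"
proof (rule endoI)
  fix h Z assume *: "X \<in> vfields A" "Y \<in> vfields A" "h \<in> cinf A" "Z \<in> vfields A"
  then have "vf_scale (vf_bracket X Y h) Z = vf_scale (X (Y h)) Z - vf_scale (Y (X h)) Z"
    by (simp add: fun_eq_iff vf_bracket_fun algebra_simps)
  with * show "curvature N X Y (vf_scale h Z) = vf_scale h (curvature N X Y Z)"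
    unfolding curvature_eq
    by (simp add: conn_scale conn_add conn_vfields vf_cinf vfields_intros vf_scale_diff vf_scale_add)
qed (simp_all add: curvature_eq vfields_intros conn_vfields conn_add conn_diff)

lemma curvature_endo_left: "Y \<in> vfields A \<Longrightarrow> Z \<in> vfields A \<Longrightarrow> endo (\<lambda>X. curvature N X Y Z)"
proof (rule endoI)
  fix h X assume *: "X \<in> vfields A" "Y \<in> vfields A" "h \<in> cinf A" "Z \<in> vfields A"
  then show "curvature N (vf_scale h X) Y Z = vf_scale h (curvature N X Y Z)"
    unfolding curvature_eq
    by (simp add: conn_scale conn_scale_left conn_add conn_diff_left conn_vfields vf_cinf vfields_intros vf_scale_diff
        vf_scale_add vf_bracket_scale_left)
qed (simp_all add: curvature_eq vfields_intros conn_vfields conn_add conn_add_left conn_diff vf_bracket_add_left)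

end

context connection
begin

lemma conn_sum: "X \<in> vfields A \<Longrightarrow> (\<And>i. i \<in> K \<Longrightarrow> Y i \<in> vfields A) \<Longrightarrow> N X (\<Sum>i\<in>K. Y i) = (\<Sum>i\<in>K. N X (Y i))"
proof (induction K rule: infinite_finite_induct)
  case empty
  have "N X 0 = 0" using conn_add[OF empty(1) vf_zero_vfields vf_zero_vfields] by simp
  then show ?case by (simp only: sum.empty)
next
  case (infinite K)
  have "N X 0 = 0" using conn_add[OF infinite(2) vf_zero_vfields vf_zero_vfields] by simp
  then show ?case using infinite(1) by (simp only: sum.infinite not_False_eq_True)
qed (simp add: conn_add vf_sum_vfields)

text \<open>The second Bianchi identity, with the curvature operators differentiated as endomorphisms and not in
  their indices. In this form no torsion appears, and everything cancels by the Jacobi identity.\<close>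

lemma bianchi:
  assumes "X \<in> vfields A" "Y \<in> vfields A" "Z \<in> vfields A" "W \<in> vfields A"
  shows "N X (curvature N Y Z W) - curvature N Y Z (N X W)
    - (N Y (curvature N X Z W) - curvature N X Z (N Y W))
    + (N Z (curvature N X Y W) - curvature N X Y (N Z W))
    - curvature N (vf_bracket X Y) Z W + curvature N (vf_bracket X Z) Y W - curvature N (vf_bracket Y Z) X W = 0"
proof -
  have "vf_bracket (vf_bracket Y Z) X = - vf_bracket X (vf_bracket Y Z)"
    "vf_bracket (vf_bracket X Z) Y = - vf_bracket Y (vf_bracket X Z)"
    by (rule vf_bracket_swap)+
  with jacobi[OF assms(1-3)] show ?thesis
    using assms unfolding curvature_eq
    by (simp add: conn_diff conn_add conn_add_left conn_diff_left conn_uminus_left conn_vfields vfields_intros)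
qed

end

locale manifold_connection = manifold_dual_basis A I x E + connection A N
  for A :: "('a::{t2_space,second_countable_topology}, 'e::euclidean_space) atlas"
    and I :: "'i set" and x E N
begin

text \<open>Write \<open>T = \<Sum>\<^sub>i \<theta>\<^sub>i \<otimes> T(E\<^sub>i)\<close> with \<open>\<theta>\<^sub>i(Y) = Y(x\<^sub>i)\<close>. By the Leibniz rule \<open>[N\<^sub>X, T]\<close> is a sum of products with
  the derivative on \<open>\<theta>\<^sub>i\<close> and of products with the derivative on \<open>T(E\<^sub>i)\<close>; this is why the index set
  is \<open>I <+> I\<close>. The contractions of both add up to \<open>\<Sum>\<^sub>i X(\<theta>\<^sub>i(T(E\<^sub>i)))\<close>.\<close>

lemma tr_derivative:
  assumes T: "endo T" and X: "X \<in> vfields A"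
  shows "X (tr T) p = tr (\<lambda>Y. N X (T Y) - T (N X Y)) p"
proof -
  define \<theta> where "\<theta> = case_sum (\<lambda>i Y. X (Y (x i)) - N X Y (x i)) (\<lambda>i Y. Y (x i))"
  define Z where "Z = case_sum (\<lambda>i. T (E i)) (\<lambda>i. N X (T (E i)))"
  note TE = endo_vfields[OF T E_vfields]
  have cov: "covector (\<theta> a)" if "a \<in> I <+> I" for a
  proof (cases a)
    case (Inl i)
    then have "x i \<in> cinf A" using that x_cinf by auto
    then show ?thesis unfolding Inl \<theta>_def sum.case
      by (intro covectorI)
        (simp_all add: cinf_fun_ops vf_cinf conn_vfields X conn_add conn_scale vf_fun_ops[OF X] algebra_simps)
  next
    case (Inr i)
    then have "x i \<in> cinf A" using that x_cinf by auto
    then show ?thesis unfolding Inr \<theta>_def sum.case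
      by (intro covectorI) (simp_all add: vf_cinf)
  qed
  have Z: "Z a \<in> vfields A" if "a \<in> I <+> I" for a
    using that TE X by (auto simp: Z_def conn_vfields split: sum.splits)
  have "tr (\<lambda>Y. N X (T Y) - T (N X Y)) p = (\<Sum>a\<in>I <+> I. \<theta> a (Z a) p)"
  proof (rule tr_eq[where K = "I <+> I" and \<theta> = \<theta> and Y = Z])
    fix Y f assume Y: "Y \<in> vfields A" and f: "f \<in> cinf A"
    have TY: "T Y = (\<Sum>i\<in>I. vf_scale (Y (x i)) (T (E i)))"
    proof (rule vf_eqI)
      show "T Y f p = (\<Sum>i\<in>I. vf_scale (Y (x i)) (T (E i))) f p" if "f \<in> cinf A" for f p
        using endo_expand[OF T Y that, of p] by (simp add: sum_fun_apply)
    qed (auto intro!: endo_vfields[OF T] Y vf_sum_vfields vf_scale_vfields vf_cinf[OF Y] TE)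
    have "N X (T Y) = (\<Sum>i\<in>I. N X (vf_scale (Y (x i)) (T (E i))))"
      unfolding TY by (rule conn_sum[OF X]) (auto intro!: vf_scale_vfields vf_cinf[OF Y] TE)
    also have "\<dots> = (\<Sum>i\<in>I. vf_scale (X (Y (x i))) (T (E i)) + vf_scale (Y (x i)) (N X (T (E i))))"
      by (intro sum.cong refl conn_scale X TE vf_cinf[OF Y])
    finally have "N X (T Y) f p = (\<Sum>i\<in>I. X (Y (x i)) p * T (E i) f p + Y (x i) p * N X (T (E i)) f p)"
      by (simp add: sum_fun_apply)
    moreover have "T (N X Y) f p = (\<Sum>i\<in>I. N X Y (x i) p * T (E i) f p)"
      by (rule endo_expand[OF T conn_vfields[OF X Y] f])
    ultimately show "(N X (T Y) - T (N X Y)) f p = (\<Sum>a\<in>I <+> I. \<theta> a Y p * Z a f p)"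
      using finite_I by (simp add: sum.Plus \<theta>_def Z_def sum.distrib sum_subtractf algebra_simps)
  qed (use finite_I cov Z in auto)
  also have "\<dots> = (\<Sum>i\<in>I. X (T (E i) (x i)) p)"
    using finite_I by (simp add: sum.Plus \<theta>_def Z_def sum_subtractf)
  also have "\<dots> = X (tr T) p"
    unfolding tr_def using TE x_cinf by (intro vf_sum[OF X, symmetric] vf_cinf)
  finally show ?thesis by simp
qed

end

section \<open>Almost-Kaehler manifolds\<close>

context manifold
begin

lemma form1_covector:
  assumes "is_form A 1 \<alpha>"
  shows "covector (\<lambda>X. \<alpha> [X])"
proof -
  have *: "\<alpha> Xs \<in> cinf A \<and>
      (\<forall>i<1. \<forall>Y\<in>vfields A. \<alpha> (Xs[i := vf_add (Xs ! i) Y]) = (\<lambda>p. \<alpha> Xs p + \<alpha> (Xs[i := Y]) p)) \<and>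
      (\<forall>i<1. \<forall>h\<in>cinf A. \<alpha> (Xs[i := vf_scale h (Xs ! i)]) = (\<lambda>p. h p * \<alpha> Xs p))"
    if "length Xs = 1" "set Xs \<subseteq> vfields A" for Xs
    using assms that unfolding is_form_def by blast
  show ?thesis
  proof (rule covectorI)
    fix X assume X: "X \<in> vfields A"
    note X1 = *[of "[X]"]
    show "\<alpha> [X] \<in> cinf A" using X1 X by simp
    show "\<alpha> [X + Y] p = \<alpha> [X] p + \<alpha> [Y] p" if "Y \<in> vfields A" for Y p
      using X1[THEN conjunct2, THEN conjunct1, rule_format, of 0 Y] X that by simp
    show "\<alpha> [vf_scale h X] p = h p * \<alpha> [X] p" if "h \<in> cinf A" for h p
      using X1[THEN conjunct2, THEN conjunct2, rule_format, of 0 h] X that by simp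
  qed
qed

lemma form2:
  assumes "is_form A 2 \<alpha>" "X \<in> vfields A" "Y \<in> vfields A"
  shows form2_cinf: "\<alpha> [X, Y] \<in> cinf A"
    and form2_add: "Z \<in> vfields A \<Longrightarrow> \<alpha> [X + Z, Y] p = \<alpha> [X, Y] p + \<alpha> [Z, Y] p"
    and form2_scale: "h \<in> cinf A \<Longrightarrow> \<alpha> [vf_scale h X, Y] p = h p * \<alpha> [X, Y] p"
    and form2_add_right: "Z \<in> vfields A \<Longrightarrow> \<alpha> [X, Y + Z] p = \<alpha> [X, Y] p + \<alpha> [X, Z] p"
    and form2_self: "\<alpha> [X, X] p = 0"
proof -
  have *: "length Xs = 2 \<Longrightarrow> set Xs \<subseteq> vfields A \<Longrightarrow> \<alpha> Xs \<in> cinf A \<and>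
      (\<forall>i<2. \<forall>Y\<in>vfields A. \<alpha> (Xs[i := vf_add (Xs ! i) Y]) = (\<lambda>p. \<alpha> Xs p + \<alpha> (Xs[i := Y]) p)) \<and>
      (\<forall>i<2. \<forall>h\<in>cinf A. \<alpha> (Xs[i := vf_scale h (Xs ! i)]) = (\<lambda>p. h p * \<alpha> Xs p)) \<and>
      (\<forall>i<2. \<forall>j<i. Xs ! i = Xs ! j \<longrightarrow> \<alpha> Xs = (\<lambda>p. 0))" for Xs
    using assms(1) unfolding is_form_def by blast
  note XY = *[of "[X, Y]"] and XX = *[of "[X, X]"]
  show "\<alpha> [X, Y] \<in> cinf A" using XY assms by simp
  show "\<alpha> [X + Z, Y] p = \<alpha> [X, Y] p + \<alpha> [Z, Y] p" if "Z \<in> vfields A"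
    using XY[THEN conjunct2, THEN conjunct1, rule_format, of 0 Z] assms that by simp
  show "\<alpha> [vf_scale h X, Y] p = h p * \<alpha> [X, Y] p" if "h \<in> cinf A"
    using XY[THEN conjunct2, THEN conjunct2, THEN conjunct1, rule_format, of 0 h] assms that by simp
  show "\<alpha> [X, Y + Z] p = \<alpha> [X, Y] p + \<alpha> [X, Z] p" if "Z \<in> vfields A"
    using XY[THEN conjunct2, THEN conjunct1, rule_format, of 1 Z] assms that by simp
  show "\<alpha> [X, X] p = 0"
    using XX[THEN conjunct2, THEN conjunct2, THEN conjunct2, rule_format, of 1 0] assms by simp
qed

lemma form2_swap:
  assumes "is_form A 2 \<alpha>" "X \<in> vfields A" "Y \<in> vfields A"
  shows "\<alpha> [Y, X] p = - \<alpha> [X, Y] p"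
  using form2_self[OF assms(1), of "X + Y" "X + Y" p] form2_self[OF assms(1), of X X p]
    form2_self[OF assms(1), of Y Y p] form2_add[OF assms(1), of X "X + Y" Y p]
    form2_add_right[OF assms(1), of X X Y p] form2_add_right[OF assms(1), of Y X Y p] assms(2,3)
  by (simp add: vf_add_vfields)

lemma form2_covector: "is_form A 2 \<alpha> \<Longrightarrow> Y \<in> vfields A \<Longrightarrow> covector (\<lambda>X. \<alpha> [X, Y])"
  by (rule covectorI) (simp_all add: form2_cinf form2_add form2_scale)

lemma ext_deriv_zero_form: "Y \<in> vfields A \<Longrightarrow> ext_deriv A (zero_form_of f) [Y] p = Y f p"
  by (simp add: ext_deriv_def zero_form_of_def nths_def)

lemma ext_deriv_one_form:
  assumes "X \<in> vfields A" "Y \<in> vfields A"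
  shows "ext_deriv A \<alpha> [X, Y] p = X (\<alpha> [Y]) p - Y (\<alpha> [X]) p - \<alpha> [vf_bracket X Y] p"
  using assms by (simp add: ext_deriv_def nths_def lessThan_Suc numeral_2_eq_2)

lemma ext_deriv_two_form:
  assumes "X \<in> vfields A" "Y \<in> vfields A" "Z \<in> vfields A"
  shows "ext_deriv A \<alpha> [X, Y, Z] p = X (\<alpha> [Y, Z]) p - Y (\<alpha> [X, Z]) p + Z (\<alpha> [X, Y]) p
    - \<alpha> [vf_bracket X Y, Z] p + \<alpha> [vf_bracket X Z, Y] p - \<alpha> [vf_bracket Y Z, X] p"
  using assms by (simp add: ext_deriv_def nths_def lessThan_Suc numeral_2_eq_2 numeral_3_eq_3)

end

locale almost_kaehler = manifold_dual_basis A I x E + D: connection A D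
  for A :: "('a::{t2_space,second_countable_topology}, 'e::euclidean_space) atlas"
    and I :: "'i set" and x E D +
  fixes \<omega> :: "'a form" and J :: "'a vf \<Rightarrow> 'a vf"
  assumes omega_closed: "closed_form A 2 \<omega>"
    and compatible: "compatible A \<omega> J"
    and levi_civita: "levi_civita A (ak_metric \<omega> J) D"
begin

abbreviation g :: "'a metric_field" where "g \<equiv> ak_metric \<omega> J"

abbreviation N :: "'a connection" where "N \<equiv> canonical_hermitian J D"

lemma omega_form: "is_form A 2 \<omega>"
  using omega_closed by (simp add: closed_form_def)

lemma J_endo: "endo J"
proof (rule endoI)
qed (use compatible in \<open>auto simp: compatible_def almost_complex_def endo_field_def\<close>)

lemmas J_vfields = endo_vfields[OF J_endo] and J_add = endo_add[OF J_endo] and J_diff = endo_diff[OF J_endo]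
  and J_scale = endo_scale[OF J_endo] and J_uminus = endo_uminus[OF J_endo]

lemma vf_scale_minus_one: "vf_scale (\<lambda>p. -1) X = - X"
  by (simp add: fun_eq_iff)

lemma J_J: "X \<in> vfields A \<Longrightarrow> J (J X) = - X"
  using compatible by (simp add: compatible_def almost_complex_def vf_scale_minus_one)

lemma omega_J: "X \<in> vfields A \<Longrightarrow> Y \<in> vfields A \<Longrightarrow> \<omega> [J X, J Y] = \<omega> [X, Y]"
  using compatible by (simp add: compatible_def)

lemmas omega_covector = form2_covector[OF omega_form]
  and omega_cinf = form2_cinf[OF omega_form]

lemma g_eq: "g X Y = \<omega> [X, J Y]"
  by (simp add: ak_metric_def)

lemma g_cinf: "X \<in> vfields A \<Longrightarrow> Y \<in> vfields A \<Longrightarrow> g X Y \<in> cinf A"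
  by (simp add: g_eq omega_cinf J_vfields)

lemma g_sym: "X \<in> vfields A \<Longrightarrow> Y \<in> vfields A \<Longrightarrow> g X Y = g Y X"
  using compatible by (simp add: compatible_def riemannian_metric_def)

lemma g_covector: "Y \<in> vfields A \<Longrightarrow> covector (\<lambda>X. g X Y)"
  unfolding g_eq by (intro omega_covector J_vfields)

lemma g_covector_right: "X \<in> vfields A \<Longrightarrow> covector (\<lambda>Y. g X Y)"
  using g_covector[of X] g_sym[of X] unfolding covector_def
  by (simp add: vf_add_vfields vf_scale_vfields del: vf_scale_fun)

lemma g_J: "X \<in> vfields A \<Longrightarrow> Y \<in> vfields A \<Longrightarrow> g (J X) (J Y) = g X Y"
  by (simp add: g_eq omega_J J_vfields)

lemma omega_g: "X \<in> vfields A \<Longrightarrow> Y \<in> vfields A \<Longrightarrow> g (J X) Y = \<omega> [X, Y]"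
  by (simp add: g_eq omega_J)

lemma g_nondegenerate:
  assumes "X \<in> vfields A" "\<And>Z. Z \<in> vfields A \<Longrightarrow> g X Z p = 0"
  shows "X f p = 0"
proof -
  have "vanishes_at X p"
    using compatible assms(1) assms(2)[OF assms(1)]
    unfolding compatible_def riemannian_metric_def by (metis less_irrefl)
  then show ?thesis by (simp add: vanishes_at_def)
qed

lemma D_torsion_free: "X \<in> vfields A \<Longrightarrow> Y \<in> vfields A \<Longrightarrow> D X Y - D Y X = vf_bracket X Y"
  and D_metric: "X \<in> vfields A \<Longrightarrow> Y \<in> vfields A \<Longrightarrow> Z \<in> vfields A \<Longrightarrow>
    X (g Y Z) = g (D X Y) Z + g Y (D X Z)"
  using levi_civita by (auto simp: levi_civita_def plus_fun_def)

text \<open>The argument behind the uniqueness of the Levi-Civita connection: a trilinear expression that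
  is symmetric in the first two and skew in the last two arguments vanishes.\<close>

lemma symmetric_skew_zero:
  assumes T: "\<And>X Y. X \<in> vfields A \<Longrightarrow> Y \<in> vfields A \<Longrightarrow> T X Y \<in> vfields A"
    and sym: "\<And>X Y. X \<in> vfields A \<Longrightarrow> Y \<in> vfields A \<Longrightarrow> T X Y = T Y X"
    and skew: "\<And>X Y Z p. X \<in> vfields A \<Longrightarrow> Y \<in> vfields A \<Longrightarrow> Z \<in> vfields A \<Longrightarrow> g (T X Y) Z p + g Y (T X Z) p = 0"
    and XY: "X \<in> vfields A" "Y \<in> vfields A"
  shows "T X Y = 0"
proof -
  have sk: "g (T X Y) Z p = - g (T X Z) Y p" if "X \<in> vfields A" "Y \<in> vfields A" "Z \<in> vfields A" for X Y Z p
    using skew[OF that, of p] g_sym[OF that(2) T[OF that(1,3)]] by simp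
  have "g (T X Y) Z p = 0" if Z: "Z \<in> vfields A" for Z p
  proof -
    have "g (T X Y) Z p = - g (T Y Z) X p" using sk[OF XY(2,1) Z, of p] sym[OF XY] by simp
    also have "\<dots> = g (T Z X) Y p" using sk[OF Z XY(2,1), of p] sym[OF Z XY(2)] by simp
    also have "\<dots> = - g (T X Y) Z p" using sk[OF XY(1) Z XY(2), of p] sym[OF Z XY(1)] by simp
    finally show ?thesis by simp
  qed
  then show ?thesis using g_nondegenerate[OF T[OF XY]] by (simp add: fun_eq_iff)
qed

abbreviation half :: "'a vf \<Rightarrow> 'a vf" where "half \<equiv> vf_scale (\<lambda>p. 1 / 2)"

text \<open>\<open>N\<close> is the average of \<open>D\<close> and of its conjugate by \<open>J\<close>; in this form it visibly commutes with \<open>J\<close>.\<close>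

lemma N_eq:
  assumes "X \<in> vfields A" "Y \<in> vfields A"
  shows "N X Y = half (D X Y - J (D X (J Y)))"
  using assms unfolding canonical_hermitian_def
  by (simp add: J_diff J_J J_vfields D.conn_vfields fun_eq_iff add_divide_distrib diff_divide_distrib)

lemma N_connection: "is_connection A N"
  unfolding is_connection_def
proof (intro conjI ballI)
  fix X Y assume XY: "X \<in> vfields A" "Y \<in> vfields A"
  note vs = vfields_intros D.conn_vfields J_vfields cinf_const
  show "N X Y \<in> vfields A" using XY by (simp add: N_eq vs)
  show "N (vf_add X Y) Z = vf_add (N X Z) (N Y Z)" if "Z \<in> vfields A" for Z
    using XY that by (simp add: N_eq vs D.conn_add_left J_add fun_eq_iff algebra_simps)
  show "N X (vf_add Y Z) = vf_add (N X Y) (N X Z)" if "Z \<in> vfields A" for Z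
    using XY that by (simp add: N_eq vs D.conn_add J_add fun_eq_iff algebra_simps)
  show "N (vf_scale h X) Y = vf_scale h (N X Y)" if "h \<in> cinf A" for h
    using XY that by (simp add: N_eq vs D.conn_scale_left J_scale fun_eq_iff algebra_simps del: vf_scale_fun)
      (simp add: algebra_simps)
  show "N X (vf_scale h Y) = vf_add (vf_scale (X h) Y) (vf_scale h (N X Y))" if "h \<in> cinf A" for h
    using XY that
    by (simp add: N_eq vs D.conn_scale J_scale J_add J_J vf_cinf fun_eq_iff del: vf_scale_fun)
      (simp add: algebra_simps)
qed

end

sublocale almost_kaehler \<subseteq> N: manifold_connection A I x E N
  by unfold_locales (rule N_connection)

context almost_kaehler
begin

lemma N_J: "X \<in> vfields A \<Longrightarrow> Y \<in> vfields A \<Longrightarrow> N X (J Y) = J (N X Y)"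
  by (simp add: N_eq J_vfields D.conn_vfields J_J J_scale J_diff cinf_const vfields_intros D.conn_uminus
      J_uminus del: vf_scale_fun) (simp add: fun_eq_iff)

text \<open>The Chern--Ricci form as a trace that does not refer to frames.\<close>

definition rho :: "'a vf \<Rightarrow> 'a vf \<Rightarrow> 'a \<Rightarrow> real" where
  "rho X Y = (\<lambda>p. - tr (\<lambda>Z. J (curvature N X Y Z)) p / 2)"

lemma J_curvature_endo: "X \<in> vfields A \<Longrightarrow> Y \<in> vfields A \<Longrightarrow> endo (\<lambda>Z. J (curvature N X Y Z))"
  by (rule endo_compose[OF J_endo N.curvature_endo])

lemma rho_cinf: "X \<in> vfields A \<Longrightarrow> Y \<in> vfields A \<Longrightarrow> rho X Y \<in> cinf A"
  using cinf_cmult[OF tr_cinf[OF J_curvature_endo], of X Y "-1/2"] by (simp add: rho_def)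

lemma rho_covector:
  assumes "Y \<in> vfields A"
  shows "covector (\<lambda>X. rho X Y)"
proof (rule covectorI)
  have c: "endo (\<lambda>X. J (curvature N X Y (E i)))" if "i \<in> I" for i
    by (rule endo_compose[OF J_endo N.curvature_endo_left[OF assms E_vfields[OF that]]])
  show "rho (X + Z) Y p = rho X Y p + rho Z Y p" if "X \<in> vfields A" "Z \<in> vfields A" for X Z p
    using that endo_add[OF c] by (simp add: rho_def tr_def sum.distrib field_simps)
  show "rho (vf_scale h X) Y p = h p * rho X Y p" if "h \<in> cinf A" "X \<in> vfields A" for h X p
    using that endo_scale[OF c] by (simp add: rho_def tr_def sum_distrib_left)
qed (simp add: rho_cinf assms)

lemma rho_swap: "X \<in> vfields A \<Longrightarrow> Y \<in> vfields A \<Longrightarrow> rho Y X p = - rho X Y p"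
  by (simp add: rho_def tr_def N.curvature_swap[of X Y] E_vfields J_uminus N.curvature_vfields sum_negf)

text \<open>Since \<open>N\<close> commutes with \<open>J\<close> and with traces, this is the trace of \<open>J\<close> applied to the Bianchi identity.\<close>

lemma rho_closed:
  assumes "X \<in> vfields A" "Y \<in> vfields A" "Z \<in> vfields A"
  shows "X (rho Y Z) p - Y (rho X Z) p + Z (rho X Y) p
    - rho (vf_bracket X Y) Z p + rho (vf_bracket X Z) Y p - rho (vf_bracket Y Z) X p = 0"
proof -
  have der: "X (rho Y Z) p = - tr (\<lambda>W. J (N X (curvature N Y Z W) - curvature N Y Z (N X W))) p / 2"
    if "X \<in> vfields A" "Y \<in> vfields A" "Z \<in> vfields A" for X Y Z
  proof -
    have "X (rho Y Z) p = - (1/2) * X (tr (\<lambda>Z'. J (curvature N Y Z Z'))) p"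
      using vf_cmult[OF that(1) tr_cinf[OF J_curvature_endo[OF that(2,3)]], of "-1/2"]
      by (simp add: rho_def)
    also have "X (tr (\<lambda>Z'. J (curvature N Y Z Z'))) p
        = tr (\<lambda>W. N X (J (curvature N Y Z W)) - J (curvature N Y Z (N X W))) p"
      by (rule N.tr_derivative[OF J_curvature_endo[OF that(2,3)] that(1)])
    also have "\<dots> = tr (\<lambda>W. J (N X (curvature N Y Z W) - curvature N Y Z (N X W))) p"
      using that unfolding tr_def
      by (intro sum.cong refl) (simp add: N_J E_vfields J_diff N.curvature_vfields N.conn_vfields)
    finally show ?thesis by simp
  qed
  have sum0: "J (N X (curvature N Y Z W) - curvature N Y Z (N X W)) f p
    - J (N Y (curvature N X Z W) - curvature N X Z (N Y W)) f p
    + J (N Z (curvature N X Y W) - curvature N X Y (N Z W)) f p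
    - J (curvature N (vf_bracket X Y) Z W) f p + J (curvature N (vf_bracket X Z) Y W) f p
    - J (curvature N (vf_bracket Y Z) X W) f p = 0" if "W \<in> vfields A" for W f
  proof -
    let ?S = "N X (curvature N Y Z W) - curvature N Y Z (N X W)
      - (N Y (curvature N X Z W) - curvature N X Z (N Y W))
      + (N Z (curvature N X Y W) - curvature N X Y (N Z W))
      - curvature N (vf_bracket X Y) Z W + curvature N (vf_bracket X Z) Y W - curvature N (vf_bracket Y Z) X W"
    have "?S = 0" by (rule N.bianchi[OF assms that])
    then have "J ?S f p = 0" using J_diff[OF vf_zero_vfields vf_zero_vfields] by simp
    then show ?thesis using assms that
      by (simp add: J_add J_diff N.curvature_vfields N.conn_vfields vfields_intros)
  qed
  have "(\<Sum>i\<in>I. J (N X (curvature N Y Z (E i)) - curvature N Y Z (N X (E i))) (x i) p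
    - J (N Y (curvature N X Z (E i)) - curvature N X Z (N Y (E i))) (x i) p
    + J (N Z (curvature N X Y (E i)) - curvature N X Y (N Z (E i))) (x i) p
    - J (curvature N (vf_bracket X Y) Z (E i)) (x i) p + J (curvature N (vf_bracket X Z) Y (E i)) (x i) p
    - J (curvature N (vf_bracket Y Z) X (E i)) (x i) p) = 0"
    by (intro sum.neutral ballI sum0 E_vfields)
  moreover have "rho X Y p = - (\<Sum>i\<in>I. J (curvature N X Y (E i)) (x i) p) / 2" for X Y
    by (simp add: rho_def tr_def)
  ultimately show ?thesis
    unfolding der[OF assms] der[OF assms(2,1,3)] der[OF assms(3,1,2)]
    unfolding tr_def sum.distrib sum_subtractf by simp
qed

end

context manifold
begin

text \<open>Cartan's formula \<open>L\<^sub>V \<omega> = d \<iota>\<^sub>V \<omega> + \<iota>\<^sub>V d\<omega> = - d d f + 0\<close>, evaluated on two fields.\<close>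

lemma hamiltonian_preserves:
  assumes \<omega>: "closed_form A 2 \<omega>" and V: "hamiltonian_vf A \<omega> f V" and YZ: "Y \<in> vfields A" "Z \<in> vfields A"
  shows "V (\<omega> [Y, Z]) p = \<omega> [vf_bracket V Y, Z] p + \<omega> [Y, vf_bracket V Z] p"
proof -
  have form: "is_form A 2 \<omega>" and d: "ext_deriv A \<omega> Xs p = 0" for Xs p
    using \<omega> by (auto simp: closed_form_def)
  have VA: "V \<in> vfields A" and f: "f \<in> cinf A" using V by (auto simp: hamiltonian_vf_def)
  have w: "\<omega> [V, Y] = - Y f" if "Y \<in> vfields A" for Y
    using V that by (simp add: hamiltonian_vf_def ext_deriv_zero_form fun_eq_iff)
  have "\<omega> [vf_bracket Y Z, V] p = vf_bracket Y Z f p"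
    using form2_swap[OF form VA vf_bracket_vfields[OF YZ], of p] w[OF vf_bracket_vfields[OF YZ]] by simp
  moreover have "\<omega> [Y, vf_bracket V Z] p = - \<omega> [vf_bracket V Z, Y] p"
    by (rule form2_swap[OF form vf_bracket_vfields[OF VA YZ(2)] YZ(1)])
  ultimately show ?thesis
    using d[of "[V, Y, Z]" p] ext_deriv_two_form[OF VA YZ, of \<omega> p] YZ f
    by (simp add: w vf_fun_ops[OF YZ(1)] vf_fun_ops[OF YZ(2)] vf_cinf vf_bracket_fun)
qed

end

context almost_kaehler
begin

section \<open>Infinitesimal automorphisms and the moment map of the Chern--Ricci form\<close>

text \<open>The operator \<open>L\<^sub>V - N\<^sub>V\<close>: both terms are derivations over \<open>V\<close>, so their difference is tensorial.\<close>

definition lie_minus_N :: "'a vf \<Rightarrow> 'a vf \<Rightarrow> 'a vf" where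
  "lie_minus_N V Y = vf_bracket V Y - N V Y"

definition mu :: "'a vf \<Rightarrow> 'a \<Rightarrow> real" where
  "mu V = (\<lambda>p. - tr (\<lambda>Y. J (lie_minus_N V Y)) p / 2)"

lemma lie_minus_N_endo: "V \<in> vfields A \<Longrightarrow> endo (lie_minus_N V)"
  by (rule endoI) (simp_all add: lie_minus_N_def vfields_intros N.conn_vfields N.conn_add N.conn_scale
      vf_bracket_add vf_bracket_scale vf_scale_diff)

context
  fixes V
  assumes V: "V \<in> vfields A"
    and V_J: "\<And>X. X \<in> vfields A \<Longrightarrow> vf_bracket V (J X) = J (vf_bracket V X)"
    and V_omega: "\<And>X Y p. X \<in> vfields A \<Longrightarrow> Y \<in> vfields A \<Longrightarrow>
      V (\<omega> [X, Y]) p = \<omega> [vf_bracket V X, Y] p + \<omega> [X, vf_bracket V Y] p"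
begin

lemma V_metric: "X \<in> vfields A \<Longrightarrow> Y \<in> vfields A \<Longrightarrow> V (g X Y) p = g (vf_bracket V X) Y p + g X (vf_bracket V Y) p"
  by (simp add: g_eq V_omega V_J J_vfields)

text \<open>The difference of the two sides is symmetric, because \<open>V\<close> preserves brackets and \<open>D\<close> has no
  torsion, and skew, because \<open>V\<close> and \<open>D\<close> preserve the metric.\<close>

lemma V_D:
  assumes "X \<in> vfields A" "Y \<in> vfields A"
  shows "vf_bracket V (D X Y) = D (vf_bracket V X) Y + D X (vf_bracket V Y)"
proof -
  define T where "T X Y = vf_bracket V (D X Y) - D (vf_bracket V X) Y - D X (vf_bracket V Y)" for X Y
  have TA: "T X Y \<in> vfields A" if "X \<in> vfields A" "Y \<in> vfields A" for X Y
    using that V by (simp add: T_def vfields_intros D.conn_vfields)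
  have "T X Y = 0"
  proof (rule symmetric_skew_zero[OF TA _ _ assms])
    fix X Y assume XY: "X \<in> vfields A" "Y \<in> vfields A"
    have "T X Y - T Y X = vf_bracket V (D X Y - D Y X) - (D (vf_bracket V X) Y - D Y (vf_bracket V X))
        - (D X (vf_bracket V Y) - D (vf_bracket V Y) X)"
      using XY V by (simp add: T_def vf_bracket_diff D.conn_vfields)
    also have "\<dots> = 0"
      using XY V by (simp add: D_torsion_free vf_bracket_vfields jacobi[OF V XY])
    finally show "T X Y = T Y X" by simp
    fix Z p assume Z: "Z \<in> vfields A"
    note vs = V XY Z vfields_intros D.conn_vfields
    note gadd = covector_add[OF g_covector] covector_add[OF g_covector_right]
      covector_diff[OF g_covector] covector_diff[OF g_covector_right]
    have Dm: "X (g Y Z) p = g (D X Y) Z p + g Y (D X Z) p" if "X \<in> vfields A" for X p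
      using that by (simp add: D_metric XY Z)
    have "V (X (g Y Z)) p = V (g (D X Y) Z + g Y (D X Z)) p"
      unfolding D_metric[OF XY Z] ..
    also have "\<dots> = g (vf_bracket V (D X Y)) Z p + g (D X Y) (vf_bracket V Z) p
        + g (vf_bracket V Y) (D X Z) p + g Y (vf_bracket V (D X Z)) p"
      by (simp add: vf_fun_ops[OF V] g_cinf V_metric vs)
    finally have 1: "V (X (g Y Z)) p = g (vf_bracket V (D X Y)) Z p + g (D X Y) (vf_bracket V Z) p
        + g (vf_bracket V Y) (D X Z) p + g Y (vf_bracket V (D X Z)) p" .
    have Vm: "V (g Y Z) = g (vf_bracket V Y) Z + g Y (vf_bracket V Z)"
      by (simp add: fun_eq_iff V_metric XY Z)
    have 2: "X (V (g Y Z)) p = g (D X (vf_bracket V Y)) Z p + g (vf_bracket V Y) (D X Z) p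
        + g (D X Y) (vf_bracket V Z) p + g Y (D X (vf_bracket V Z)) p"
      unfolding Vm by (simp add: vf_fun_ops[OF XY(1)] g_cinf D_metric vs)
    have 3: "V (X (g Y Z)) p - X (V (g Y Z)) p = g (D (vf_bracket V X) Y) Z p + g Y (D (vf_bracket V X) Z) p"
      using Dm[OF vf_bracket_vfields[OF V XY(1)], of p] by (simp add: vf_bracket_fun)
    have 4: "g (T X Y) Z p = g (vf_bracket V (D X Y)) Z p - g (D (vf_bracket V X) Y) Z p - g (D X (vf_bracket V Y)) Z p"
      unfolding T_def by (simp add: covector_diff[OF g_covector[OF Z]] vs)
    have 5: "g Y (T X Z) p = g Y (vf_bracket V (D X Z)) p - g Y (D (vf_bracket V X) Z) p - g Y (D X (vf_bracket V Z)) p"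
      unfolding T_def by (simp add: covector_diff[OF g_covector_right[OF XY(2)]] vs)
    show "g (T X Y) Z p + g Y (T X Z) p = 0" using 1 2 3 4 5 by linarith
  qed
  then show ?thesis by (simp add: T_def algebra_simps)
qed

lemma V_half: "X \<in> vfields A \<Longrightarrow> vf_bracket V (half X) = half (vf_bracket V X)"
  using vf_bracket_scale[OF cinf_const V, of X "1/2"] V by (simp add: fun_eq_iff vf_const)

lemma V_N:
  assumes "X \<in> vfields A" "Y \<in> vfields A"
  shows "vf_bracket V (N X Y) = N (vf_bracket V X) Y + N X (vf_bracket V Y)"
proof -
  have "vf_bracket V (N X Y) = half (vf_bracket V (D X Y) - J (vf_bracket V (D X (J Y))))"
    using assms V by (simp add: N_eq V_half vf_bracket_diff V_J D.conn_vfields J_vfields vfields_intros)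
  also have "\<dots> = half (D (vf_bracket V X) Y - J (D (vf_bracket V X) (J Y)))
      + half (D X (vf_bracket V Y) - J (D X (J (vf_bracket V Y))))"
    using assms V by (simp add: V_D V_J J_add D.conn_vfields J_vfields vfields_intros fun_eq_iff algebra_simps)
  also have "\<dots> = N (vf_bracket V X) Y + N X (vf_bracket V Y)"
    using assms V by (simp add: N_eq vfields_intros)
  finally show ?thesis .
qed

text \<open>Equivariant Chern--Weil theory: the curvature is the covariant derivative of \<open>L\<^sub>V - N\<^sub>V\<close>, hence
  \<open>mu V\<close> is a moment map of \<open>V\<close> with respect to the closed form \<open>rho\<close>.\<close>

lemma lie_minus_N_derivative:
  assumes "X \<in> vfields A" "Y \<in> vfields A"
  shows "N X (lie_minus_N V Y) - lie_minus_N V (N X Y) = curvature N X V Y"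
proof -
  have "N (vf_bracket X V) Y = - N (vf_bracket V X) Y"
    using N.conn_uminus_left[OF vf_bracket_vfields[OF V assms(1)] assms(2)] by (simp add: vf_bracket_swap[of X])
  then show ?thesis
    using assms V unfolding lie_minus_N_def N.curvature_eq
    by (simp add: N.conn_diff V_N N.conn_vfields vfields_intros)
qed

lemma mu_derivative:
  assumes X: "X \<in> vfields A"
  shows "X (mu V) p = - rho V X p"
proof -
  have e: "endo (\<lambda>Y. J (lie_minus_N V Y))" by (rule endo_compose[OF J_endo lie_minus_N_endo[OF V]])
  have "X (mu V) p = - (1/2) * X (tr (\<lambda>Y. J (lie_minus_N V Y))) p"
    using vf_cmult[OF X tr_cinf[OF e], of "-1/2"] by (simp add: mu_def)
  also have "X (tr (\<lambda>Y. J (lie_minus_N V Y))) p = tr (\<lambda>Y. N X (J (lie_minus_N V Y)) - J (lie_minus_N V (N X Y))) p"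
    by (rule N.tr_derivative[OF e X])
  also have "\<dots> = tr (\<lambda>Y. J (curvature N X V Y)) p"
    unfolding tr_def
    using X by (intro sum.cong refl)
      (simp add: N_J J_diff[symmetric] lie_minus_N_derivative E_vfields N.conn_vfields
        endo_vfields[OF lie_minus_N_endo[OF V]])
  also have "- (1/2) * tr (\<lambda>Y. J (curvature N X V Y)) p = rho X V p" by (simp add: rho_def)
  finally show ?thesis using rho_swap[OF V X] by simp
qed

lemma mu_cinf: "mu V \<in> cinf A"
  using cinf_cmult[OF tr_cinf[OF endo_compose[OF J_endo lie_minus_N_endo[OF V]]], of "-1/2"]
  by (simp add: mu_def)

end

end

section \<open>Diffeomorphisms\<close>

locale diffeo = manifold A
  for A :: "('a::{t2_space,second_countable_topology}, 'e::euclidean_space) atlas" +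
  fixes \<phi> :: "'a \<Rightarrow> 'a"
  assumes bij: "bij \<phi>" and comp_cinf: "\<And>f. f \<in> cinf A \<Longrightarrow> f \<circ> \<phi> \<in> cinf A"
    and comp_inv_cinf: "\<And>f. f \<in> cinf A \<Longrightarrow> f \<circ> inv \<phi> \<in> cinf A"
begin

lemma inv_app [simp]: "inv \<phi> (\<phi> p) = p" "\<phi> (inv \<phi> p) = p"
  using bij by (auto simp: bij_is_inj bij_is_surj surj_f_inv_f)

lemma comp_cancel [simp]: "f \<circ> \<phi> \<circ> inv \<phi> = f" "f \<circ> inv \<phi> \<circ> \<phi> = f"
  by (auto simp: fun_eq_iff)

lemma inv_diffeo: "diffeo A (inv \<phi>)"
  by unfold_locales (use bij comp_cinf comp_inv_cinf in \<open>auto simp: bij_imp_bij_inv inv_inv_eq\<close>)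

lemma push_fun: "vf_push \<phi> X f = X (f \<circ> \<phi>) \<circ> inv \<phi>"
  by (simp add: vf_push_def)

lemma push_apply [simp]: "vf_push \<phi> X f (\<phi> p) = X (f \<circ> \<phi>) p"
  by (simp add: push_fun)

lemma push_vfields: "X \<in> vfields A \<Longrightarrow> vf_push \<phi> X \<in> vfields A"
proof (rule vfieldsI)
  assume X: "X \<in> vfields A"
  show "vf_push \<phi> X f \<in> cinf A" for f unfolding push_fun by (rule comp_inv_cinf[OF vf_cinf[OF X]])
  have *: "(\<lambda>x. f x + g x) \<circ> \<phi> = (\<lambda>x. (f \<circ> \<phi>) x + (g \<circ> \<phi>) x)" "(\<lambda>x. f x * g x) \<circ> \<phi> = (\<lambda>x. (f \<circ> \<phi>) x * (g \<circ> \<phi>) x)"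
    "(\<lambda>x. c * f x) \<circ> \<phi> = (\<lambda>x. c * (f \<circ> \<phi>) x)" for f g :: "'a \<Rightarrow> real" and c by auto
  show "tangent_at p (\<lambda>f. vf_push \<phi> X f p)" for p
    unfolding tangent_at_def push_fun *
    using vf_simps[OF X] comp_cinf by (simp add: o_def)
  show "vf_push \<phi> X f = (\<lambda>p. 0)" if "f \<notin> cinf A" for f
  proof -
    have "f \<circ> \<phi> \<notin> cinf A" using comp_inv_cinf[of "f \<circ> \<phi>"] that by auto
    then have "X (f \<circ> \<phi>) = (\<lambda>p. 0)" using X by (auto simp: vfields_def)
    then show ?thesis by (simp add: push_fun o_def)
  qed
qed

lemma push_pull [simp]: "vf_push \<phi> (vf_push (inv \<phi>) X) = X" "vf_push (inv \<phi>) (vf_push \<phi> X) = X"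
  using bij by (auto simp: vf_push_def fun_eq_iff inv_inv_eq)

lemma push_add: "vf_push \<phi> (X + Y) = vf_push \<phi> X + vf_push \<phi> Y"
  by (simp add: push_fun fun_eq_iff)

lemma push_diff: "vf_push \<phi> (X - Y) = vf_push \<phi> X - vf_push \<phi> Y"
  by (simp add: push_fun fun_eq_iff)

lemma push_scale: "vf_push \<phi> (vf_scale h X) = vf_scale (h \<circ> inv \<phi>) (vf_push \<phi> X)"
  by (simp add: push_fun fun_eq_iff)

lemma push_bracket: "vf_push \<phi> (vf_bracket X Y) = vf_bracket (vf_push \<phi> X) (vf_push \<phi> Y)"
  by (simp add: push_fun fun_eq_iff vf_bracket_fun)

end

context manifold_dual_basis
begin

lemma tr_push:
  assumes "diffeo A \<phi>" and T: "endo T" and T': "endo T'"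
    and comm: "\<And>Y. Y \<in> vfields A \<Longrightarrow> T' (vf_push \<phi> Y) = vf_push \<phi> (T Y)"
  shows "tr T' (\<phi> p) = tr T p"
proof -
  interpret \<phi>: diffeo A \<phi> by fact
  interpret \<psi>: diffeo A "inv \<phi>" by (rule \<phi>.inv_diffeo)
  let ?Q = "vf_push (inv \<phi>)"
  have "tr T' (\<phi> p) = (\<Sum>i\<in>I. (?Q (vf_push \<phi> (T (E i))) (x i) \<circ> inv \<phi>) (\<phi> p))"
  proof (rule tr_eq[OF finite_I, where \<theta> = "\<lambda>i Y. ?Q Y (x i) \<circ> inv \<phi>" and Y = "\<lambda>i. vf_push \<phi> (T (E i))"])
    fix i assume i: "i \<in> I"
    show "covector (\<lambda>Y. ?Q Y (x i) \<circ> inv \<phi>)"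
    proof (rule covectorI)
      show "?Q X (x i) \<circ> inv \<phi> \<in> cinf A" if "X \<in> vfields A" for X
        by (rule \<phi>.comp_inv_cinf[OF vf_cinf[OF \<psi>.push_vfields[OF that]]])
    qed (simp_all add: \<psi>.push_add \<psi>.push_scale inv_inv_eq[OF \<phi>.bij])
    show "vf_push \<phi> (T (E i)) \<in> vfields A"
      by (intro \<phi>.push_vfields endo_vfields[OF T] E_vfields i)
  next
    fix Y f assume Y: "Y \<in> vfields A" and f: "f \<in> cinf A"
    have "T' Y f (\<phi> p) = T (?Q Y) (f \<circ> \<phi>) p"
      using comm[OF \<psi>.push_vfields[OF Y]] by simp
    also have "\<dots> = (\<Sum>i\<in>I. ?Q Y (x i) p * T (E i) (f \<circ> \<phi>) p)"
      by (rule endo_expand[OF T \<psi>.push_vfields[OF Y] \<phi>.comp_cinf[OF f]])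
    finally show "T' Y f (\<phi> p) = (\<Sum>i\<in>I. (?Q Y (x i) \<circ> inv \<phi>) (\<phi> p) * vf_push \<phi> (T (E i)) f (\<phi> p))"
      by simp
  qed
  then show ?thesis by (simp add: tr_def)
qed

end

context almost_kaehler
begin

context
  fixes \<phi>
  assumes diff: "diffeo A \<phi>"
    and push_J: "\<And>X. X \<in> vfields A \<Longrightarrow> J (vf_push \<phi> X) = vf_push \<phi> (J X)"
    and push_omega: "\<And>X Y p. X \<in> vfields A \<Longrightarrow> Y \<in> vfields A \<Longrightarrow>
      \<omega> [vf_push \<phi> X, vf_push \<phi> Y] (\<phi> p) = \<omega> [X, Y] p"
begin

interpretation \<phi>: diffeo A \<phi> by (rule diff)
interpretation \<psi>: diffeo A "inv \<phi>" by (rule \<phi>.inv_diffeo)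

lemma push_metric: "X \<in> vfields A \<Longrightarrow> Y \<in> vfields A \<Longrightarrow> g (vf_push \<phi> X) (vf_push \<phi> Y) \<circ> \<phi> = g X Y"
  by (simp add: g_eq push_J push_omega J_vfields fun_eq_iff)

text \<open>Naturality of the Levi-Civita connection, by the same argument as for \<open>V_D\<close>.\<close>

lemma push_D:
  assumes "X \<in> vfields A" "Y \<in> vfields A"
  shows "D (vf_push \<phi> X) (vf_push \<phi> Y) = vf_push \<phi> (D X Y)"
proof -
  let ?P = "vf_push \<phi>" and ?Q = "vf_push (inv \<phi>)"
  define T where "T X Y = ?Q (D (?P X) (?P Y)) - D X Y" for X Y
  have TA: "T X Y \<in> vfields A" if "X \<in> vfields A" "Y \<in> vfields A" for X Y
    using that by (simp add: T_def vfields_intros D.conn_vfields \<phi>.push_vfields \<psi>.push_vfields)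
  have "T X Y = 0"
  proof (rule symmetric_skew_zero[OF TA _ _ assms])
    fix X Y assume XY: "X \<in> vfields A" "Y \<in> vfields A"
    have "T X Y - T Y X = ?Q (D (?P X) (?P Y) - D (?P Y) (?P X)) - (D X Y - D Y X)"
      by (simp add: T_def \<psi>.push_diff)
    also have "\<dots> = 0"
      using XY by (simp add: D_torsion_free \<phi>.push_vfields \<phi>.push_bracket[symmetric])
    finally show "T X Y = T Y X" by simp
    fix Z p assume Z: "Z \<in> vfields A"
    have m: "g (?Q W) Y p = g W (?P Y) (\<phi> p)" "g Y (?Q W) p = g (?P Y) W (\<phi> p)"
      if "W \<in> vfields A" "Y \<in> vfields A" for W Y
      using push_metric[OF \<psi>.push_vfields[OF that(1)] that(2)] push_metric[OF that(2) \<psi>.push_vfields[OF that(1)]]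
      by (simp_all add: fun_eq_iff)
    note vs = XY Z \<phi>.push_vfields \<psi>.push_vfields D.conn_vfields
    have 1: "X (g Y Z) p = g (D X Y) Z p + g Y (D X Z) p" by (simp add: D_metric XY Z)
    have "X (g Y Z) p = ?P X (g (?P Y) (?P Z)) (\<phi> p)" using XY Z by (simp add: push_metric)
    also have "\<dots> = g (D (?P X) (?P Y)) (?P Z) (\<phi> p) + g (?P Y) (D (?P X) (?P Z)) (\<phi> p)"
      by (simp add: D_metric vs)
    also have "\<dots> = g (?Q (D (?P X) (?P Y))) Z p + g Y (?Q (D (?P X) (?P Z))) p"
      by (simp add: m vs)
    finally show "g (T X Y) Z p + g Y (T X Z) p = 0"
      using 1 unfolding T_def
      by (simp add: covector_diff[OF g_covector[OF Z]] covector_diff[OF g_covector_right[OF XY(2)]] vs)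
  qed
  then have "?P (?Q (D (?P X) (?P Y))) = ?P (D X Y)" by (simp add: T_def)
  then show ?thesis by simp
qed

lemma push_N:
  assumes "X \<in> vfields A" "Y \<in> vfields A"
  shows "N (vf_push \<phi> X) (vf_push \<phi> Y) = vf_push \<phi> (N X Y)"
proof -
  have half: "half (vf_push \<phi> W) = vf_push \<phi> (half W)" for W
    by (simp add: fun_eq_iff \<phi>.push_fun)
  show ?thesis
    using assms by (simp add: N_eq \<phi>.push_vfields push_J push_D J_vfields half D.conn_vfields \<phi>.push_diff[symmetric])
qed

text \<open>All ingredients of the Chern--Ricci form, and the trace, are natural under \<open>\<phi>\<close>.\<close>

lemma push_rho:
  assumes "X \<in> vfields A" "Y \<in> vfields A"
  shows "rho (vf_push \<phi> X) (vf_push \<phi> Y) (\<phi> p) = rho X Y p"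
proof -
  let ?P = "vf_push \<phi>"
  have "curvature N (?P X) (?P Y) (?P Z) = ?P (curvature N X Y Z)" if "Z \<in> vfields A" for Z
    using assms that unfolding N.curvature_eq
    by (simp add: push_N \<phi>.push_bracket[symmetric] \<phi>.push_diff vfields_intros N.conn_vfields)
  then have "tr (\<lambda>Z. J (curvature N (?P X) (?P Y) Z)) (\<phi> p) = tr (\<lambda>Z. J (curvature N X Y Z)) p"
    using assms by (intro tr_push[OF diff] J_curvature_endo)
      (simp_all add: \<phi>.push_vfields push_J N.curvature_vfields)
  then show ?thesis by (simp add: rho_def)
qed

end

end

section \<open>Adapted frames\<close>

context almost_kaehler
begin

definition orthonormal_at :: "'a \<Rightarrow> nat \<Rightarrow> (nat \<Rightarrow> 'a vf) \<Rightarrow> bool" where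
  "orthonormal_at p k e \<longleftrightarrow> (\<forall>i<k. e i \<in> vfields A) \<and>
     (\<forall>i<k. \<forall>j<k. g (e i) (e j) p = (if i = j then 1 else 0))"

abbreviation combination :: "nat \<Rightarrow> (nat \<Rightarrow> real) \<Rightarrow> (nat \<Rightarrow> 'a vf) \<Rightarrow> 'a vf" where
  "combination k c e \<equiv> \<Sum>i<k. vf_scale (\<lambda>p. c i) (e i)"

lemma combination_vfields: "(\<And>i. i < k \<Longrightarrow> e i \<in> vfields A) \<Longrightarrow> combination k c e \<in> vfields A"
  by (intro vf_sum_vfields vf_scale_vfields cinf_const) auto

lemma g_combination:
  assumes "orthonormal_at p k e" "j < k"
  shows "g (combination k c e) (e j) p = c j"
proof -
  have e: "\<And>i. i < k \<Longrightarrow> e i \<in> vfields A" using assms(1) by (auto simp: orthonormal_at_def)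
  have "g (combination k c e) (e j) p = (\<Sum>i<k. g (vf_scale (\<lambda>p. c i) (e i)) (e j) p)"
    by (rule covector_sum[OF g_covector[OF e[OF assms(2)]]]) (auto intro!: vf_scale_vfields cinf_const e)
  also have "\<dots> = (\<Sum>i<k. c i * (if i = j then 1 else 0))"
    using assms by (intro sum.cong refl)
      (simp add: covector_scale[OF g_covector[OF e[OF assms(2)]]] e cinf_const orthonormal_at_def del: vf_scale_fun)
  finally show ?thesis using assms(2) by (simp add: if_distrib cong: if_cong)
qed

text \<open>A linear isomorphism from the tangent space at \<open>p\<close> onto the model space, given on vector fields. It
  brings in the dimension of the tangent spaces.\<close>

definition tangent_coordinates :: "'a \<Rightarrow> ('a vf \<Rightarrow> 'e) \<Rightarrow> bool" where
  "tangent_coordinates p crd \<longleftrightarrow>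
     (\<forall>X\<in>vfields A. \<forall>Y\<in>vfields A. crd X = crd Y \<longleftrightarrow> (\<forall>f\<in>cinf A. X f p = Y f p)) \<and>
     (\<forall>v. \<exists>X\<in>vfields A. crd X = v) \<and>
     (\<forall>k c e. crd (combination k c e) = (\<Sum>i<k. c i *\<^sub>R crd (e i)))"

lemma tangent_coordinates_exist:
  obtains crd where "tangent_coordinates p crd"
proof -
  obtain U \<phi> \<eta> M where cut: "chart_cutoff (U, \<phi>) \<eta> M" and p: "p \<in> M" by (rule chart_cutoff_at)
  let ?x = "coord_fun (U, \<phi>) \<eta>"
  define crd where "crd X = (\<Sum>b\<in>Basis. X (?x b) p *\<^sub>R b)" for X :: "'a vf"
  have inner: "crd X \<bullet> b = X (?x b) p" if "b \<in> Basis" for X b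
    using that by (simp add: crd_def inner_sum_left inner_Basis if_distrib cong: if_cong)
  have "tangent_coordinates p crd" unfolding tangent_coordinates_def
  proof (intro conjI ballI allI iffI)
    fix X Y :: "'a vf" and f assume X: "X \<in> vfields A" and Y: "Y \<in> vfields A" and "crd X = crd Y" and f: "f \<in> cinf A"
    then have "X (?x b) p = Y (?x b) p" if "b \<in> Basis" for b using inner[OF that] by metis
    then show "X f p = Y f p"
      using tangent_expand_coord[OF cut p vf_tangent[OF X] f] tangent_expand_coord[OF cut p vf_tangent[OF Y] f]
      by simp
  next
    fix X Y :: "'a vf" assume "\<forall>f\<in>cinf A. X f p = Y f p"
    then show "crd X = crd Y" by (simp add: crd_def coord_fun_cinf[OF cut])
  next
    fix v
    have "crd (coord_field (U, \<phi>) \<eta> v) = v"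
      by (simp add: crd_def coord_field_coord_fun[OF cut p] euclidean_representation)
    then show "\<exists>X\<in>vfields A. crd X = v" using coord_field_vfields[OF cut] by blast
  next
    fix k c and e :: "nat \<Rightarrow> 'a vf"
    show "crd (combination k c e) = (\<Sum>i<k. c i *\<^sub>R crd (e i))"
      by (rule euclidean_eqI) (simp add: inner inner_sum_left sum_fun_apply)
  qed
  then show ?thesis by (rule that)
qed

context
  fixes p crd
  assumes coords: "tangent_coordinates p crd"
begin

lemma crd_eq_iff: "X \<in> vfields A \<Longrightarrow> Y \<in> vfields A \<Longrightarrow> crd X = crd Y \<longleftrightarrow> (\<forall>f\<in>cinf A. X f p = Y f p)"
  and crd_surj: "\<exists>X\<in>vfields A. crd X = v"
  and crd_combination: "crd (combination k c e) = (\<Sum>i<k. c i *\<^sub>R crd (e i))"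
  using coords by (auto simp: tangent_coordinates_def)

lemma orthonormal_independent:
  assumes on: "orthonormal_at p k e"
  shows "inj_on (\<lambda>i. crd (e i)) {..<k}" "independent ((\<lambda>i. crd (e i)) ` {..<k})"
proof -
  have e: "\<And>i. i < k \<Longrightarrow> e i \<in> vfields A" using on by (auto simp: orthonormal_at_def)
  show inj: "inj_on (\<lambda>i. crd (e i)) {..<k}"
  proof (rule inj_onI, rule ccontr)
    fix i j assume ij: "i \<in> {..<k}" "j \<in> {..<k}" "crd (e i) = crd (e j)" "i \<noteq> j"
    have "g (e i) (e j) p = g (e j) (e j) p"
      by (rule covector_pointwise[OF g_covector]) (use ij crd_eq_iff e in auto)
    then show False using ij on by (simp add: orthonormal_at_def)
  qed
  show "independent ((\<lambda>i. crd (e i)) ` {..<k})"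
  proof (rule independent_if_scalars_zero)
    fix f w assume z: "(\<Sum>v\<in>(\<lambda>i. crd (e i)) ` {..<k}. f v *\<^sub>R v) = 0" and w: "w \<in> (\<lambda>i. crd (e i)) ` {..<k}"
    then obtain j where j: "j < k" "w = crd (e j)" by auto
    let ?c = "\<lambda>i. f (crd (e i))"
    have "crd (combination k ?c e) = crd (combination k (\<lambda>i. 0) e)"
      using z by (simp add: crd_combination sum.reindex[OF inj])
    then have "g (combination k ?c e) (e j) p = g (combination k (\<lambda>i. 0) e) (e j) p"
      using crd_eq_iff[OF combination_vfields combination_vfields] e
      by (intro covector_pointwise[OF g_covector] e j combination_vfields) auto
    then show "f w = 0" unfolding g_combination[OF on j(1)] j(2) .
  qed simp
qed

lemma orthonormal_span:
  assumes on: "orthonormal_at p (DIM('e)) e" and X: "X \<in> vfields A" and f: "f \<in> cinf A"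
  shows "X f p = (\<Sum>i<DIM('e). g X (e i) p * e i f p)"
proof -
  let ?k = "DIM('e)"
  have e: "\<And>i. i < ?k \<Longrightarrow> e i \<in> vfields A" using on by (auto simp: orthonormal_at_def)
  note ind = orthonormal_independent[OF on]
  have "(UNIV :: 'e set) \<subseteq> span ((\<lambda>i. crd (e i)) ` {..<?k})"
    by (rule card_ge_dim_independent) (use ind in \<open>auto simp: card_image\<close>)
  then have "crd X \<in> span ((\<lambda>i. crd (e i)) ` {..<?k})" by auto
  then obtain u where "crd X = (\<Sum>v\<in>(\<lambda>i. crd (e i)) ` {..<?k}. u v *\<^sub>R v)"
    by (auto simp: span_finite)
  then have "crd X = crd (combination ?k (\<lambda>i. u (crd (e i))) e)"
    by (simp add: crd_combination sum.reindex[OF ind(1)])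
  then have eq: "X f p = combination ?k (\<lambda>i. u (crd (e i))) e f p" if "f \<in> cinf A" for f
    using crd_eq_iff[OF X combination_vfields[OF e]] that by simp
  have "u (crd (e j)) = g X (e j) p" if "j < ?k" for j
    using covector_pointwise[OF g_covector[OF e[OF that]] X combination_vfields[OF e] eq]
    by (simp only: g_combination[OF on that])
  then show ?thesis using eq[OF f] by (simp add: sum_fun_apply)
qed

lemma orthonormal_not_spanning:
  assumes e: "\<And>i. i < k \<Longrightarrow> e i \<in> vfields A" and k: "k < DIM('e)"
  shows "\<exists>X\<in>vfields A. \<exists>f\<in>cinf A. X f p \<noteq> (\<Sum>i<k. g X (e i) p * e i f p)"
proof (rule ccontr)
  assume "\<not> ?thesis"
  then have all: "X f p = combination k (\<lambda>i. g X (e i) p) e f p" if "X \<in> vfields A" "f \<in> cinf A" for X f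
    using that by (auto simp: sum_fun_apply)
  have "v \<in> span ((\<lambda>i. crd (e i)) ` {..<k})" for v
  proof -
    obtain X where X: "X \<in> vfields A" "crd X = v" using crd_surj by blast
    have "crd X = crd (combination k (\<lambda>i. g X (e i) p) e)"
      using crd_eq_iff[OF X(1) combination_vfields[OF e]] all[OF X(1)] by simp
    also have "\<dots> \<in> span ((\<lambda>i. crd (e i)) ` {..<k})"
      unfolding crd_combination by (intro span_sum span_scale span_base) auto
    finally show ?thesis using X by simp
  qed
  then have "dim (UNIV :: 'e set) \<le> card ((\<lambda>i. crd (e i)) ` {..<k})"
    by (intro dim_le_card) auto
  also have "\<dots> \<le> k" using card_image_le[of "{..<k}" "\<lambda>i. crd (e i)"] by simp
  finally show False using k by simp
qed

end

lemma orthonormal_expand: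
  assumes "orthonormal_at p (DIM('e)) e" "X \<in> vfields A" "f \<in> cinf A"
  shows "X f p = (\<Sum>i<DIM('e). g X (e i) p * e i f p)"
  using tangent_coordinates_exist[of p] orthonormal_span[OF _ assms] by blast

lemma tr_orthonormal:
  assumes on: "orthonormal_at p (DIM('e)) e" and T: "endo T"
  shows "tr T p = (\<Sum>i<DIM('e). g (T (e i)) (e i) p)"
proof -
  have e: "\<And>i. i < DIM('e) \<Longrightarrow> e i \<in> vfields A" using on by (auto simp: orthonormal_at_def)
  show ?thesis
  proof (rule tr_eq[where \<theta> = "\<lambda>i X. g X (e i)" and Y = "\<lambda>i. T (e i)"])
    fix X f assume X: "X \<in> vfields A" and f: "f \<in> cinf A"
    let ?Y = "combination (DIM('e)) (\<lambda>i. g X (e i) p) e"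
    have Y: "?Y \<in> vfields A" by (intro combination_vfields e)
    have "T X f p = T ?Y f p"
      by (rule covector_pointwise[OF endo_covector[OF T f] X Y])
        (simp add: orthonormal_expand[OF on X] sum_fun_apply)
    also have "\<dots> = (\<Sum>i<DIM('e). T (vf_scale (\<lambda>q. g X (e i) p) (e i)) f p)"
      by (rule covector_sum[OF endo_covector[OF T f]]) (auto intro!: vf_scale_vfields cinf_const e)
    also have "\<dots> = (\<Sum>i<DIM('e). g X (e i) p * T (e i) f p)"
      by (intro sum.cong refl) (simp add: endo_scale[OF T cinf_const] e)
    finally show "T X f p = (\<Sum>i<DIM('e). g X (e i) p * T (e i) f p)" .
  qed (use e endo_vfields[OF T] g_covector in auto)
qed

text \<open>Vectors \<open>e\<^sub>0, \<dots>, e\<^sub>k\<^sub>-\<^sub>1\<close> that are orthonormal for the Hermitian inner product \<open>g - i \<omega>\<close>; together with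
  their images under \<open>J\<close> they are orthonormal for \<open>g\<close>.\<close>

definition unitary_on :: "'a set \<Rightarrow> nat \<Rightarrow> (nat \<Rightarrow> 'a vf) \<Rightarrow> bool" where
  "unitary_on U k e \<longleftrightarrow> (\<forall>i<k. e i \<in> vfields A) \<and>
     (\<forall>p\<in>U. \<forall>i<k. \<forall>j<k. g (e i) (e j) p = (if i = j then 1 else 0) \<and> g (e i) (J (e j)) p = 0)"

definition with_J :: "nat \<Rightarrow> (nat \<Rightarrow> 'a vf) \<Rightarrow> nat \<Rightarrow> 'a vf" where
  "with_J k e i = (if i < k then e i else J (e (i - k)))"

lemma g_J_right: "X \<in> vfields A \<Longrightarrow> Y \<in> vfields A \<Longrightarrow> g X (J Y) p = - g (J X) Y p"
  using g_J[of X "J Y"] covector_uminus[OF g_covector_right, of "J X" Y p] by (simp add: J_J J_vfields)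

lemma with_J_orthonormal:
  assumes "unitary_on U k e" "p \<in> U"
  shows "orthonormal_at p (2 * k) (with_J k e)"
proof -
  have e: "\<And>i. i < k \<Longrightarrow> e i \<in> vfields A"
    and on: "\<And>i j. i < k \<Longrightarrow> j < k \<Longrightarrow> g (e i) (e j) p = (if i = j then 1 else 0)"
    and J0: "\<And>i j. i < k \<Longrightarrow> j < k \<Longrightarrow> g (e i) (J (e j)) p = 0"
    using assms by (auto simp: unitary_on_def)
  have J0': "g (J (e i)) (e j) p = 0" if "i < k" "j < k" for i j
    using J0[OF that] g_J_right[OF e[OF that(1)] e[OF that(2)], of p] by simp
  show ?thesis unfolding orthonormal_at_def with_J_def
    by (auto simp: e J_vfields on J0 J0' g_J)
qed

text \<open>One step of the Hermitian Gram--Schmidt process, on a neighbourhood of \<open>p\<close>.\<close>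

lemma unitary_extend:
  assumes un: "unitary_on U k e" and U: "open U" "p \<in> U" and k: "2 * k < DIM('e)"
  obtains X V where "open V" "p \<in> V" "unitary_on V (Suc k) (e(k := X))"
proof -
  have e: "\<And>i. i < k \<Longrightarrow> e i \<in> vfields A" using un by (auto simp: unitary_on_def)
  let ?e = "with_J k e"
  have we: "?e i \<in> vfields A" if "i < 2 * k" for i
    using that e by (auto simp: with_J_def J_vfields)
  obtain crd where "tangent_coordinates p crd" by (rule tangent_coordinates_exist)
  from orthonormal_not_spanning[OF this, of "2 * k" ?e, OF we k] obtain Y f where Y: "Y \<in> vfields A" "f \<in> cinf A"
    "Y f p \<noteq> (\<Sum>i<2 * k. g Y (?e i) p * ?e i f p)" by blast
  let ?S = "\<Sum>i<2 * k. vf_scale (g Y (?e i)) (?e i)"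
  define Z where "Z = Y - ?S"
  have S: "?S \<in> vfields A" by (intro vf_sum_vfields vf_scale_vfields g_cinf Y we) auto
  have Z: "Z \<in> vfields A" unfolding Z_def by (intro vf_diff_vfields Y S)
  have "Z f p \<noteq> 0" using Y(3) by (simp add: Z_def sum_fun_apply)
  then have pos: "g Z Z p > 0"
    using compatible Z unfolding compatible_def riemannian_metric_def vanishes_at_def by blast
  have nonneg: "g Z Z q \<ge> 0" for q
  proof (cases "vanishes_at Z q")
    case True
    then have "g Z Z q = g 0 Z q"
      by (intro covector_pointwise[OF g_covector[OF Z] Z vf_zero_vfields]) (simp add: vanishes_at_def)
    then show ?thesis using covector_zero[OF g_covector[OF Z]] by simp
  next
    case False
    then show ?thesis using compatible Z unfolding compatible_def riemannian_metric_def by (metis less_imp_le)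
  qed
  have orth: "g Z (?e j) q = 0" if "q \<in> U" "j < 2 * k" for q j
  proof -
    have on: "orthonormal_at q (2 * k) ?e" by (rule with_J_orthonormal[OF un that(1)])
    have "g ?S (?e j) q = (\<Sum>i<2 * k. g (vf_scale (g Y (?e i)) (?e i)) (?e j) q)"
      by (rule covector_sum[OF g_covector[OF we[OF that(2)]]]) (auto intro!: vf_scale_vfields g_cinf Y we)
    also have "\<dots> = (\<Sum>i<2 * k. g Y (?e i) q * (if i = j then 1 else 0))"
      using on that(2) by (intro sum.cong refl)
        (simp add: covector_scale[OF g_covector[OF we[OF that(2)]]] we g_cinf Y orthonormal_at_def del: vf_scale_fun)
    also have "\<dots> = g Y (?e j) q" using that(2) by (simp add: if_distrib cong: if_cong)
    finally show ?thesis
      unfolding Z_def by (simp add: covector_diff[OF g_covector[OF we[OF that(2)]]] Y S)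
  qed
  define W where "W = {q. g Z Z q > 0}"
  have "open W" unfolding W_def
    using open_Collect_less[OF continuous_on_const cinf_continuous[OF g_cinf[OF Z Z]]] by simp
  then obtain \<eta> M K where \<eta>: "\<eta> \<in> cinf A" "open M" "p \<in> M" "\<And>x. x \<in> M \<Longrightarrow> \<eta> x = 1"
    "K \<subseteq> W" "\<And>x. x \<notin> K \<Longrightarrow> \<eta> x = 0"
    using bump[of W p] pos unfolding W_def by (metis mem_Collect_eq)
  \<comment> \<open>\<open>s\<close> equals \<open>g Z Z\<close> near \<open>p\<close> and is positive everywhere, so that \<open>1/\<surd>s\<close> is a smooth function on the whole manifold\<close>
  define s where "s = (\<lambda>q. g Z Z q + (1 - \<eta> q) * (1 - \<eta> q))"
  have s_pos: "s q > 0" for q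
  proof (cases "q \<in> K")
    case True
    then have "g Z Z q > 0" using \<eta>(5) by (auto simp: W_def)
    then show ?thesis by (simp add: s_def add_pos_nonneg)
  next
    case False
    then show ?thesis using nonneg[of q] \<eta>(6) by (simp add: s_def)
  qed
  define h where "h = (\<lambda>q. s q powr (-1/2))"
  have h: "h \<in> cinf A" unfolding h_def
  proof (rule cinf_compose[OF _ smooth_on_powr])
    show "s \<in> cinf A" unfolding s_def by (intro cinf_intros g_cinf Z \<eta>)
  qed (use s_pos in auto)
  define X where "X = vf_scale h Z"
  have X: "X \<in> vfields A" unfolding X_def by (rule vf_scale_vfields[OF h Z])
  have gX: "g X Y q = h q * g Z Y q" if "Y \<in> vfields A" for Y q
    unfolding X_def by (rule covector_scale[OF g_covector[OF that] h Z])
  have gXX: "g X X q = 1" if "q \<in> M" for q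
  proof -
    have "g X X q = h q * (h q * g Z Z q)"
      using gX[OF X, of q] gX[OF Z, of q] g_sym[OF X Z] by simp
    also have "g Z Z q = s q" using \<eta>(4)[OF that] by (simp add: s_def)
    also have "h q * (h q * s q) = s q powr (-1/2 + -1/2) * s q"
      unfolding h_def powr_add by simp
    also have "\<dots> = 1" using s_pos[of q] by (simp add: powr_minus)
    finally show ?thesis .
  qed
  have gXJ: "g X (J X) q = 0" for q
    using g_J_right[OF X X, of q] g_sym[OF X J_vfields[OF X]] by simp
  have X0: "g X (e j) q = 0" "g X (J (e j)) q = 0" if "q \<in> U" "j < k" for q j
    using orth[OF that(1), of j] orth[OF that(1), of "k + j"] that(2) e
    by (simp_all add: gX J_vfields with_J_def)
  have X0': "g (e j) X q = 0" "g (e j) (J X) q = 0" if "q \<in> U" "j < k" for q j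
    using X0[OF that] g_sym[OF X e[OF that(2)]] g_J_right[OF e[OF that(2)] X, of q]
      g_sym[OF X J_vfields[OF e[OF that(2)]]] by simp_all
  have "unitary_on (U \<inter> M) (Suc k) (e(k := X))"
    using un unfolding unitary_on_def by (auto simp: less_Suc_eq X gXX gXJ X0 X0')
  then show ?thesis using U \<eta>(2,3) by (intro that[of "U \<inter> M" X]) auto
qed

lemma unitary_frame:
  assumes "2 * k \<le> DIM('e)"
  shows "\<exists>U e. open U \<and> p \<in> U \<and> unitary_on U k e"
  using assms
proof (induction k)
  case 0
  show ?case by (intro exI[of _ UNIV]) (simp add: unitary_on_def)
next
  case (Suc k)
  then obtain U e where U: "open U" "p \<in> U" "unitary_on U k e" by auto
  have "2 * k < DIM('e)" using Suc.prems by simp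
  then obtain X V where "open V" "p \<in> V" "unitary_on V (Suc k) (e(k := X))"
    by (rule unitary_extend[OF U(3,1,2)])
  then show ?case by blast
qed

lemma adapted_frame:
  assumes n: "DIM('e) = 2 * n"
  shows "\<exists>U. open U \<and> p \<in> U \<and> adapted_frame_on A n \<omega> J U (adapted_frame_at A n \<omega> J p)"
proof -
  obtain U e where U: "open U" "p \<in> U" "unitary_on U n e" using unitary_frame[of n p] n by auto
  have "adapted_frame_on A n \<omega> J U (with_J n e)"
    unfolding adapted_frame_on_def orthonormal_frame_on_def
  proof (intro conjI allI ballI impI)
    show "with_J n e i \<in> vfields A" if "i < DIM('e)" for i
      using with_J_orthonormal[OF U(3,2)] that n by (simp add: orthonormal_at_def)
    show "g (with_J n e i) (with_J n e j) q = (if i = j then 1 else 0)" if "i < DIM('e)" "j < DIM('e)" "q \<in> U" for i j q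
      using with_J_orthonormal[OF U(3) that(3)] that n by (simp add: orthonormal_at_def)
    show "vanishes_at (vf_diff (with_J n e (n + i)) (J (with_J n e i))) q" if "i < n" for i q
      using that by (simp add: with_J_def vanishes_at_def)
  qed
  then have "\<exists>e U. open U \<and> p \<in> U \<and> adapted_frame_on A n \<omega> J U e" using U by blast
  then show ?thesis unfolding adapted_frame_at_def by (rule someI_ex)
qed

lemma orthonormal_frame_exists:
  assumes "DIM('e) = 2 * n"
  obtains U e where "open U" "p \<in> U" "\<And>q. q \<in> U \<Longrightarrow> orthonormal_at q (DIM('e)) e"
  using unitary_frame[of n p] with_J_orthonormal assms by (metis order_refl)

section \<open>The Chern--Ricci form\<close>

lemma chern_ricci_eq:
  assumes n: "DIM('e) = 2 * n"
  shows "chern_ricci A n \<omega> J N = (\<lambda>Xs p. if length Xs = 2 \<and> set Xs \<subseteq> vfields A then rho (Xs ! 0) (Xs ! 1) p else 0)"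
proof (intro ext)
  fix Xs p
  show "chern_ricci A n \<omega> J N Xs p = (if length Xs = 2 \<and> set Xs \<subseteq> vfields A then rho (Xs ! 0) (Xs ! 1) p else 0)"
  proof (cases "length Xs = 2 \<and> set Xs \<subseteq> vfields A")
    case True
    then have XY: "Xs ! 0 \<in> vfields A" "Xs ! 1 \<in> vfields A" by auto
    define e where "e = adapted_frame_at A n \<omega> J p"
    obtain U where "p \<in> U" "adapted_frame_on A n \<omega> J U e" using adapted_frame[OF n] e_def by blast
    then have on: "orthonormal_at p (DIM('e)) e"
      by (auto simp: adapted_frame_on_def orthonormal_frame_on_def orthonormal_at_def)
    then have ei: "\<And>i. i < DIM('e) \<Longrightarrow> e i \<in> vfields A" by (auto simp: orthonormal_at_def)
    let ?R = "curvature N (Xs ! 0) (Xs ! 1)"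
    have "(\<Sum>i<2 * n. g (?R (e i)) (J (e i)) p) = (\<Sum>i<DIM('e). - g (J (?R (e i))) (e i) p)"
      using XY ei n by (intro sum.cong) (auto intro!: g_J_right N.curvature_vfields)
    also have "\<dots> = - tr (\<lambda>Z. J (?R Z)) p"
      using tr_orthonormal[OF on J_curvature_endo[OF XY]] by (simp add: sum_negf)
    finally show ?thesis using True by (simp add: chern_ricci_def rho_def Let_def e_def[symmetric])
  next
    case False
    then show ?thesis by (auto simp: chern_ricci_def)
  qed
qed

lemma chern_ricci_closed:
  assumes n: "DIM('e) = 2 * n"
  shows "closed_form A 2 (chern_ricci A n \<omega> J N)"
proof -
  define \<rho> :: "'a form" where "\<rho> = (\<lambda>Xs p. if length Xs = 2 \<and> set Xs \<subseteq> vfields A then rho (Xs ! 0) (Xs ! 1) p else 0)"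
  have \<rho>2: "\<rho> [X, Y] = rho X Y" if "X \<in> vfields A" "Y \<in> vfields A" for X Y
    using that by (simp add: \<rho>_def)
  have \<rho>0: "\<rho> Xs = (\<lambda>p. 0)" if "length Xs \<noteq> 2" for Xs using that by (simp add: \<rho>_def)
  have right: "rho X (Y + Z) p = rho X Y p + rho X Z p" "h \<in> cinf A \<Longrightarrow> rho X (vf_scale h Y) p = h p * rho X Y p"
    if "X \<in> vfields A" "Y \<in> vfields A" "Z \<in> vfields A" for X Y Z h p
    using covector_add[OF rho_covector[OF that(1)] that(2,3), of p] covector_scale[OF rho_covector[OF that(1)] _ that(2), of h p]
      that rho_swap[of X] by (simp_all add: vf_add_vfields vf_scale_vfields del: vf_scale_fun)
  have self: "rho X X p = 0" if "X \<in> vfields A" for X p using rho_swap[OF that that, of p] by simp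
  have form: "is_form A 2 \<rho>"
    unfolding is_form_def
  proof (intro conjI allI impI)
    fix Xs :: "'a vf list" assume Xs: "length Xs = 2 \<and> set Xs \<subseteq> vfields A"
    then obtain X Y where XY: "Xs = [X, Y]" "X \<in> vfields A" "Y \<in> vfields A"
      by (auto simp: numeral_2_eq_2 length_Suc_conv)
    show "\<rho> Xs \<in> cinf A" using XY by (simp add: \<rho>2 rho_cinf)
    show "\<forall>Z\<in>vfields A. \<rho> (Xs[i := vf_add (Xs ! i) Z]) = (\<lambda>p. \<rho> Xs p + \<rho> (Xs[i := Z]) p)" if "i < 2" for i
      using that XY by (auto simp: less_2_cases_iff \<rho>2 vf_add_vfields right covector_add[OF rho_covector] fun_eq_iff)
    show "\<forall>h\<in>cinf A. \<rho> (Xs[i := vf_scale h (Xs ! i)]) = (\<lambda>p. h p * \<rho> Xs p)" if "i < 2" for i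
      using that XY by (auto simp: less_2_cases_iff \<rho>2 vf_scale_vfields right covector_scale[OF rho_covector] fun_eq_iff simp del: vf_scale_fun)
    show "\<rho> Xs = (\<lambda>p. 0)" if "i < 2" "j < i" "Xs ! i = Xs ! j" for i j
    proof -
      have "X = Y" using that XY by (auto simp: less_2_cases_iff)
      then show ?thesis using XY \<rho>2[OF XY(2,3)] self[OF XY(2)] by auto
    qed
  next
    fix Xs :: "'a vf list" assume "\<not> (length Xs = 2 \<and> set Xs \<subseteq> vfields A)"
    then show "\<rho> Xs = (\<lambda>p. 0)" by (auto simp: \<rho>_def fun_eq_iff)
  qed
  have "ext_deriv A \<rho> Xs p = 0" for Xs p
  proof (cases "set Xs \<subseteq> vfields A")
    case sub: True
    show ?thesis
    proof (cases "length Xs = 3")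
      case True
      then obtain X Y Z where "Xs = [X, Y, Z]" by (auto simp: numeral_3_eq_3 length_Suc_conv)
      then show ?thesis using sub rho_closed[of X Y Z p] ext_deriv_two_form[of X Y Z \<rho> p]
        by (simp add: \<rho>2 vf_bracket_vfields)
    next
      case False
      have "(Xs ! i) (\<rho> (nths Xs (- {i}))) p = 0" if "i < length Xs" for i
      proof -
        have "{j. j < length Xs \<and> j \<in> - {i}} = {..<length Xs} - {i}" by auto
        then have "length (nths Xs (- {i})) = length Xs - 1" using that by (simp add: length_nths)
        then have "\<rho> (nths Xs (- {i})) = (\<lambda>p. 0)" using False that by (intro \<rho>0) auto
        moreover have "Xs ! i \<in> vfields A" using sub that by auto
        ultimately show ?thesis by (simp add: vf_const)
      qed
      moreover have "\<rho> (vf_bracket (Xs ! i) (Xs ! j) # nths Xs (- {i, j})) p = 0" if "i < j" "j < length Xs" for i j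
      proof -
        have "{k. k < length Xs \<and> k \<in> - {i, j}} = {..<length Xs} - {i, j}" by auto
        then have "length (nths Xs (- {i, j})) = length Xs - 2"
          using that by (simp add: length_nths card_Diff_subset)
        then have "\<rho> (vf_bracket (Xs ! i) (Xs ! j) # nths Xs (- {i, j})) = (\<lambda>p. 0)"
          using False that by (intro \<rho>0) auto
        then show ?thesis by simp
      qed
      ultimately show ?thesis by (simp add: ext_deriv_def)
    qed
  qed (simp add: ext_deriv_def)
  then show ?thesis using form unfolding chern_ricci_eq[OF n] closed_form_def \<rho>_def by blast
qed

end

lemma line_in_open:
  fixes y w :: "'a::real_normed_vector"
  assumes "open S" "y \<in> S"
  obtains \<epsilon> where "\<epsilon> > 0" "\<And>t. \<bar>t\<bar> < \<epsilon> \<Longrightarrow> y + t *\<^sub>R w \<in> S"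
proof -
  obtain r where r: "r > 0" "ball y r \<subseteq> S" using assms by (auto simp: open_contains_ball)
  have nw: "norm w + 1 > 0" by (smt (verit) norm_ge_zero)
  have "y + t *\<^sub>R w \<in> S" if "\<bar>t\<bar> < r / (norm w + 1)" for t
  proof -
    have "norm (t *\<^sub>R w) \<le> \<bar>t\<bar> * (norm w + 1)" by (simp add: mult_left_mono)
    also have "\<dots> < r" using that nw by (simp add: pos_less_divide_eq)
    finally show ?thesis using r(2) by (auto simp: dist_norm)
  qed
  then show ?thesis using r(1) nw that[of "r / (norm w + 1)"] by simp
qed

section \<open>Smooth families of functions\<close>

lemma dir_deriv_slices:
  fixes G :: "'k::real_normed_vector \<times> 'e::real_normed_vector \<Rightarrow> real"
  assumes "open T" "smooth_on T G" "(b, y) \<in> T"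
  shows "dir_deriv (\<lambda>b. G (b, y)) w b = dir_deriv G (w, 0) (b, y)"
    and "dir_deriv (\<lambda>y. G (b, y)) v y = dir_deriv G (0, v) (b, y)"
proof -
  note G = smooth_on_has_derivative[OF assms]
  have "((\<lambda>b. (b, y)) has_derivative (\<lambda>w. (w, 0))) (at b)" "((\<lambda>y. (b, y)) has_derivative (\<lambda>v. (0, v))) (at y)"
    by (auto intro!: derivative_eq_intros)
  from this[THEN diff_chain_at, OF G] show "dir_deriv (\<lambda>b. G (b, y)) w b = dir_deriv G (w, 0) (b, y)"
    "dir_deriv (\<lambda>y. G (b, y)) v y = dir_deriv G (0, v) (b, y)"
    by (auto dest!: frechet_derivative_at simp: o_def fun_eq_iff)
qed

context manifold
begin

text \<open>Functions on the manifold that depend smoothly on a parameter in an open subset \<open>S\<close> of a vector space,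
  such as \<open>f\<close> composed with the flow of a vector field or with the elements of a Lie group in a chart.\<close>

definition smooth_family :: "'k::euclidean_space set \<Rightarrow> ('k \<Rightarrow> 'a \<Rightarrow> real) \<Rightarrow> bool" where
  "smooth_family S F \<longleftrightarrow> (\<forall>(U, \<phi>)\<in>A. smooth_on (S \<times> \<phi> ` U) (\<lambda>z. F (fst z) (inv_into U \<phi> (snd z))))"

lemma smooth_familyD:
  "smooth_family S F \<Longrightarrow> (U, \<phi>) \<in> A \<Longrightarrow> smooth_on (S \<times> \<phi> ` U) (\<lambda>z. F (fst z) (inv_into U \<phi> (snd z)))"
  by (auto simp: smooth_family_def)

lemma smooth_family_mult: "smooth_family S F \<Longrightarrow> smooth_family S G \<Longrightarrow> smooth_family S (\<lambda>b x. F b x * G b x)"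
  unfolding smooth_family_def by (auto intro!: smooth_on_mult)

lemma smooth_family_sum: "(\<And>i. i \<in> K \<Longrightarrow> smooth_family S (F i)) \<Longrightarrow> smooth_family S (\<lambda>b x. \<Sum>i\<in>K. F i b x)"
  unfolding smooth_family_def by (auto intro!: smooth_on_sum)

context
  fixes S :: "'k::euclidean_space set" and F
  assumes S: "open S" and F: "smooth_family S F"
begin

lemma family_cinf:
  assumes "b \<in> S"
  shows "F b \<in> cinf A"
proof (rule cinfI)
  fix U \<phi> assume U: "(U, \<phi>) \<in> A"
  have "smooth_on (\<phi> ` U) (\<lambda>y. F (fst (b, y)) (inv_into U \<phi> (snd (b, y))))"
    by (rule smooth_on_compose[OF smooth_familyD[OF F U] smooth_on_Pair[OF smooth_on_const smooth_on_id]])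
      (use assms in auto)
  then show "smooth_on (\<phi> ` U) (\<lambda>y. F b (inv_into U \<phi> y))" by simp
qed

lemma family_parameter: "smooth_on S (\<lambda>b. F b x)"
proof -
  obtain U \<phi> where U: "(U, \<phi>) \<in> A" "x \<in> U" by (rule chart_at)
  have "smooth_on S (\<lambda>b. F (fst (b, \<phi> x)) (inv_into U \<phi> (snd (b, \<phi> x))))"
    by (rule smooth_on_compose[OF smooth_familyD[OF F U(1)] smooth_on_Pair[OF smooth_on_id smooth_on_const]])
      (use U in auto)
  then show ?thesis using U by simp
qed

lemma family_continuous: "continuous_on (S \<times> UNIV) (\<lambda>(b, x). F b x)"
proof -
  have "isCont (\<lambda>(b, x). F b x) (b, x)" if b: "b \<in> S" for b x
  proof -
    obtain U \<phi> where U: "(U, \<phi>) \<in> A" "x \<in> U" by (rule chart_at)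
    have "continuous_on (S \<times> U) (\<lambda>z. (fst z, \<phi> (snd z)))"
      by (intro continuous_intros continuous_on_compose2[OF chart_continuous[OF U(1)]]) auto
    then have "continuous_on (S \<times> U) (\<lambda>z. F (fst (fst z, \<phi> (snd z))) (inv_into U \<phi> (snd (fst z, \<phi> (snd z)))))"
      by (rule continuous_on_compose2[OF smooth_on_imp_continuous_on[OF smooth_familyD[OF F U(1)]]]) auto
    then have "continuous_on (S \<times> U) (\<lambda>(b, x). F b x)"
      by (rule continuous_on_cong[THEN iffD1, OF refl, rotated]) (use U in auto)
    then show ?thesis
      using open_Times[OF S chart_open[OF U(1)]] b U(2) continuous_on_eq_continuous_at by (metis mem_Sigma_iff)
  qed
  then show ?thesis by (auto intro!: continuous_at_imp_continuous_on)
qed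

lemma open_chart_times: "(U, \<phi>) \<in> A \<Longrightarrow> open (S \<times> \<phi> ` U)"
  by (intro open_Times S chart_image)

lemma family_deriv: "smooth_family S (\<lambda>b x. dir_deriv (\<lambda>b. F b x) w b)"
  unfolding smooth_family_def
proof (clarify)
  fix U \<phi> assume U: "(U, \<phi>) \<in> A"
  show "smooth_on (S \<times> \<phi> ` U) (\<lambda>z. dir_deriv (\<lambda>b. F b (inv_into U \<phi> (snd z))) w (fst z))"
    by (rule smooth_on_cong[OF open_chart_times[OF U] _
          smooth_on_dir_deriv[OF open_chart_times[OF U] smooth_familyD[OF F U], of "(w, 0)"]])
      (use dir_deriv_slices(1)[OF open_chart_times[OF U] smooth_familyD[OF F U]] in auto)
qed

lemma family_coord_field:
  assumes cut: "chart_cutoff (U, \<phi>) \<eta> N" and x: "x \<in> N" and b: "b \<in> S" and X: "X \<in> vfields A"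
  shows "X (F b) x = (\<Sum>v\<in>Basis. X (coord_fun (U, \<phi>) \<eta> v) x
    * dir_deriv (\<lambda>z. F (fst z) (inv_into U \<phi> (snd z))) (0, v) (b, \<phi> x))"
proof -
  note U = cutoff(1)[OF cut]
  have m: "(b, \<phi> x) \<in> S \<times> \<phi> ` U" using x b cutoff(4)[OF cut] by auto
  have "coord_field (U, \<phi>) \<eta> v (F b) x = dir_deriv (\<lambda>z. F (fst z) (inv_into U \<phi> (snd z))) (0, v) (b, \<phi> x)" for v
    using dir_deriv_slices(2)[OF open_chart_times[OF U] smooth_familyD[OF F U] m, of v]
    by (simp add: coord_field_eq[OF cut x family_cinf[OF b]])
  then show ?thesis using tangent_expand_coord[OF cut x vf_tangent[OF X] family_cinf[OF b]] by simp
qed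

lemma family_vf:
  assumes X: "X \<in> vfields A"
  shows "smooth_family S (\<lambda>b. X (F b))"
  unfolding smooth_family_def
proof (clarify, rule smooth_on_local, clarify)
  fix U \<phi> b p assume U: "(U, \<phi>) \<in> A" and b: "b \<in> S" and p: "p \<in> U"
  obtain \<eta> N where cut: "chart_cutoff (U, \<phi>) \<eta> N" and pN: "p \<in> N" by (rule chart_cutoff_in[OF U p])
  let ?G = "\<lambda>z. F (fst z) (inv_into U \<phi> (snd z))" and ?T = "S \<times> \<phi> ` N"
  have T: "open ?T" using S chart_image_open[OF U cutoff(3,4)[OF cut]] by (rule open_Times)
  have sub: "?T \<subseteq> S \<times> \<phi> ` U" using cutoff(4)[OF cut] by auto
  have "smooth_on ?T (\<lambda>z. X (coord_fun (U, \<phi>) \<eta> v) (inv_into U \<phi> (snd z)))" for v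
    by (rule smooth_on_compose[OF cinfD[OF vf_cinf[OF X] U]])
      (use cutoff(4)[OF cut] in \<open>auto intro: smooth_on_bounded_linear[OF bounded_linear_snd smooth_on_id]\<close>)
  then have "smooth_on ?T (\<lambda>z. \<Sum>v\<in>Basis. X (coord_fun (U, \<phi>) \<eta> v) (inv_into U \<phi> (snd z)) * dir_deriv ?G (0, v) z)"
    by (intro smooth_on_sum smooth_on_mult
        smooth_on_subset[OF smooth_on_dir_deriv[OF open_chart_times[OF U] smooth_familyD[OF F U]] sub])
  then have "smooth_on ?T (\<lambda>z. X (F (fst z)) (inv_into U \<phi> (snd z)))"
    by (rule smooth_on_cong[OF T, rotated])
      (use family_coord_field[OF cut _ _ X] cutoff[OF cut] in \<open>auto simp: subset_iff\<close>)
  then show "\<exists>T. open T \<and> (b, \<phi> p) \<in> T \<and> smooth_on T (\<lambda>z. X (F (fst z)) (inv_into U \<phi> (snd z)))"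
    using T b pN by blast
qed

text \<open>Symmetry of second derivatives, in the parameter and in a coordinate.\<close>

lemma family_vf_deriv:
  assumes X: "X \<in> vfields A" and b: "b \<in> S"
  shows "dir_deriv (\<lambda>b. X (F b) x) w b = X (\<lambda>x. dir_deriv (\<lambda>b. F b x) w b) x"
proof -
  obtain U \<phi> \<eta> N where cut: "chart_cutoff (U, \<phi>) \<eta> N" and x: "x \<in> N" by (rule chart_cutoff_at)
  note U = cutoff(1)[OF cut]
  let ?G = "\<lambda>z. F (fst z) (inv_into U \<phi> (snd z))"
  let ?T = "S \<times> \<phi> ` U"
  note T = open_chart_times[OF U] and G = smooth_familyD[OF F U]
  have m: "(b, \<phi> x) \<in> ?T" if "b \<in> S" for b using x that cutoff(4)[OF cut] by auto
  let ?c = "\<lambda>v. X (coord_fun (U, \<phi>) \<eta> v) x"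
  have "((\<lambda>b. \<Sum>v\<in>Basis. ?c v * dir_deriv ?G (0, v) (b, \<phi> x)) has_derivative
      (\<lambda>w. \<Sum>v\<in>Basis. ?c v * dir_deriv (dir_deriv ?G (0, v)) (w, 0) (b, \<phi> x))) (at b)"
  proof (intro has_derivative_sum has_derivative_mult_right)
    fix v :: 'e
    note d = smooth_on_has_derivative[OF T smooth_on_dir_deriv[OF T G, of "(0, v)"] m[OF b]]
    have "((\<lambda>b. (b, \<phi> x)) has_derivative (\<lambda>w. (w, 0))) (at b)" by (auto intro!: derivative_eq_intros)
    from diff_chain_at[OF this d]
    show "((\<lambda>b. dir_deriv ?G (0, v) (b, \<phi> x)) has_derivative (\<lambda>w. dir_deriv (dir_deriv ?G (0, v)) (w, 0) (b, \<phi> x))) (at b)"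
      by (simp add: o_def)
  qed
  then have "((\<lambda>b. X (F b) x) has_derivative
      (\<lambda>w. \<Sum>v\<in>Basis. ?c v * dir_deriv (dir_deriv ?G (0, v)) (w, 0) (b, \<phi> x))) (at b)"
    by (rule has_derivative_transform_within_open[OF _ S b]) (simp add: family_coord_field[OF cut x _ X])
  from frechet_derivative_at[OF this]
  have "dir_deriv (\<lambda>b. X (F b) x) w b = (\<Sum>v\<in>Basis. ?c v * dir_deriv (dir_deriv ?G (0, v)) (w, 0) (b, \<phi> x))"
    by (simp add: fun_eq_iff)
  also have "\<dots> = (\<Sum>v\<in>Basis. ?c v * dir_deriv (dir_deriv ?G (w, 0)) (0, v) (b, \<phi> x))"
    using dir_deriv_commute[OF T G m[OF b]] by metis
  also have "\<dots> = (\<Sum>v\<in>Basis. ?c v * coord_field (U, \<phi>) \<eta> v (\<lambda>x. dir_deriv (\<lambda>b. F b x) w b) x)"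
  proof (intro sum.cong refl arg_cong2[where f = "(*)"])
    fix v :: 'e
    have cinf: "(\<lambda>x. dir_deriv (\<lambda>b. F b x) w b) \<in> cinf A"
      using manifold.family_cinf[OF manifold_axioms S family_deriv b] .
    have "dir_deriv (dir_deriv ?G (w, 0)) (0, v) (b, \<phi> x) = dir_deriv (\<lambda>y. dir_deriv ?G (w, 0) (b, y)) v (\<phi> x)"
      using dir_deriv_slices(2)[OF T smooth_on_dir_deriv[OF T G] m[OF b]] by simp
    also have "\<dots> = dir_deriv (\<lambda>y. dir_deriv (\<lambda>b. F b (inv_into U \<phi> y)) w b) v (\<phi> x)"
    proof -
      have d: "((\<lambda>y. dir_deriv ?G (w, 0) (b, y)) has_derivative
          (\<lambda>v. dir_deriv (dir_deriv ?G (w, 0)) (0, v) (b, \<phi> x))) (at (\<phi> x))"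
      proof -
        have "((\<lambda>y. (b, y)) has_derivative (\<lambda>v. (0, v))) (at (\<phi> x))" by (auto intro!: derivative_eq_intros)
        from diff_chain_at[OF this smooth_on_has_derivative[OF T smooth_on_dir_deriv[OF T G] m[OF b]]]
        show ?thesis by (simp add: o_def)
      qed
      have "((\<lambda>y. dir_deriv (\<lambda>b. F b (inv_into U \<phi> y)) w b) has_derivative
          (\<lambda>v. dir_deriv (dir_deriv ?G (w, 0)) (0, v) (b, \<phi> x))) (at (\<phi> x))"
        by (rule has_derivative_transform_within_open[OF d chart_image[OF U]])
          (use x cutoff(4)[OF cut] b dir_deriv_slices(1)[OF T G] in auto)
      from fun_cong[OF frechet_derivative_at[OF this], of v] fun_cong[OF frechet_derivative_at[OF d], of v]
      show ?thesis by simp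
    qed
    finally show "dir_deriv (dir_deriv ?G (w, 0)) (0, v) (b, \<phi> x)
        = coord_field (U, \<phi>) \<eta> v (\<lambda>x. dir_deriv (\<lambda>b. F b x) w b) x"
      by (simp add: coord_field_eq[OF cut x cinf])
  qed
  also have "\<dots> = X (\<lambda>x. dir_deriv (\<lambda>b. F b x) w b) x"
    using tangent_expand_coord[OF cut x vf_tangent[OF X] manifold.family_cinf[OF manifold_axioms S family_deriv b]]
    by simp
  finally show ?thesis .
qed

lemma family_line_derivative:
  assumes "b + t *\<^sub>R w \<in> S"
  shows "((\<lambda>t. F (b + t *\<^sub>R w) x) has_real_derivative dir_deriv (\<lambda>b. F b x) w (b + t *\<^sub>R w)) (at t)"
  by (rule smooth_on_line_derivative[OF S family_parameter assms])

end

text \<open>The source of smooth families: flows, and group actions in a chart of the group.\<close>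

lemma smooth_family_map:
  fixes P :: "('b::{t2_space,second_countable_topology}, 'k::euclidean_space) atlas"
  assumes P: "manifold P" and \<Psi>: "smooth_map (prod_atlas P A) A \<Psi>" and f: "f \<in> cinf A" and W: "(W, \<psi>) \<in> P"
  shows "smooth_family (\<psi> ` W) (\<lambda>b x. f (\<Psi> (inv_into W \<psi> b, x)))"
  unfolding smooth_family_def
proof (clarify, rule smooth_on_local, clarify)
  interpret P: manifold P by (rule P)
  fix U \<phi> a p assume U: "(U, \<phi>) \<in> A" and a: "a \<in> W" and p: "p \<in> U"
  obtain V \<zeta> where V: "(V, \<zeta>) \<in> A" "\<Psi> (a, p) \<in> V" by (rule chart_at)
  let ?i = "\<lambda>z. (inv_into W \<psi> (fst z), inv_into U \<phi> (snd z))"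
  define T where "T = map_prod \<psi> \<phi> ` (W \<times> U \<inter> \<Psi> -` V)"
  have \<Psi>c: "continuous_on UNIV \<Psi>" using \<Psi> by (simp add: smooth_map_def)
  have inv: "inv_into (W \<times> U) (map_prod \<psi> \<phi>) z = ?i z" if "z \<in> \<psi> ` W \<times> \<phi> ` U" for z
    using that P.chart_inv[OF W] chart_inv[OF U]
    by (intro inv_into_f_eq) (auto intro!: map_prod_inj_on P.chart_inj[OF W] chart_inj[OF U])
  have "T = (\<psi> ` W \<times> \<phi> ` U) \<inter> (\<lambda>z. \<Psi> (?i z)) -` V"
    using P.chart_inv[OF W] chart_inv[OF U] unfolding T_def by (auto simp: image_iff)
  note T_eq = this
  have TV: "(\<zeta> \<circ> \<Psi> \<circ> inv_into (W \<times> U) (map_prod \<psi> \<phi>)) z = \<zeta> (\<Psi> (?i z))" "\<Psi> (?i z) \<in> V" if "z \<in> T" for z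
    using that inv unfolding T_eq by auto
  have "continuous_on (\<psi> ` W \<times> \<phi> ` U) (\<lambda>z. \<Psi> (?i z))"
    by (intro continuous_on_compose2[OF \<Psi>c] continuous_on_Pair
        continuous_on_compose2[OF P.chart_inv_continuous[OF W]]
        continuous_on_compose2[OF chart_inv_continuous[OF U]] continuous_intros) auto
  with T_eq have T: "open T"
    using continuous_open_preimage[OF _ open_Times[OF P.chart_image[OF W] chart_image[OF U]] chart_open[OF V(1)]]
    by metis
  have "(W \<times> U, map_prod \<psi> \<phi>) \<in> prod_atlas P A" using W U by (auto simp: prod_atlas_def)
  then have "smooth_on T (\<zeta> \<circ> \<Psi> \<circ> inv_into (W \<times> U) (map_prod \<psi> \<phi>))"
    using \<Psi> V(1) unfolding smooth_map_def T_def by fastforce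
  then have "smooth_on T (\<lambda>z. f (inv_into V \<zeta> ((\<zeta> \<circ> \<Psi> \<circ> inv_into (W \<times> U) (map_prod \<psi> \<phi>)) z)))"
    by (rule smooth_on_compose[OF cinfD[OF f V(1)]]) (use TV in auto)
  then have "smooth_on T (\<lambda>z. f (\<Psi> (?i z)))"
    by (rule smooth_on_cong[OF T, rotated]) (use TV V(1) in auto)
  then show "\<exists>T. open T \<and> (\<psi> a, \<phi> p) \<in> T \<and> smooth_on T (\<lambda>z. f (\<Psi> (inv_into W \<psi> (fst z), inv_into U \<phi> (snd z))))"
    using T a p V(2) unfolding T_def by (intro exI[of _ T]) (auto simp: T_def intro!: image_eqI[of _ _ "(a, p)"])
qed

section \<open>Curves and maxima\<close>

lemma coordinate_line:
  assumes cut: "chart_cutoff (U, \<phi>) \<eta> N" and y: "y + t *\<^sub>R v \<in> \<phi> ` N" and f: "f \<in> cinf A"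
  shows "((\<lambda>t. f (inv_into U \<phi> (y + t *\<^sub>R v))) has_real_derivative
    coord_field (U, \<phi>) \<eta> v f (inv_into U \<phi> (y + t *\<^sub>R v))) (at t)"
proof -
  note U = cutoff(1)[OF cut]
  obtain x where x: "x \<in> N" "y + t *\<^sub>R v = \<phi> x" using y by auto
  have m: "y + t *\<^sub>R v \<in> \<phi> ` U" using x cutoff(4)[OF cut] by auto
  have "inv_into U \<phi> (y + t *\<^sub>R v) = x" using x cutoff(4)[OF cut] U by auto
  then show ?thesis
    using smooth_on_line_derivative[OF chart_image[OF U] cinfD[OF f U] m] coord_field_eq[OF cut x(1) f, of v] x(2)
    by simp
qed

text \<open>Straight lines in a chart. Along them the velocity is a coordinate field, hence the restriction of a
  global vector field.\<close>

lemma nearby_curve: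
  obtains W where "open W" "p \<in> W" "\<And>x. x \<in> W \<Longrightarrow> \<exists>X\<in>vfields A. \<exists>\<gamma>. \<gamma> 0 = p \<and> \<gamma> 1 = x \<and> continuous_on {0..1} \<gamma> \<and>
      (\<forall>s\<in>{0..1}. \<forall>f\<in>cinf A. ((\<lambda>s. f (\<gamma> s)) has_real_derivative X f (\<gamma> s)) (at s))"
proof -
  obtain U \<phi> \<eta> N where cut: "chart_cutoff (U, \<phi>) \<eta> N" and p: "p \<in> N" by (rule chart_cutoff_at)
  note U = cutoff(1)[OF cut]
  obtain r where r: "r > 0" "ball (\<phi> p) r \<subseteq> \<phi> ` N"
    using chart_image_open[OF U cutoff(3,4)[OF cut]] p by (auto simp: open_contains_ball)
  define W where "W = U \<inter> \<phi> -` ball (\<phi> p) r"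
  have pU: "p \<in> U" using p cutoff(4)[OF cut] by auto
  show ?thesis
  proof (rule that[of W])
    show "open W" unfolding W_def by (rule chart_preimage_open[OF U open_ball])
    show "p \<in> W" using pU r by (simp add: W_def)
    fix x assume x: "x \<in> W"
    define v where "v = \<phi> x - \<phi> p"
    define \<gamma> where "\<gamma> s = inv_into U \<phi> (\<phi> p + s *\<^sub>R v)" for s
    have seg: "\<phi> p + s *\<^sub>R v \<in> ball (\<phi> p) r" if "s \<in> {0..1}" for s
      using convexD_alt[OF convex_ball, of "\<phi> p" "\<phi> p" r "\<phi> x" s] x r(1) that
      by (auto simp: W_def v_def algebra_simps)
    then have segN: "\<phi> p + s *\<^sub>R v \<in> \<phi> ` N" if "s \<in> {0..1}" for s using r(2) that by blast
    have "continuous_on {0..1} \<gamma>" unfolding \<gamma>_def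
      by (intro continuous_on_compose2[OF chart_inv_continuous[OF U]] continuous_intros)
        (use segN cutoff(4)[OF cut] in blast)
    moreover have "\<gamma> 0 = p" "\<gamma> 1 = x" using pU x U by (auto simp: \<gamma>_def v_def W_def)
    moreover have "((\<lambda>s. f (\<gamma> s)) has_real_derivative coord_field (U, \<phi>) \<eta> v f (\<gamma> s)) (at s)"
      if "s \<in> {0..1}" "f \<in> cinf A" for s f
      unfolding \<gamma>_def by (rule coordinate_line[OF cut segN[OF that(1)] that(2)])
    ultimately show "\<exists>X\<in>vfields A. \<exists>\<gamma>. \<gamma> 0 = p \<and> \<gamma> 1 = x \<and> continuous_on {0..1} \<gamma> \<and>
      (\<forall>s\<in>{0..1}. \<forall>f\<in>cinf A. ((\<lambda>s. f (\<gamma> s)) has_real_derivative X f (\<gamma> s)) (at s))"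
      using coord_field_vfields[OF cut] by blast
  qed
qed

lemma curve_with_velocity:
  assumes X: "X \<in> vfields A" and W: "open W" "p \<in> W"
  obtains Y \<gamma> \<epsilon> where "Y \<in> vfields A" "\<And>f. f \<in> cinf A \<Longrightarrow> Y f p = X f p" "\<epsilon> > 0" "\<gamma> 0 = p"
    "\<And>s. \<bar>s\<bar> < \<epsilon> \<Longrightarrow> \<gamma> s \<in> W"
    "\<And>s f. \<bar>s\<bar> < \<epsilon> \<Longrightarrow> f \<in> cinf A \<Longrightarrow> ((\<lambda>s. f (\<gamma> s)) has_real_derivative Y f (\<gamma> s)) (at s)"
proof -
  obtain U \<phi> \<eta> N where cut: "chart_cutoff (U, \<phi>) \<eta> N" and p: "p \<in> N" by (rule chart_cutoff_at)
  note U = cutoff(1)[OF cut]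
  have pU: "p \<in> U" using p cutoff(4)[OF cut] by auto
  have NU: "N \<inter> W \<subseteq> U" using cutoff(4)[OF cut] by auto
  define v where "v = (\<Sum>b\<in>Basis. X (coord_fun (U, \<phi>) \<eta> b) p *\<^sub>R b)"
  let ?Y = "coord_field (U, \<phi>) \<eta> v"
  have "\<phi> p \<in> \<phi> ` (N \<inter> W)" using p W(2) by blast
  from line_in_open[OF chart_image_open[OF U open_Int[OF cutoff(3)[OF cut] W(1)] NU] this]
  obtain \<epsilon> where \<epsilon>: "\<epsilon> > 0" and seg: "\<And>s. \<bar>s\<bar> < \<epsilon> \<Longrightarrow> \<phi> p + s *\<^sub>R v \<in> \<phi> ` (N \<inter> W)"
    by blast
  show ?thesis
  proof (rule that[of ?Y \<epsilon> "\<lambda>s. inv_into U \<phi> (\<phi> p + s *\<^sub>R v)"])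
    show Y: "?Y \<in> vfields A" by (rule coord_field_vfields[OF cut])
    show "?Y f p = X f p" if "f \<in> cinf A" for f
    proof -
      have "?Y (coord_fun (U, \<phi>) \<eta> b) p = X (coord_fun (U, \<phi>) \<eta> b) p" if "b \<in> Basis" for b
        using that by (simp add: coord_field_coord_fun[OF cut p] v_def inner_sum_left inner_Basis if_distrib cong: if_cong)
      then show ?thesis
        using tangent_expand_coord[OF cut p vf_tangent[OF Y] that] tangent_expand_coord[OF cut p vf_tangent[OF X] that]
        by simp
    qed
    show "\<epsilon> > 0" by (rule \<epsilon>)
    show "inv_into U \<phi> (\<phi> p + 0 *\<^sub>R v) = p" using pU U by simp
    show "inv_into U \<phi> (\<phi> p + s *\<^sub>R v) \<in> W" if s: "\<bar>s\<bar> < \<epsilon>" for s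
    proof -
      obtain x where "x \<in> N \<inter> W" "\<phi> p + s *\<^sub>R v = \<phi> x" using seg[OF s] by blast
      then show ?thesis using NU U by auto
    qed
    show "((\<lambda>s. f (inv_into U \<phi> (\<phi> p + s *\<^sub>R v))) has_real_derivative ?Y f (inv_into U \<phi> (\<phi> p + s *\<^sub>R v))) (at s)"
      if "\<bar>s\<bar> < \<epsilon>" "f \<in> cinf A" for s f
      by (rule coordinate_line[OF cut _ that(2)]) (use seg[OF that(1)] in auto)
  qed
qed

end

lemma second_derivative_test:
  fixes h :: "real \<Rightarrow> real"
  assumes "\<epsilon> > 0" "\<And>s. \<bar>s\<bar> < \<epsilon> \<Longrightarrow> (h has_real_derivative h' s) (at s)" "(h' has_real_derivative l) (at 0)"
    and "\<And>s. \<bar>s\<bar> < \<epsilon> \<Longrightarrow> h s \<le> h 0"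
  shows "h' 0 = 0" "l \<le> 0"
proof -
  show h0: "h' 0 = 0"
    by (rule DERIV_local_max[OF assms(2)[of 0] assms(1)]) (use assms in auto)
  show "l \<le> 0"
  proof (rule ccontr)
    assume "\<not> l \<le> 0"
    then obtain d where d: "d > 0" "\<And>k. 0 < k \<Longrightarrow> k < d \<Longrightarrow> h' 0 < h' (0 + k)"
      using DERIV_pos_inc_right[OF assms(3)] by auto
    define k where "k = min d \<epsilon> / 2"
    have k: "0 < k" "k < d" "k < \<epsilon>" using d(1) assms(1) by (auto simp: k_def)
    have "\<exists>z>0. z < k \<and> h k - h 0 = (k - 0) * h' z"
      by (rule MVT2) (use k assms(2) in auto)
    then obtain z where z: "0 < z" "z < k" "h k - h 0 = k * h' z" by auto
    then have "h' z > 0" using d(2)[of z] k h0 by auto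
    then have "h k - h 0 > 0" using z(3) k(1) by simp
    then show False using assms(4)[of k] k by simp
  qed
qed

context manifold_dual_basis
begin

text \<open>At a critical point the second derivative \<open>X (Z f) p\<close> depends only on the values of the fields at \<open>p\<close>.\<close>

lemma vf_critical:
  assumes X: "X \<in> vfields A" and Z: "Z \<in> vfields A" and f: "f \<in> cinf A"
    and crit: "\<And>Y. Y \<in> vfields A \<Longrightarrow> Y f p = 0" and Z0: "\<And>h. h \<in> cinf A \<Longrightarrow> Z h p = 0"
  shows "X (Z f) p = 0"
proof -
  have "Z f = (\<lambda>q. \<Sum>i\<in>I. Z (x i) q * E i f q)"
    using tangent_expand[OF vf_tangent[OF Z] f] by blast
  then have "X (Z f) p = (\<Sum>i\<in>I. X (\<lambda>q. Z (x i) q * E i f q) p)"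
    by (simp add: vf_sum[OF X] cinf_mult vf_cinf[OF Z] vf_cinf[OF E_vfields])
  also have "\<dots> = 0"
    by (intro sum.neutral ballI) (simp add: vf_mult[OF X] vf_cinf[OF Z] vf_cinf[OF E_vfields] crit[OF E_vfields] Z0[OF x_cinf])
  finally show ?thesis .
qed

text \<open>The second derivative test along a straight line in a chart, for the coordinate field \<open>Y\<close> that agrees
  with \<open>X\<close> at \<open>p\<close>; \<open>vf_critical\<close> passes from \<open>Y\<close> to \<open>X\<close>.\<close>

lemma local_max:
  assumes f: "f \<in> cinf A" and W: "open W" "p \<in> W" "\<And>q. q \<in> W \<Longrightarrow> f q \<le> f p" and X: "X \<in> vfields A"
  shows "X f p = 0" "X (X f) p \<le> 0"
proof -
  have *: "X f p = 0 \<and> (\<exists>Y\<in>vfields A. (\<forall>h\<in>cinf A. Y h p = X h p) \<and> Y (Y f) p \<le> 0)"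
    if X: "X \<in> vfields A" for X
  proof -
    obtain Y \<gamma> \<epsilon> where Y: "Y \<in> vfields A" "\<And>f. f \<in> cinf A \<Longrightarrow> Y f p = X f p" "\<epsilon> > 0" "\<gamma> 0 = p"
      "\<And>s. \<bar>s\<bar> < \<epsilon> \<Longrightarrow> \<gamma> s \<in> W"
      "\<And>s f. \<bar>s\<bar> < \<epsilon> \<Longrightarrow> f \<in> cinf A \<Longrightarrow> ((\<lambda>s. f (\<gamma> s)) has_real_derivative Y f (\<gamma> s)) (at s)"
      by (rule curve_with_velocity[OF X W(1,2)]) blast
    note t = second_derivative_test[of \<epsilon> "\<lambda>s. f (\<gamma> s)" "\<lambda>s. Y f (\<gamma> s)" "Y (Y f) p"]
    have "Y f (\<gamma> 0) = 0" "Y (Y f) p \<le> 0"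
      using t Y(3,4,5) Y(6)[of _ f] Y(6)[of 0 "Y f"] W(3) f vf_cinf[OF Y(1)] by auto
    then show ?thesis using Y(1,2,4) f by auto
  qed
  have crit: "\<And>X. X \<in> vfields A \<Longrightarrow> X f p = 0" using * by blast
  then show "X f p = 0" using X .
  obtain Y where Y: "Y \<in> vfields A" "\<And>h. h \<in> cinf A \<Longrightarrow> Y h p = X h p" "Y (Y f) p \<le> 0" using *[OF X] by blast
  have "X ((X - Y) f) p = 0"
    by (rule vf_critical[OF X vf_diff_vfields[OF X Y(1)] f]) (simp_all add: crit Y(2))
  then have "X (X f) p = X (Y f) p" by (simp add: vf_fun_ops[OF X] vf_cinf X Y(1))
  also have "\<dots> = Y (Y f) p" using Y(2)[OF vf_cinf[OF Y(1)]] by simp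
  finally show "X (X f) p \<le> 0" using Y(3) by simp
qed

end

section \<open>Hamiltonian diffeomorphisms preserve the symplectic form\<close>

context manifold_dual_basis
begin

lemma form2_covector_right:
  assumes "is_form A 2 \<alpha>" "X \<in> vfields A"
  shows "covector (\<lambda>Y. \<alpha> [X, Y])"
  by (rule covectorI)
    (use assms form2_swap[OF assms(1,2)] form2_scale[OF assms(1) _ assms(2)] in
      \<open>simp_all add: form2_cinf form2_add_right vf_scale_vfields del: vf_scale_fun\<close>)

lemma form2_expand:
  assumes "is_form A 2 \<alpha>" "X \<in> vfields A" "Y \<in> vfields A"
  shows "\<alpha> [X, Y] p = (\<Sum>i\<in>I. \<Sum>j\<in>I. X (x i) p * (Y (x j) p * \<alpha> [E i, E j] p))"
proof -
  have "\<alpha> [X, Y] p = (\<Sum>i\<in>I. X (x i) p * \<alpha> [E i, Y] p)"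
    by (rule covector_expand[OF form2_covector[OF assms(1,3)] assms(2)])
  also have "\<dots> = (\<Sum>i\<in>I. X (x i) p * (\<Sum>j\<in>I. Y (x j) p * \<alpha> [E i, E j] p))"
    by (intro sum.cong refl arg_cong2[where f = "(*)"]
        covector_expand[OF form2_covector_right[OF assms(1)] assms(3)] E_vfields)
  finally show ?thesis by (simp add: sum_distrib_left)
qed

lemma tangent_extends:
  assumes "tangent_at p \<delta>"
  obtains X where "X \<in> vfields A" "\<And>f. f \<in> cinf A \<Longrightarrow> X f p = \<delta> f"
proof (rule that[of "\<Sum>i\<in>I. vf_scale (\<lambda>q. \<delta> (x i)) (E i)"])
  show "(\<Sum>i\<in>I. vf_scale (\<lambda>q. \<delta> (x i)) (E i)) \<in> vfields A"
    by (intro vf_sum_vfields vf_scale_vfields cinf_const E_vfields)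
qed (simp add: sum_fun_apply tangent_expand[OF assms])

text \<open>The equation \<open>L\<^sub>V \<omega> = 0\<close> in the dual basis. Here \<open>Y\<close> and \<open>Z\<close> enter through their values at \<open>p\<close> alone, so
  that they may be replaced by images of tangent vectors under a flow.\<close>

lemma hamiltonian_preserves_expand:
  assumes \<omega>: "closed_form A 2 \<omega>" and V: "hamiltonian_vf A \<omega> f V" and YZ: "Y \<in> vfields A" "Z \<in> vfields A"
  shows "(\<Sum>i\<in>I. \<Sum>j\<in>I. Y (V (x i)) p * (Z (x j) p * \<omega> [E i, E j] p)
    + Y (x i) p * (Z (V (x j)) p * \<omega> [E i, E j] p + Z (x j) p * V (\<omega> [E i, E j]) p)) = 0"
proof -
  have form: "is_form A 2 \<omega>" using \<omega> by (simp add: closed_form_def)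
  have VA: "V \<in> vfields A" using V by (simp add: hamiltonian_vf_def)
  have w: "\<omega> [E i, E j] \<in> cinf A" if "i \<in> I" "j \<in> I" for i j using that by (intro form2_cinf[OF form] E_vfields)
  have "\<omega> [Y, Z] = (\<lambda>q. \<Sum>i\<in>I. \<Sum>j\<in>I. Y (x i) q * (Z (x j) q * \<omega> [E i, E j] q))"
    using form2_expand[OF form YZ] by blast
  then have "V (\<omega> [Y, Z]) p = (\<Sum>i\<in>I. \<Sum>j\<in>I. V (Y (x i)) p * (Z (x j) p * \<omega> [E i, E j] p)
    + Y (x i) p * (V (Z (x j)) p * \<omega> [E i, E j] p + Z (x j) p * V (\<omega> [E i, E j]) p))"
    by (simp add: vf_sum[OF VA] vf_mult[OF VA] cinf_sum cinf_mult vf_cinf[OF YZ(1)] vf_cinf[OF YZ(2)] w)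
  moreover have "\<omega> [vf_bracket V Y, Z] p = (\<Sum>i\<in>I. \<Sum>j\<in>I. (V (Y (x i)) p - Y (V (x i)) p) * (Z (x j) p * \<omega> [E i, E j] p))"
    using form2_expand[OF form vf_bracket_vfields[OF VA YZ(1)] YZ(2), of p] by (simp add: vf_bracket_fun)
  moreover have "\<omega> [Y, vf_bracket V Z] p = (\<Sum>i\<in>I. \<Sum>j\<in>I. Y (x i) p * ((V (Z (x j)) p - Z (V (x j)) p) * \<omega> [E i, E j] p))"
    using form2_expand[OF form YZ(1) vf_bracket_vfields[OF VA YZ(2)], of p] by (simp add: vf_bracket_fun)
  ultimately show ?thesis
    using hamiltonian_preserves[OF \<omega> V YZ, of p]
    by (simp add: sum.distrib sum_subtractf algebra_simps)
qed

lemma manifold_euclidean: "manifold (euclidean_atlas :: (real, real) atlas)"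
proof
  show "smooth_manifold (euclidean_atlas :: (real, real) atlas)"
    by (simp add: smooth_manifold_def euclidean_atlas_def is_chart_def smooth_compatible_def o_def
        homeomorphism_ident[folded id_def] smooth_on_id[folded id_def])
qed

text \<open>In the dual basis, \<open>c t\<close> is the pull-back of \<open>\<omega>\<close> under the flow at time \<open>t\<close>, evaluated on \<open>Y\<close> and \<open>Z\<close>. Its derivative is the
  pull-back of \<open>L\<^sub>V \<omega> = 0\<close>, where \<open>V\<close> is the Hamiltonian field at time \<open>t\<close>.\<close>

lemma Ham_preserves:
  assumes \<omega>: "closed_form A 2 \<omega>" and \<phi>: "\<phi> \<in> Ham A \<omega>" and YZ: "Y \<in> vfields A" "Z \<in> vfields A"
    and diff: "diffeo A \<phi>"
  shows "\<omega> [vf_push \<phi> Y, vf_push \<phi> Z] (\<phi> p) = \<omega> [Y, Z] p"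
proof -
  interpret \<phi>: diffeo A \<phi> by (rule diff)
  have form: "is_form A 2 \<omega>" using \<omega> by (simp add: closed_form_def)
  obtain H \<Phi> X where
    \<Phi>: "smooth_map (prod_atlas (euclidean_atlas :: (real, real) atlas) A) A \<Phi>"
    and X: "\<And>t. hamiltonian_vf A \<omega> (\<lambda>p. H (t, p)) (X t)" and \<Phi>0: "\<And>p. \<Phi> (0, p) = p"
    and flow: "\<And>t p f. f \<in> cinf A \<Longrightarrow> ((\<lambda>s. f (\<Phi> (s, p))) has_real_derivative X t f (\<Phi> (t, p))) (at t)"
    and \<phi>_eq: "\<phi> = (\<lambda>p. \<Phi> (1, p))"
    using \<phi> unfolding Ham_def by blast
  have XA: "X t \<in> vfields A" for t using X by (auto simp: hamiltonian_vf_def)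
  have fam: "smooth_family UNIV (\<lambda>t q. f (\<Phi> (t, q)))" if "f \<in> cinf A" for f
    using smooth_family_map[OF manifold_euclidean \<Phi> that, of UNIV id] by (simp add: euclidean_atlas_def)
  note fam_cinf = family_cinf[OF open_UNIV fam UNIV_I]
  have dir: "dir_deriv (\<lambda>s. f (\<Phi> (s, q))) 1 t = X t f (\<Phi> (t, q))" if "f \<in> cinf A" for f q t
    using frechet_derivative_at[OF flow[OF that, unfolded has_field_derivative_def]] by (metis mult.right_neutral)
  have der: "((\<lambda>t. Y (\<lambda>q. f (\<Phi> (t, q))) p) has_real_derivative Y (\<lambda>q. X t f (\<Phi> (t, q))) p) (at t)"
    if Y: "Y \<in> vfields A" and f: "f \<in> cinf A" for Y f t
    using family_line_derivative[OF open_UNIV family_vf[OF open_UNIV fam[OF f] Y], of 0 t 1 p]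
      family_vf_deriv[OF open_UNIV fam[OF f] Y UNIV_I, of p t 1] dir[OF f] by simp
  define c where "c t = (\<Sum>i\<in>I. \<Sum>j\<in>I. Y (\<lambda>q. x i (\<Phi> (t, q))) p
    * (Z (\<lambda>q. x j (\<Phi> (t, q))) p * \<omega> [E i, E j] (\<Phi> (t, p))))" for t
  have "(c has_real_derivative 0) (at t)" for t
  proof -
    have tan: "tangent_at (\<Phi> (t, p)) (\<lambda>f. Y (\<lambda>q. f (\<Phi> (t, q))) p)" if "Y \<in> vfields A" for Y
      unfolding tangent_at_def using fam_cinf vf_simps[OF that] by auto
    \<comment> \<open>fields whose values at \<open>\<Phi> (t, p)\<close> are the images of \<open>Y\<close> and \<open>Z\<close> under the differential of the flow\<close>
    obtain Y' where Y': "Y' \<in> vfields A" "\<And>f. f \<in> cinf A \<Longrightarrow> Y' f (\<Phi> (t, p)) = Y (\<lambda>q. f (\<Phi> (t, q))) p"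
      by (rule tangent_extends[OF tan[OF YZ(1)]]) blast
    obtain Z' where Z': "Z' \<in> vfields A" "\<And>f. f \<in> cinf A \<Longrightarrow> Z' f (\<Phi> (t, p)) = Z (\<lambda>q. f (\<Phi> (t, q))) p"
      by (rule tangent_extends[OF tan[OF YZ(2)]]) blast
    have "(c has_real_derivative (\<Sum>i\<in>I. \<Sum>j\<in>I.
        Y (\<lambda>q. X t (x i) (\<Phi> (t, q))) p * (Z (\<lambda>q. x j (\<Phi> (t, q))) p * \<omega> [E i, E j] (\<Phi> (t, p)))
        + Y (\<lambda>q. x i (\<Phi> (t, q))) p * (Z (\<lambda>q. X t (x j) (\<Phi> (t, q))) p * \<omega> [E i, E j] (\<Phi> (t, p))
          + Z (\<lambda>q. x j (\<Phi> (t, q))) p * X t (\<omega> [E i, E j]) (\<Phi> (t, p))))) (at t)"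
      unfolding c_def
    proof (intro DERIV_sum)
      fix i j assume ij: "i \<in> I" "j \<in> I"
      show "((\<lambda>t. Y (\<lambda>q. x i (\<Phi> (t, q))) p * (Z (\<lambda>q. x j (\<Phi> (t, q))) p * \<omega> [E i, E j] (\<Phi> (t, p)))) has_real_derivative
        Y (\<lambda>q. X t (x i) (\<Phi> (t, q))) p * (Z (\<lambda>q. x j (\<Phi> (t, q))) p * \<omega> [E i, E j] (\<Phi> (t, p)))
        + Y (\<lambda>q. x i (\<Phi> (t, q))) p * (Z (\<lambda>q. X t (x j) (\<Phi> (t, q))) p * \<omega> [E i, E j] (\<Phi> (t, p))
          + Z (\<lambda>q. x j (\<Phi> (t, q))) p * X t (\<omega> [E i, E j]) (\<Phi> (t, p)))) (at t)"
        by (rule DERIV_cong[OF DERIV_mult[OF der[OF YZ(1) x_cinf[OF ij(1)]]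
                DERIV_mult[OF der[OF YZ(2) x_cinf[OF ij(2)]]
                  flow[OF form2_cinf[OF form E_vfields[OF ij(1)] E_vfields[OF ij(2)]]]]]])
          (simp add: algebra_simps)
    qed
    moreover have "(\<Sum>i\<in>I. \<Sum>j\<in>I.
        Y (\<lambda>q. X t (x i) (\<Phi> (t, q))) p * (Z (\<lambda>q. x j (\<Phi> (t, q))) p * \<omega> [E i, E j] (\<Phi> (t, p)))
        + Y (\<lambda>q. x i (\<Phi> (t, q))) p * (Z (\<lambda>q. X t (x j) (\<Phi> (t, q))) p * \<omega> [E i, E j] (\<Phi> (t, p))
          + Z (\<lambda>q. x j (\<Phi> (t, q))) p * X t (\<omega> [E i, E j]) (\<Phi> (t, p)))) = 0"
      using hamiltonian_preserves_expand[OF \<omega> X[of t] Y'(1) Z'(1), of "\<Phi> (t, p)"]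
      by (simp add: Y'(2) Z'(2) x_cinf vf_cinf[OF XA])
    ultimately show ?thesis by simp
  qed
  then have "c 1 = c 0" by (rule DERIV_isconst_all[rule_format])
  moreover have "c 0 = \<omega> [Y, Z] p" by (simp add: c_def \<Phi>0 form2_expand[OF form YZ])
  moreover have "c 1 = \<omega> [vf_push \<phi> Y, vf_push \<phi> Z] (\<phi> p)"
    using form2_expand[OF form \<phi>.push_vfields[OF YZ(1)] \<phi>.push_vfields[OF YZ(2)], of "\<phi> p"]
    unfolding \<phi>.push_apply by (simp add: c_def \<phi>_eq o_def)
  ultimately show ?thesis by simp
qed

end

section \<open>Zeros of an infinitesimal automorphism\<close>

context manifold_dual_basis
begin

text \<open>At a zero of \<open>V\<close> the bracket \<open>[V, Y]\<close> is minus the derivative of the components of \<open>V\<close> along \<open>Y\<close>.\<close>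

lemma covector_bracket_at_zero:
  assumes \<theta>: "covector \<theta>" and V: "V \<in> vfields A" and Y: "Y \<in> vfields A"
    and zero: "\<And>h. h \<in> cinf A \<Longrightarrow> V h p = 0"
  shows "\<theta> (vf_bracket V Y) p = - Y (\<theta> V) p"
proof -
  have "\<theta> V = (\<lambda>q. \<Sum>i\<in>I. V (x i) q * \<theta> (E i) q)" using covector_expand[OF \<theta> V] by blast
  then have "Y (\<theta> V) p = (\<Sum>i\<in>I. Y (V (x i)) p * \<theta> (E i) p)"
    by (simp add: vf_sum[OF Y] vf_mult[OF Y] cinf_mult vf_cinf[OF V] covector_cinf[OF \<theta>] E_vfields zero x_cinf)
  moreover have "\<theta> (vf_bracket V Y) p = (\<Sum>i\<in>I. - Y (V (x i)) p * \<theta> (E i) p)"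
    using covector_expand[OF \<theta> vf_bracket_vfields[OF V Y], of p]
    by (simp add: vf_bracket_fun zero vf_cinf[OF Y])
  ultimately show ?thesis by (simp add: sum_negf)
qed

lemma covector_at_zero:
  assumes "covector \<theta>" "V \<in> vfields A" "\<And>h. h \<in> cinf A \<Longrightarrow> V h p = 0"
  shows "\<theta> V p = 0"
  using covector_expand[OF assms(1,2), of p] assms(3) x_cinf by simp

end

context almost_kaehler
begin

context
  fixes V f
  assumes ham: "hamiltonian_vf A \<omega> f V"
begin

lemma ham_vfields: "V \<in> vfields A"
  using ham by (auto simp: hamiltonian_vf_def)

lemma omega_ham: "Y \<in> vfields A \<Longrightarrow> \<omega> [V, Y] = - Y f"
  using ham by (simp add: hamiltonian_vf_def ext_deriv_zero_form fun_eq_iff)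

lemma critical_iff_zero:
  "(\<forall>Y\<in>vfields A. Y f p = 0) \<longleftrightarrow> (\<forall>h\<in>cinf A. V h p = 0)"
proof
  assume "\<forall>Y\<in>vfields A. Y f p = 0"
  then show "\<forall>h\<in>cinf A. V h p = 0"
    using g_nondegenerate[OF ham_vfields] by (simp add: g_eq omega_ham J_vfields)
next
  assume z: "\<forall>h\<in>cinf A. V h p = 0"
  show "\<forall>Y\<in>vfields A. Y f p = 0"
  proof
    fix Y assume Y: "Y \<in> vfields A"
    have "\<omega> [V, Y] p = 0" by (rule covector_at_zero[OF omega_covector[OF Y] ham_vfields]) (use z in blast)
    then show "Y f p = 0" using omega_ham[OF Y] by simp
  qed
qed

text \<open>At a zero of \<open>V\<close> the operator \<open>L\<^sub>V - N\<^sub>V\<close> is the linearisation of \<open>V\<close>, that is, \<open>J\<close> times the Hessian of \<open>f\<close>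
  up to sign. So the moment map is half of the non-negative Laplacian of \<open>f\<close> there, with sign
  \<open>\<ge> 0\<close> at maxima and \<open>\<le> 0\<close> at minima.\<close>

lemma mu_at_zero:
  assumes on: "orthonormal_at p (DIM('e)) e" and zero: "\<And>h. h \<in> cinf A \<Longrightarrow> V h p = 0"
  shows "mu V p = - (\<Sum>i<DIM('e). e i (e i f) p) / 2"
proof -
  have e: "\<And>i. i < DIM('e) \<Longrightarrow> e i \<in> vfields A" using on by (auto simp: orthonormal_at_def)
  note V = ham_vfields
  have "g (J (lie_minus_N V (e i))) (e i) p = e i (e i f) p" if "i < DIM('e)" for i
  proof -
    note ei = e[OF that]
    have NV: "N V (e i) h p = 0" if "h \<in> cinf A" for h
      by (rule covector_at_zero[OF endo_covector[OF N.conn_endo[OF ei] that] V zero])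
    have "g (J (lie_minus_N V (e i))) (e i) p = \<omega> [lie_minus_N V (e i), e i] p"
      by (simp add: omega_g ei endo_vfields[OF lie_minus_N_endo[OF V]])
    also have "\<dots> = \<omega> [vf_bracket V (e i), e i] p - \<omega> [N V (e i), e i] p"
      unfolding lie_minus_N_def
      by (rule covector_diff[OF omega_covector[OF ei]]) (intro vfields_intros N.conn_vfields V ei)+
    also have "\<omega> [N V (e i), e i] p = 0"
      by (rule covector_at_zero[OF omega_covector[OF ei] N.conn_vfields[OF V ei] NV])
    also have "\<omega> [vf_bracket V (e i), e i] p = - e i (\<omega> [V, e i]) p"
      by (rule covector_bracket_at_zero[OF omega_covector[OF ei] V ei zero])
    also have "\<dots> = e i (e i f) p"
      by (simp add: omega_ham[OF ei] vf_fun_ops[OF ei] vf_cinf[OF ei])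
    finally show ?thesis by simp
  qed
  then show ?thesis
    by (simp add: mu_def tr_orthonormal[OF on endo_compose[OF J_endo lie_minus_N_endo[OF V]]])
qed

end

end

section \<open>Unique continuation for infinitesimal automorphisms\<close>

context manifold_dual_basis
begin

text \<open>The ideal of functions that is generated by the first jet of \<open>V\<close>. It is the calculus of "lower order
  terms" for the second order equation below.\<close>

inductive_set jet_ideal :: "'a vf \<Rightarrow> ('a \<Rightarrow> real) set" for V where
  jet0: "l \<in> I \<Longrightarrow> V (x l) \<in> jet_ideal V"
| jet1: "l \<in> I \<Longrightarrow> m \<in> I \<Longrightarrow> E m (V (x l)) \<in> jet_ideal V"
| jet_zero: "(\<lambda>p. 0) \<in> jet_ideal V"
| jet_add: "f \<in> jet_ideal V \<Longrightarrow> k \<in> jet_ideal V \<Longrightarrow> (\<lambda>p. f p + k p) \<in> jet_ideal V"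
| jet_mult: "h \<in> cinf A \<Longrightarrow> f \<in> jet_ideal V \<Longrightarrow> (\<lambda>p. h p * f p) \<in> jet_ideal V"

lemma jet_sum: "(\<And>i. i \<in> K \<Longrightarrow> f i \<in> jet_ideal V) \<Longrightarrow> (\<lambda>p. \<Sum>i\<in>K. f i p) \<in> jet_ideal V"
  by (induction K rule: infinite_finite_induct) (auto intro: jet_zero jet_add)

lemma jet_mult': "h \<in> cinf A \<Longrightarrow> f \<in> jet_ideal V \<Longrightarrow> (\<lambda>p. f p * h p) \<in> jet_ideal V"
  using jet_mult[of h f V] by (simp add: mult.commute)

lemma jet_diff: "f \<in> jet_ideal V \<Longrightarrow> k \<in> jet_ideal V \<Longrightarrow> (\<lambda>p. f p - k p) \<in> jet_ideal V"
  using jet_add[OF _ jet_mult[OF cinf_const[of "-1"]], of f V k] by simp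

definition in_jet_module :: "'a vf \<Rightarrow> 'a vf \<Rightarrow> bool" where
  "in_jet_module V W \<longleftrightarrow> W \<in> vfields A \<and> (\<forall>h\<in>cinf A. W h \<in> jet_ideal V)"

definition jet_energy :: "'a vf \<Rightarrow> 'a \<Rightarrow> real" where
  "jet_energy V p = (\<Sum>l\<in>I. (V (x l) p)\<^sup>2) + (\<Sum>(m, l)\<in>I \<times> I. (E m (V (x l)) p)\<^sup>2)"

definition flat_at :: "'a vf \<Rightarrow> 'a \<Rightarrow> bool" where
  "flat_at V p \<longleftrightarrow> (\<forall>h\<in>cinf A. V h p = 0) \<and> (\<forall>X\<in>vfields A. \<forall>h\<in>cinf A. X (V h) p = 0)"

context
  fixes V
  assumes V: "V \<in> vfields A"
begin

lemma jet_V: "h \<in> cinf A \<Longrightarrow> V h \<in> jet_ideal V"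
proof -
  assume h: "h \<in> cinf A"
  have "V h = (\<lambda>p. \<Sum>i\<in>I. V (x i) p * E i h p)" using tangent_expand[OF vf_tangent[OF V] h] by blast
  also have "\<dots> \<in> jet_ideal V" by (intro jet_sum jet_mult' jet0 vf_cinf[OF E_vfields])
  finally show ?thesis .
qed

lemma jet_XV:
  assumes X: "X \<in> vfields A" and h: "h \<in> cinf A"
  shows "X (V h) \<in> jet_ideal V"
proof -
  have base: "X (V (x i)) \<in> jet_ideal V" if "i \<in> I" for i
  proof -
    have "X (V (x i)) = (\<lambda>p. \<Sum>m\<in>I. X (x m) p * E m (V (x i)) p)"
      using tangent_expand[OF vf_tangent[OF X] vf_cinf[OF V]] by blast
    also have "\<dots> \<in> jet_ideal V" by (intro jet_sum jet_mult jet1 vf_cinf[OF X] that)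
    finally show ?thesis .
  qed
  have "V h = (\<lambda>p. \<Sum>i\<in>I. V (x i) p * E i h p)" using tangent_expand[OF vf_tangent[OF V] h] by blast
  then have "X (V h) p = (\<Sum>i\<in>I. X (V (x i)) p * E i h p + V (x i) p * X (E i h) p)" for p
    by (simp add: vf_sum[OF X] vf_mult[OF X] cinf_mult vf_cinf[OF V] vf_cinf[OF E_vfields])
  then have "X (V h) = (\<lambda>p. \<Sum>i\<in>I. X (V (x i)) p * E i h p + V (x i) p * X (E i h) p)" by blast
  also have "\<dots> \<in> jet_ideal V"
    by (intro jet_sum jet_add jet_mult' jet0 base vf_cinf[OF E_vfields] vf_cinf[OF X])
  finally show ?thesis .
qed

lemma in_jet_module_V: "in_jet_module V V"
  by (simp add: in_jet_module_def V jet_V)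

lemma in_jet_module_diff: "in_jet_module V W \<Longrightarrow> in_jet_module V W' \<Longrightarrow> in_jet_module V (W - W')"
  using jet_diff[of "W h" V "W' h" for h] vf_diff_vfields[of W W']
  by (simp add: in_jet_module_def fun_diff_def[of "W h" for h])

lemma in_jet_module_add: "in_jet_module V W \<Longrightarrow> in_jet_module V W' \<Longrightarrow> in_jet_module V (W + W')"
  using jet_add[of "W h" V "W' h" for h] vf_add_vfields[of W W']
  by (simp add: in_jet_module_def plus_fun_def[of "W h" for h])

lemma in_jet_module_sum:
  assumes "\<And>i. i \<in> K \<Longrightarrow> W i \<in> vfields A" "\<And>i h. i \<in> K \<Longrightarrow> h \<in> cinf A \<Longrightarrow> W i h \<in> jet_ideal V"
  shows "in_jet_module V (\<Sum>i\<in>K. W i)"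
proof -
  have "(\<Sum>i\<in>K. W i) h = (\<lambda>p. \<Sum>i\<in>K. W i h p)" for h by (simp add: fun_eq_iff sum_fun_apply)
  then show ?thesis using assms by (auto simp: in_jet_module_def intro!: vf_sum_vfields jet_sum)
qed

lemma in_jet_module_bracket:
  assumes Y: "Y \<in> vfields A"
  shows "in_jet_module V (vf_bracket V Y)"
  unfolding in_jet_module_def
proof (intro conjI ballI)
  fix h assume h: "h \<in> cinf A"
  have "vf_bracket V Y h = (\<lambda>p. V (Y h) p - Y (V h) p)" by (simp add: vf_bracket_def)
  also have "\<dots> \<in> jet_ideal V" by (intro jet_diff jet_V jet_XV Y h vf_cinf[OF Y])
  finally show "vf_bracket V Y h \<in> jet_ideal V" .
qed (intro vf_bracket_vfields V Y)

lemma in_jet_module_endo: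
  assumes T: "endo T" and W: "in_jet_module V W"
  shows "in_jet_module V (T W)"
  unfolding in_jet_module_def
proof (intro conjI ballI)
  have WA: "W \<in> vfields A" using W by (simp add: in_jet_module_def)
  show "T W \<in> vfields A" by (rule endo_vfields[OF T WA])
  fix h assume h: "h \<in> cinf A"
  have "T W h = (\<lambda>p. \<Sum>i\<in>I. W (x i) p * T (E i) h p)" using endo_expand[OF T WA h] by blast
  also have "\<dots> \<in> jet_ideal V"
    using W x_cinf unfolding in_jet_module_def
    by (intro jet_sum jet_mult' vf_cinf[OF endo_vfields[OF T E_vfields]]) auto
  finally show "T W h \<in> jet_ideal V" .
qed

end

end

context manifold_connection
begin

lemma conn_expand:
  assumes "X \<in> vfields A" "W \<in> vfields A"
  shows "N X W = (\<Sum>i\<in>I. vf_scale (X (W (x i))) (E i) + vf_scale (W (x i)) (N X (E i)))"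
proof -
  have "N X W = N X (\<Sum>i\<in>I. vf_scale (W (x i)) (E i))" using vf_expand[OF assms(2)] by simp
  also have "\<dots> = (\<Sum>i\<in>I. N X (vf_scale (W (x i)) (E i)))"
    by (rule conn_sum[OF assms(1)]) (rule vf_scale_vfields[OF vf_cinf[OF assms(2)] E_vfields])
  also have "\<dots> = (\<Sum>i\<in>I. vf_scale (X (W (x i))) (E i) + vf_scale (W (x i)) (N X (E i)))"
    by (intro sum.cong refl conn_scale assms(1) E_vfields vf_cinf[OF assms(2)])
  finally show ?thesis .
qed

text \<open>Covariant and ordinary derivatives differ by terms of order zero.\<close>

lemma jet_X_of_module:
  assumes V: "V \<in> vfields A" and X: "X \<in> vfields A" and W: "in_jet_module V W"
    and XW: "in_jet_module V (N X W)" and h: "h \<in> cinf A"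
  shows "X (W h) \<in> jet_ideal V"
proof -
  have WA: "W \<in> vfields A" and Wx: "\<And>i. i \<in> I \<Longrightarrow> W (x i) \<in> jet_ideal V"
    using W x_cinf by (auto simp: in_jet_module_def)
  have "W h = (\<lambda>p. \<Sum>i\<in>I. W (x i) p * E i h p)" using tangent_expand[OF vf_tangent[OF WA] h] by blast
  then have "X (W h) p = (\<Sum>i\<in>I. X (W (x i)) p * E i h p + W (x i) p * X (E i h) p)" for p
    by (simp add: vf_sum[OF X] vf_mult[OF X] cinf_mult vf_cinf[OF WA] vf_cinf[OF E_vfields])
  moreover have "N X W h p = (\<Sum>i\<in>I. X (W (x i)) p * E i h p + W (x i) p * N X (E i) h p)" for p
    using conn_expand[OF X WA] by (simp add: sum_fun_apply)
  ultimately have "X (W h) = (\<lambda>p. (N X W h p - (\<Sum>i\<in>I. W (x i) p * N X (E i) h p)) + (\<Sum>i\<in>I. W (x i) p * X (E i h) p))"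
    by (simp add: fun_eq_iff sum.distrib)
  also have "\<dots> \<in> jet_ideal V"
    using XW h by (intro jet_add jet_diff jet_sum jet_mult' Wx vf_cinf[OF X] vf_cinf[OF conn_vfields[OF X E_vfields]])
      (auto simp: in_jet_module_def)
  finally show ?thesis .
qed

end

context almost_kaehler
begin

context
  fixes V
  assumes V: "V \<in> vfields A"
    and V_J: "\<And>X. X \<in> vfields A \<Longrightarrow> vf_bracket V (J X) = J (vf_bracket V X)"
    and V_omega: "\<And>X Y p. X \<in> vfields A \<Longrightarrow> Y \<in> vfields A \<Longrightarrow>
      V (\<omega> [X, Y]) p = \<omega> [vf_bracket V X, Y] p + \<omega> [X, vf_bracket V Y] p"
begin

interpretation Dm: manifold_connection A I x E D
  by unfold_locales

text \<open>A Killing field satisfies a linear differential equation of second order: applying \<open>L\<^sub>V D = 0\<close> to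
  \<open>D\<^sub>Y V = D\<^sub>V Y - [V, Y]\<close> gives \<open>D\<^sub>X D\<^sub>Y V = D\<^sub>X D\<^sub>V Y + D\<^bsub>[V,X]\<^esub> Y - [V, D\<^sub>X Y]\<close>, whose right-hand side contains only first
  derivatives of \<open>V\<close>.\<close>

lemma jet_XYV:
  assumes X: "X \<in> vfields A" and Y: "Y \<in> vfields A" and h: "h \<in> cinf A"
  shows "X (Y (V h)) \<in> jet_ideal V"
proof -
  let ?W = "D V Y - vf_bracket V Y"
  have VE: "D (E i) Y \<in> vfields A" if "i \<in> I" for i using E_vfields[OF that] Y by (rule D.conn_vfields)
  have DV: "D V Y = (\<Sum>i\<in>I. vf_scale (V (x i)) (D (E i) Y))"
  proof (rule vf_eqI)
    show "D V Y h p = (\<Sum>i\<in>I. vf_scale (V (x i)) (D (E i) Y)) h p" if "h \<in> cinf A" for h p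
      using endo_expand[OF D.conn_endo[OF Y] V that, of p] by (simp add: sum_fun_apply)
  qed (auto intro!: vf_sum_vfields vf_scale_vfields VE vf_cinf[OF V] D.conn_vfields V Y)
  have "D X (D V Y) = (\<Sum>i\<in>I. D X (vf_scale (V (x i)) (D (E i) Y)))"
    unfolding DV by (rule D.conn_sum[OF X]) (rule vf_scale_vfields[OF vf_cinf[OF V] VE])
  also have "\<dots> = (\<Sum>i\<in>I. vf_scale (X (V (x i))) (D (E i) Y) + vf_scale (V (x i)) (D X (D (E i) Y)))"
    by (intro sum.cong refl D.conn_scale X VE vf_cinf[OF V])
  finally have DDV: "D X (D V Y) = \<dots>" .
  have low1: "in_jet_module V (D X (D V Y))"
    unfolding DDV
  proof (rule in_jet_module_sum)
    fix i assume i: "i \<in> I"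
    note DD = D.conn_vfields[OF X VE[OF i]]
    show "vf_scale (X (V (x i))) (D (E i) Y) + vf_scale (V (x i)) (D X (D (E i) Y)) \<in> vfields A"
      by (intro vfields_intros vf_cinf[OF X] vf_cinf[OF V] VE i DD)
    fix h assume "h \<in> cinf A"
    have "(\<lambda>p. X (V (x i)) p * D (E i) Y h p + V (x i) p * D X (D (E i) Y) h p) \<in> jet_ideal V"
      by (intro jet_add jet_mult' jet_XV[OF V X] jet0 x_cinf i vf_cinf[OF VE] vf_cinf[OF DD])
    then show "(vf_scale (X (V (x i))) (D (E i) Y) + vf_scale (V (x i)) (D X (D (E i) Y))) h \<in> jet_ideal V"
      by (simp add: plus_fun_def times_fun_def)
  qed (rule V)
  have low2: "in_jet_module V (D V Y)" by (rule in_jet_module_endo[OF V D.conn_endo[OF Y] in_jet_module_V[OF V]])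
  have low3: "in_jet_module V ?W" by (rule in_jet_module_diff[OF V low2 in_jet_module_bracket[OF V Y]])
  have DW: "D X ?W = D X (D V Y) + D (vf_bracket V X) Y - vf_bracket V (D X Y)"
  proof -
    have "D X ?W = D X (D V Y) - D X (vf_bracket V Y)"
      by (intro D.conn_diff X D.conn_vfields V Y vf_bracket_vfields)
    moreover have "vf_bracket V (D X Y) = D (vf_bracket V X) Y + D X (vf_bracket V Y)"
      by (rule V_D[OF V V_J V_omega X Y])
    ultimately show ?thesis by (simp only: add_diff_cancel_left diff_diff_eq2 add_diff_eq algebra_simps) simp
  qed
  have low4: "in_jet_module V (D X ?W)"
    unfolding DW
    by (intro in_jet_module_diff in_jet_module_add low1 in_jet_module_bracket D.conn_vfields X Y V
        in_jet_module_endo[OF V D.conn_endo[OF Y]])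
  have "Y (V h) = (\<lambda>p. (?W h p + V (Y h) p) - D V Y h p)"
    by (simp add: fun_eq_iff vf_bracket_fun)
  moreover have "X (\<lambda>p. (w p + v p) - d p) = (\<lambda>p. (X w p + X v p) - X d p)"
    if "w \<in> cinf A" "v \<in> cinf A" "d \<in> cinf A" for w v d
    using that by (simp add: fun_eq_iff vf_diff[OF X] vf_add[OF X] cinf_add)
  moreover have "?W h \<in> cinf A" "V (Y h) \<in> cinf A" "D V Y h \<in> cinf A"
    by (rule vf_cinf[OF vf_diff_vfields[OF D.conn_vfields[OF V Y] vf_bracket_vfields[OF V Y]]]
        vf_cinf[OF V] vf_cinf[OF D.conn_vfields[OF V Y]])+
  ultimately have "X (Y (V h)) = (\<lambda>p. (X (?W h) p + X (V (Y h)) p) - X (D V Y h) p)"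
    by metis
  also have "\<dots> \<in> jet_ideal V"
    by (intro jet_diff jet_add Dm.jet_X_of_module[OF V X low3 low4 h] jet_XV[OF V X vf_cinf[OF Y]]
        Dm.jet_X_of_module[OF V X low2 low1 h])
  finally show ?thesis .
qed

context
  assumes compact: "compact (UNIV :: 'a set)"
begin

lemma cinf_bounded:
  assumes "h \<in> cinf A"
  obtains M where "M \<ge> 0" "\<And>p. \<bar>h p\<bar> \<le> M"
proof -
  have "bounded (range h)"
    by (rule compact_imp_bounded[OF compact_continuous_image[OF cinf_continuous[OF assms] compact]])
  then obtain M where "\<And>p. \<bar>h p\<bar> \<le> M" by (auto simp: bounded_iff)
  then show ?thesis using that[of M] by (meson abs_ge_zero order_trans)
qed

lemma jet_bound:
  assumes "k \<in> jet_ideal V"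
  shows "\<exists>C\<ge>0. \<forall>p. \<bar>k p\<bar> \<le> C * sqrt (jet_energy V p)"
  using assms
proof induction
  case (jet0 l)
  have "(V (x l) p)\<^sup>2 \<le> jet_energy V p" for p
    unfolding jet_energy_def using member_le_sum[OF jet0 _ finite_I, of "\<lambda>l. (V (x l) p)\<^sup>2"]
    by (auto intro!: add_increasing2 sum_nonneg)
  then show ?case by (intro exI[of _ 1]) (simp add: real_le_rsqrt)
next
  case (jet1 l m)
  have "(E m (V (x l)) p)\<^sup>2 \<le> jet_energy V p" for p
    unfolding jet_energy_def
    using member_le_sum[of "(m, l)" "I \<times> I" "\<lambda>(m, l). (E m (V (x l)) p)\<^sup>2"] jet1 finite_I
    by (auto intro!: add_increasing sum_nonneg)
  then show ?case by (intro exI[of _ 1]) (simp add: real_le_rsqrt)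
next
  case jet_zero
  show ?case by (intro exI[of _ 0]) simp
next
  case (jet_add f k)
  then obtain C C' where "C \<ge> 0" "C' \<ge> 0" "\<And>p. \<bar>f p\<bar> \<le> C * sqrt (jet_energy V p)"
    "\<And>p. \<bar>k p\<bar> \<le> C' * sqrt (jet_energy V p)" by blast
  then show ?case
    by (intro exI[of _ "C + C'"]) (auto simp: distrib_right intro: order_trans[OF abs_triangle_ineq add_mono])
next
  case (jet_mult h f)
  then obtain C where C: "C \<ge> 0" "\<And>p. \<bar>f p\<bar> \<le> C * sqrt (jet_energy V p)" by blast
  obtain M where M: "M \<ge> 0" "\<And>p. \<bar>h p\<bar> \<le> M" using cinf_bounded[OF jet_mult(1)] by blast
  have "\<bar>h p * f p\<bar> \<le> M * (C * sqrt (jet_energy V p))" for p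
    unfolding abs_mult by (rule mult_mono[OF M(2) C(2) M(1)]) simp
  then show ?case using C M by (intro exI[of _ "M * C"]) (simp add: mult.assoc)
qed

lemma jet_energy_nonneg: "jet_energy V p \<ge> 0"
  by (auto simp: jet_energy_def intro!: add_nonneg_nonneg sum_nonneg)

lemma flat_iff_energy: "flat_at V p \<longleftrightarrow> jet_energy V p = 0"
proof
  assume "flat_at V p"
  then show "jet_energy V p = 0"
    by (auto simp: flat_at_def jet_energy_def x_cinf E_vfields intro!: sum.neutral)
next
  assume e: "jet_energy V p = 0"
  have "k p = 0" if "k \<in> jet_ideal V" for k
    using jet_bound[OF that] e by (metis abs_le_zero_iff mult_zero_right real_sqrt_zero)
  then show "flat_at V p" using jet_V[OF V] jet_XV[OF V] by (auto simp: flat_at_def)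
qed

lemma jet_energy_derivative:
  assumes X: "X \<in> vfields A"
  shows "jet_energy V \<in> cinf A" "\<exists>C. \<forall>p. \<bar>X (jet_energy V) p\<bar> \<le> C * jet_energy V p"
proof -
  define z where "z = case_sum (\<lambda>l. V (x l)) (\<lambda>(m, l). E m (V (x l)))"
  let ?K = "I <+> (I \<times> I)"
  have zA: "z k \<in> cinf A" "z k \<in> jet_ideal V" "X (z k) \<in> jet_ideal V" if "k \<in> ?K" for k
    using that by (auto simp: z_def vf_cinf[OF V] vf_cinf[OF E_vfields] jet0 jet1 jet_XV[OF V X] x_cinf
        jet_XYV[OF X E_vfields])
  have e: "jet_energy V = (\<lambda>p. \<Sum>k\<in>?K. z k p * z k p)"
    using finite_I by (simp add: fun_eq_iff jet_energy_def z_def sum.Plus power2_eq_square split_beta)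
  show "jet_energy V \<in> cinf A" unfolding e by (intro cinf_sum cinf_mult zA)
  have "\<exists>C. C \<ge> 0 \<and> (\<forall>p. \<bar>z k p * X (z k) p\<bar> \<le> C * jet_energy V p)" if k: "k \<in> ?K" for k
  proof -
    obtain C C' where C: "C \<ge> 0" "C' \<ge> 0" "\<And>p. \<bar>z k p\<bar> \<le> C * sqrt (jet_energy V p)"
      "\<And>p. \<bar>X (z k) p\<bar> \<le> C' * sqrt (jet_energy V p)"
      using jet_bound[OF zA(2)[OF k]] jet_bound[OF zA(3)[OF k]] by blast
    have "\<bar>z k p * X (z k) p\<bar> \<le> (C * C') * jet_energy V p" for p
    proof -
      have "\<bar>z k p * X (z k) p\<bar> \<le> (C * sqrt (jet_energy V p)) * (C' * sqrt (jet_energy V p))"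
        unfolding abs_mult by (rule mult_mono[OF C(3,4)]) (use C(1) jet_energy_nonneg in auto)
      also have "\<dots> = (C * C') * jet_energy V p" using jet_energy_nonneg[of p] by simp
      finally show ?thesis .
    qed
    then show ?thesis using C(1,2) by (intro exI[of _ "C * C'"]) auto
  qed
  then obtain C where C: "\<And>k p. k \<in> ?K \<Longrightarrow> \<bar>z k p * X (z k) p\<bar> \<le> C k * jet_energy V p" by metis
  have "\<bar>X (jet_energy V) p\<bar> \<le> (2 * (\<Sum>k\<in>?K. C k)) * jet_energy V p" for p
  proof -
    have "X (jet_energy V) p = (\<Sum>k\<in>?K. 2 * (z k p * X (z k) p))"
      unfolding e by (simp add: vf_sum[OF X] vf_mult[OF X] cinf_mult zA(1))
    also have "\<bar>\<dots>\<bar> \<le> (\<Sum>k\<in>?K. 2 * (C k * jet_energy V p))"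
      by (rule order_trans[OF sum_abs sum_mono]) (use C in \<open>simp add: abs_mult\<close>)
    also have "\<dots> = (2 * (\<Sum>k\<in>?K. C k)) * jet_energy V p"
      by (simp add: sum_distrib_left sum_distrib_right mult.assoc)
    finally show ?thesis .
  qed
  then show "\<exists>C. \<forall>p. \<bar>X (jet_energy V) p\<bar> \<le> C * jet_energy V p" by blast
qed

text \<open>By the second order equation the derivative of the energy of the first jet is bounded by a multiple of the
  energy. Gronwall's inequality, in both directions along the curve, propagates its vanishing.\<close>

lemma flat_along_curve:
  assumes X: "X \<in> vfields A"
    and \<gamma>: "\<And>s f. s \<in> {0..1} \<Longrightarrow> f \<in> cinf A \<Longrightarrow> ((\<lambda>s. f (\<gamma> s)) has_real_derivative X f (\<gamma> s)) (at s)"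
  shows "flat_at V (\<gamma> 0) \<longleftrightarrow> flat_at V (\<gamma> 1)"
proof -
  obtain C where C: "\<And>p. \<bar>X (jet_energy V) p\<bar> \<le> C * jet_energy V p" using jet_energy_derivative(2)[OF X] by blast
  let ?e = "\<lambda>s. jet_energy V (\<gamma> s)"
  have de: "(?e has_real_derivative X (jet_energy V) (\<gamma> s)) (at s)" if "s \<in> {0..1}" for s
    by (rule \<gamma>[OF that jet_energy_derivative(1)[OF X]])
  have "?e 1 * exp (- C * 1) \<le> ?e 0 * exp (- C * 0)"
  proof (rule DERIV_nonpos_imp_nonincreasing[of 0 1 "\<lambda>s. ?e s * exp (- C * s)"])
    fix s :: real assume s: "0 \<le> s" "s \<le> 1"
    have "((\<lambda>s. ?e s * exp (- C * s)) has_real_derivative (X (jet_energy V) (\<gamma> s) - C * ?e s) * exp (- C * s)) (at s)"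
      using s by (auto intro!: derivative_eq_intros de simp: algebra_simps)
    moreover have "(X (jet_energy V) (\<gamma> s) - C * ?e s) * exp (- C * s) \<le> 0"
      using C[of "\<gamma> s"] by (simp add: mult_le_0_iff)
    ultimately show "\<exists>y. ((\<lambda>s. ?e s * exp (- C * s)) has_real_derivative y) (at s) \<and> y \<le> 0" by blast
  qed simp
  moreover have "?e 0 * exp (C * 0) \<le> ?e 1 * exp (C * 1)"
  proof (rule DERIV_nonneg_imp_nondecreasing[of 0 1 "\<lambda>s. ?e s * exp (C * s)"])
    fix s :: real assume s: "0 \<le> s" "s \<le> 1"
    have "((\<lambda>s. ?e s * exp (C * s)) has_real_derivative (X (jet_energy V) (\<gamma> s) + C * ?e s) * exp (C * s)) (at s)"
      using s by (auto intro!: derivative_eq_intros de simp: algebra_simps)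
    moreover have "(X (jet_energy V) (\<gamma> s) + C * ?e s) * exp (C * s) \<ge> 0"
      using C[of "\<gamma> s"] by (intro mult_nonneg_nonneg) auto
    ultimately show "\<exists>y. ((\<lambda>s. ?e s * exp (C * s)) has_real_derivative y) (at s) \<and> y \<ge> 0" by blast
  qed simp
  ultimately show ?thesis
    using jet_energy_nonneg[of "\<gamma> 0"] jet_energy_nonneg[of "\<gamma> 1"]
    by (auto simp: flat_iff_energy mult_le_0_iff)
qed

end

end

end

section \<open>The action of the group\<close>

lemma (in manifold) velocity_exists:
  assumes W: "(W, \<psi>) \<in> A" "a \<in> W" and \<delta>: "tangent_at a \<delta>"
  obtains w where "\<And>k. k \<in> cinf A \<Longrightarrow> \<delta> k = dir_deriv (\<lambda>b. k (inv_into W \<psi> b)) w (\<psi> a)"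
proof -
  obtain \<eta> M where cut: "chart_cutoff (W, \<psi>) \<eta> M" and a: "a \<in> M" by (rule chart_cutoff_in[OF W])
  let ?w = "\<Sum>b\<in>Basis. \<delta> (coord_fun (W, \<psi>) \<eta> b) *\<^sub>R b"
  show ?thesis
  proof (rule that[of ?w])
    fix k assume k: "k \<in> cinf A"
    have lin: "linear (frechet_derivative (\<lambda>y. k (inv_into W \<psi> y)) (at (\<psi> a)))"
      by (rule has_derivative_linear[OF chart_rep_derivative[OF cut k W(2)]])
    have "\<delta> k = (\<Sum>b\<in>Basis. \<delta> (coord_fun (W, \<psi>) \<eta> b) * dir_deriv (\<lambda>y. k (inv_into W \<psi> y)) b (\<psi> a))"
      using tangent_expand_coord[OF cut a \<delta> k] by (simp add: coord_field_eq[OF cut a k])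
    then show "\<delta> k = dir_deriv (\<lambda>b. k (inv_into W \<psi> b)) ?w (\<psi> a)"
      by (simp add: linear_sum[OF lin] linear_scale[OF lin])
  qed
qed

locale hamiltonian_action = almost_kaehler A I x E D \<omega> J + B: manifold B
  for A :: "('a::{t2_space,second_countable_topology}, 'e::euclidean_space) atlas"
    and I :: "'i set" and x E D \<omega> J
    and B :: "('g::{t2_space,second_countable_topology}, 'k::euclidean_space) atlas" +
  fixes mul :: "'g \<Rightarrow> 'g \<Rightarrow> 'g" and one :: 'g and iv :: "'g \<Rightarrow> 'g" and act :: "'g \<Rightarrow> 'a \<Rightarrow> 'a"
    and \<xi> :: "'g vf" and V :: "'a vf" and f :: "'a \<Rightarrow> real"
  assumes subgroup: "lie_subgroup_of_Ham A \<omega> B mul one iv act"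
    and J_AK: "J \<in> AK A \<omega> (range act)"
    and xi: "\<xi> \<in> lie_algebra B mul"
    and V_eq: "V = fundamental_vf A one act \<xi>"
    and ham: "hamiltonian_vf A \<omega> f V"
begin

lemma group: "Groups.group mul one iv" and act_Ham: "act a \<in> Ham A \<omega>" and act_one: "act one = id"
  and act_mul: "act (mul a b) = act a \<circ> act b" and act_smooth: "smooth_map (prod_atlas B A) A (\<lambda>(a, p). act a p)"
  using subgroup by (auto simp: lie_subgroup_of_Ham_def lie_group_def)

interpretation G: Groups.group mul one iv by (rule group)

lemma act_family: "(W, \<psi>) \<in> B \<Longrightarrow> h \<in> cinf A \<Longrightarrow> smooth_family (\<psi> ` W) (\<lambda>b q. h (act (inv_into W \<psi> b) q))"
  using smooth_family_map[OF B.manifold_axioms act_smooth] by simp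

lemma act_cinf: "h \<in> cinf A \<Longrightarrow> (\<lambda>q. h (act a q)) \<in> cinf A"
proof -
  assume h: "h \<in> cinf A"
  obtain W \<psi> where W: "(W, \<psi>) \<in> B" "a \<in> W" by (rule B.chart_at)
  have "\<psi> a \<in> \<psi> ` W" using W by auto
  from family_cinf[OF B.chart_image[OF W(1)] act_family[OF W(1) h] this] W show ?thesis by simp
qed

lemma orbit_cinf: "h \<in> cinf A \<Longrightarrow> (\<lambda>a. h (act a q)) \<in> cinf B"
  by (rule B.cinfI) (rule family_parameter[OF B.chart_image act_family])

lemma act_iv: "act (iv a) \<circ> act a = id" "act a \<circ> act (iv a) = id"
  by (simp_all add: act_mul[symmetric] act_one)

lemma act_diffeo: "diffeo A (act a)"
proof
  show b: "bij (act a)" by (rule o_bij[OF act_iv])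
  have i: "inv (act a) = act (iv a)" using inv_unique_comp[OF act_iv(2,1)] .
  show "h \<circ> act a \<in> cinf A" "h \<circ> inv (act a) \<in> cinf A" if "h \<in> cinf A" for h
    using act_cinf[OF that] unfolding i o_def by auto
qed

lemma xi_vfields: "\<xi> \<in> vfields B"
  using xi by (simp add: lie_algebra_def)

lemma V_apply: "h \<in> cinf A \<Longrightarrow> V h q = \<xi> (\<lambda>a. h (act a q)) one"
  by (simp add: V_eq fundamental_vf_def)

lemma xi_left_invariant: "\<xi> k a = \<xi> (\<lambda>b. k (mul a b)) one"
proof -
  have inj: "inj (mul a)"
    by (rule injI) (metis G.assoc G.left_inverse G.group_left_neutral)
  have "\<xi> k a = vf_push (mul a) \<xi> k (mul a one)" using xi by (simp add: lie_algebra_def)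
  also have "\<dots> = \<xi> (k \<circ> mul a) one" by (simp only: vf_push_def o_apply inv_f_f[OF inj])
  finally show ?thesis by (simp add: o_def)
qed

lemma xi_orbit: "h \<in> cinf A \<Longrightarrow> \<xi> (\<lambda>a. h (act a q)) a = V (\<lambda>q. h (act a q)) q"
  by (subst xi_left_invariant) (simp add: V_apply[OF act_cinf] act_mul)

text \<open>\<open>w\<close> represents \<open>\<xi>\<close> at \<open>a\<close> in the chart; along this direction the action differentiates to \<open>V\<close>.\<close>

definition velocity :: "'g set \<Rightarrow> ('g \<Rightarrow> 'k) \<Rightarrow> 'g \<Rightarrow> 'k \<Rightarrow> bool" where
  "velocity W \<psi> a w \<longleftrightarrow> (W, \<psi>) \<in> B \<and> a \<in> W \<and>
     (\<forall>k\<in>cinf B. \<xi> k a = dir_deriv (\<lambda>b. k (inv_into W \<psi> b)) w (\<psi> a))"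

lemma velocity_at:
  obtains W \<psi> w where "velocity W \<psi> a w"
proof -
  obtain W \<psi> where W: "(W, \<psi>) \<in> B" "a \<in> W" by (rule B.chart_at)
  from B.velocity_exists[OF W B.vf_tangent[OF xi_vfields]] obtain w
    where "\<And>k. k \<in> cinf B \<Longrightarrow> \<xi> k a = dir_deriv (\<lambda>b. k (inv_into W \<psi> b)) w (\<psi> a)" by blast
  then show ?thesis using W that unfolding velocity_def by blast
qed

lemma velocity_action:
  assumes "velocity W \<psi> a w" "h \<in> cinf A"
  shows "dir_deriv (\<lambda>b. h (act (inv_into W \<psi> b) q)) w (\<psi> a) = V (\<lambda>q. h (act a q)) q"
proof -
  have "\<forall>k\<in>cinf B. \<xi> k a = dir_deriv (\<lambda>b. k (inv_into W \<psi> b)) w (\<psi> a)"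
    using assms(1) by (simp add: velocity_def)
  from bspec[OF this orbit_cinf[OF assms(2), of q]] xi_orbit[OF assms(2), of q a] show ?thesis by simp
qed

lemma V_vfields: "V \<in> vfields A" and f_cinf: "f \<in> cinf A"
  using ham by (auto simp: hamiltonian_vf_def)

lemma V_omega: "Y \<in> vfields A \<Longrightarrow> Z \<in> vfields A \<Longrightarrow>
    V (\<omega> [Y, Z]) p = \<omega> [vf_bracket V Y, Z] p + \<omega> [Y, vf_bracket V Z] p"
  by (rule hamiltonian_preserves[OF omega_closed ham])

lemma push_J: "X \<in> vfields A \<Longrightarrow> J (vf_push (act a) X) = vf_push (act a) (J X)"
  using J_AK by (simp add: AK_def)

lemma push_omega: "X \<in> vfields A \<Longrightarrow> Y \<in> vfields A \<Longrightarrow>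
    \<omega> [vf_push (act a) X, vf_push (act a) Y] (act a p) = \<omega> [X, Y] p"
  by (rule Ham_preserves[OF omega_closed act_Ham _ _ act_diffeo])

text \<open>The invariance of \<open>J\<close> under the group, differentiated at the unit.\<close>

lemma V_J:
  assumes X: "X \<in> vfields A"
  shows "vf_bracket V (J X) = J (vf_bracket V X)"
proof (rule vf_eqI)
  show "vf_bracket V (J X) \<in> vfields A" "J (vf_bracket V X) \<in> vfields A"
    by (intro vfields_intros J_vfields V_vfields X)+
  fix h p assume h: "h \<in> cinf A"
  obtain W \<psi> w where w: "velocity W \<psi> one w" by (rule velocity_at)
  then have W: "(W, \<psi>) \<in> B" "one \<in> W" by (auto simp: velocity_def)
  note S = B.chart_image[OF W(1)] and fam = act_family[OF W(1)]
  have b0: "\<psi> one \<in> \<psi> ` W" using W(2) by auto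
  have b00: "\<psi> one + 0 *\<^sub>R w \<in> \<psi> ` W" using b0 by simp
  let ?act = "\<lambda>t. act (inv_into W \<psi> (\<psi> one + t *\<^sub>R w))"
  have act0: "?act 0 q = q" for q using W by (simp add: act_one)
  have der_h: "((\<lambda>t. k (?act t p)) has_real_derivative V k p) (at 0)" if "k \<in> cinf A" for k
    using family_line_derivative[OF S fam[OF that] b00, of p] velocity_action[OF w that, of p]
    by (simp add: act_one)
  have der_X: "((\<lambda>t. Y (\<lambda>q. k (?act t q)) p) has_real_derivative Y (V k) p) (at 0)"
    if "k \<in> cinf A" "Y \<in> vfields A" for k Y
    using family_line_derivative[OF S family_vf[OF S fam[OF that(1)] that(2)] b00, of p]
      family_vf_deriv[OF S fam[OF that(1)] that(2) b0, of p w] velocity_action[OF w that(1)]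
    by (simp add: act_one)
  have eq: "J X (\<lambda>q. h (act a q)) p = (\<Sum>i\<in>I. X (\<lambda>q. x i (act a q)) p * J (E i) h (act a p))" for a
  proof -
    interpret d: diffeo A "act a" by (rule act_diffeo)
    have "J X (h \<circ> act a) p = J (vf_push (act a) X) h (act a p)" by (simp add: push_J[OF X])
    also have "\<dots> = (\<Sum>i\<in>I. vf_push (act a) X (x i) (act a p) * J (E i) h (act a p))"
      by (rule endo_expand[OF J_endo d.push_vfields[OF X] h])
    finally show ?thesis by (simp add: o_def)
  qed
  have "((\<lambda>t. J X (\<lambda>q. h (?act t q)) p) has_real_derivative
      (\<Sum>i\<in>I. X (V (x i)) p * J (E i) h p + X (x i) p * V (J (E i) h) p)) (at 0)"
    unfolding eq
  proof (rule DERIV_sum)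
    fix i assume i: "i \<in> I"
    note JE = vf_cinf[OF J_vfields[OF E_vfields[OF i]]]
    show "((\<lambda>t. X (\<lambda>q. x i (?act t q)) p * J (E i) h (?act t p)) has_real_derivative
        X (V (x i)) p * J (E i) h p + X (x i) p * V (J (E i) h) p) (at 0)"
      by (rule DERIV_cong[OF DERIV_mult[OF der_X[OF x_cinf[OF i] X] der_h[OF JE]]])
        (simp add: act0[simplified] act_one W)
  qed
  then have "J X (V h) p = (\<Sum>i\<in>I. X (V (x i)) p * J (E i) h p + X (x i) p * V (J (E i) h) p)"
    by (rule DERIV_unique[OF der_X[OF h J_vfields[OF X]]])
  moreover have "V (J X h) p = (\<Sum>i\<in>I. V (X (x i)) p * J (E i) h p + X (x i) p * V (J (E i) h) p)"
  proof -
    have "J X h = (\<lambda>q. \<Sum>i\<in>I. X (x i) q * J (E i) h q)" using endo_expand[OF J_endo X h] by blast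
    then show ?thesis
      by (simp add: vf_sum[OF V_vfields] vf_mult[OF V_vfields] cinf_mult vf_cinf[OF X]
          vf_cinf[OF J_vfields[OF E_vfields]])
  qed
  moreover have "J (vf_bracket V X) h p = (\<Sum>i\<in>I. (V (X (x i)) p - X (V (x i)) p) * J (E i) h p)"
    using endo_expand[OF J_endo vf_bracket_vfields[OF V_vfields X] h, of p] by (simp add: vf_bracket_fun)
  ultimately show "vf_bracket V (J X) h p = J (vf_bracket V X) h p"
    by (simp add: vf_bracket_fun sum.distrib sum_subtractf algebra_simps)
qed

section \<open>Primitives of the Chern--Ricci form and the moment map\<close>

context
  fixes \<alpha> :: "'a form" and lam :: real
  assumes \<alpha>: "is_form A 1 \<alpha>"
    and primitive: "\<And>X Y p. X \<in> vfields A \<Longrightarrow> Y \<in> vfields A \<Longrightarrow>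
      rho X Y p = lam * \<omega> [X, Y] p + ext_deriv A \<alpha> [X, Y] p"
begin

text \<open>A moment map of \<open>V\<close> with respect to the exact form \<open>rho - lam \<omega>\<close>.\<close>

definition u :: "'a \<Rightarrow> real" where "u = (\<lambda>p. mu V p - lam * f p)"

text \<open>The contraction of \<open>V\<close> with the pull-back of \<open>\<alpha>\<close> under \<open>a\<close>; the latter is \<open>\<Sum>\<^sub>i (\<alpha>(E\<^sub>i) \<circ> a) d(x\<^sub>i \<circ> a)\<close>.\<close>

definition transported :: "'g \<Rightarrow> 'a \<Rightarrow> real" where
  "transported a = (\<lambda>q. \<Sum>i\<in>I. \<alpha> [E i] (act a q) * V (\<lambda>q. x i (act a q)) q)"

lemma \<alpha>_cinf: "i \<in> I \<Longrightarrow> \<alpha> [E i] \<in> cinf A"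
  by (rule covector_cinf[OF form1_covector[OF \<alpha>] E_vfields])

lemma u_cinf: "u \<in> cinf A"
  unfolding u_def by (intro cinf_diff cinf_cmult mu_cinf[OF V_vfields V_J V_omega] f_cinf)

lemma u_derivative:
  assumes Y: "Y \<in> vfields A"
  shows "Y u p = - ext_deriv A \<alpha> [V, Y] p"
proof -
  have "Y u p = Y (mu V) p - lam * Y f p"
    unfolding u_def by (simp add: vf_diff[OF Y] vf_cmult[OF Y] cinf_cmult mu_cinf[OF V_vfields V_J V_omega] f_cinf)
  also have "Y (mu V) p = - rho V Y p" by (rule mu_derivative[OF V_vfields V_J V_omega Y])
  finally show ?thesis using primitive[OF V_vfields Y, of p] omega_ham[OF ham Y] by simp
qed

lemma ext_deriv_expand:
  assumes X: "X \<in> vfields A" and Y: "Y \<in> vfields A"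
  shows "ext_deriv A \<alpha> [X, Y] p = (\<Sum>i\<in>I. X (\<alpha> [E i]) p * Y (x i) p - Y (\<alpha> [E i]) p * X (x i) p)"
proof -
  note c = form1_covector[OF \<alpha>]
  have exp: "\<alpha> [Z] = (\<lambda>q. \<Sum>i\<in>I. Z (x i) q * \<alpha> [E i] q)" if "Z \<in> vfields A" for Z
    using covector_expand[OF c that] by blast
  have der: "Z (\<alpha> [Z']) p = (\<Sum>i\<in>I. Z (Z' (x i)) p * \<alpha> [E i] p + Z' (x i) p * Z (\<alpha> [E i]) p)"
    if "Z \<in> vfields A" "Z' \<in> vfields A" for Z Z'
    unfolding exp[OF that(2)]
    by (simp add: vf_sum[OF that(1)] vf_mult[OF that(1)] cinf_mult vf_cinf[OF that(2)] \<alpha>_cinf)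
  show ?thesis
    using ext_deriv_one_form[OF X Y, of \<alpha> p] der[OF X Y] der[OF Y X]
      covector_expand[OF c vf_bracket_vfields[OF X Y], of p]
    by (simp add: vf_bracket_fun sum.distrib sum_subtractf algebra_simps)
qed

lemma ext_deriv_push:
  assumes X: "X \<in> vfields A" and Y: "Y \<in> vfields A"
  shows "ext_deriv A \<alpha> [vf_push (act a) X, vf_push (act a) Y] (act a p) = ext_deriv A \<alpha> [X, Y] p"
proof -
  interpret d: diffeo A "act a" by (rule act_diffeo)
  show ?thesis
    using primitive[OF X Y, of p] primitive[OF d.push_vfields[OF X] d.push_vfields[OF Y], of "act a p"]
      push_rho[OF act_diffeo push_J push_omega X Y, of a p] push_omega[OF X Y, of a p] by simp
qed

text \<open>Differentiation along straight lines in charts that represent \<open>\<xi>\<close>. For the argument with the maximum it is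
  enough that the continuous function \<open>H\<close> has these derivatives.\<close>

definition xi_derivative :: "('g \<Rightarrow> real) \<Rightarrow> ('g \<Rightarrow> real) \<Rightarrow> bool" where
  "xi_derivative H H' \<longleftrightarrow> (\<forall>W \<psi> a w. velocity W \<psi> a w \<longrightarrow>
     ((\<lambda>t. H (inv_into W \<psi> (\<psi> a + t *\<^sub>R w))) has_real_derivative H' a) (at 0))"

text \<open>Let \<open>H a\<close> be the integral of \<open>\<alpha>\<close> over the translate of \<open>\<gamma>\<close> by \<open>a\<close>, that is, of the pull-back \<open>a\<^sup>*\<alpha>\<close> over \<open>\<gamma>\<close>. Its
  derivative is the integral of \<open>L\<^sub>V (a\<^sup>*\<alpha>) = d (a\<^sup>*\<alpha> (V)) + \<iota>\<^sub>V a\<^sup>*d\<alpha>\<close>. As \<open>a\<^sup>*d\<alpha> = d\<alpha>\<close> and \<open>\<iota>\<^sub>V d\<alpha> = - d u\<close>, only boundary terms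
  remain.\<close>

lemma translated_integral:
  assumes Y: "Y \<in> vfields A" and \<gamma>c: "continuous_on {0..1} \<gamma>"
    and \<gamma>: "\<And>s h. s \<in> {0..1} \<Longrightarrow> h \<in> cinf A \<Longrightarrow> ((\<lambda>s. h (\<gamma> s)) has_real_derivative Y h (\<gamma> s)) (at s)"
  obtains H :: "'g \<Rightarrow> real" where "continuous_on UNIV H"
    "xi_derivative H (\<lambda>a. (transported a (\<gamma> 1) - u (\<gamma> 1)) - (transported a (\<gamma> 0) - u (\<gamma> 0)))"
proof -
  define k where "k a q = (\<Sum>i\<in>I. \<alpha> [E i] (act a q) * Y (\<lambda>q. x i (act a q)) q)" for a q
  define H where "H a = integral (cbox 0 1) (\<lambda>s. k a (\<gamma> s))" for a
  have fam: "smooth_family (\<psi> ` W) (\<lambda>b q. k (inv_into W \<psi> b) q)" if "(W, \<psi>) \<in> B" for W \<psi>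
    unfolding k_def
    by (intro smooth_family_sum smooth_family_mult act_family[OF that]
        family_vf[OF B.chart_image[OF that] act_family[OF that] Y] \<alpha>_cinf x_cinf)
  have cont_fam: "continuous_on (S \<times> cbox 0 1) (\<lambda>(b, s). F b (\<gamma> s))"
    if S: "open S" "smooth_family S F" for S :: "'k set" and F
  proof -
    have "continuous_on (S \<times> cbox 0 1) (\<lambda>z. (fst z, \<gamma> (snd z)))"
      by (intro continuous_intros continuous_on_compose2[OF \<gamma>c]) auto
    then have "continuous_on (S \<times> cbox 0 1) (\<lambda>z. case (fst z, \<gamma> (snd z)) of (b, q) \<Rightarrow> F b q)"
      by (rule continuous_on_compose2[OF family_continuous[OF S]]) auto
    then show ?thesis by (simp add: split_beta)
  qed
  have H_chart: "continuous_on (\<psi> ` W) (\<lambda>b. H (inv_into W \<psi> b))" if W: "(W, \<psi>) \<in> B" for W \<psi>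
    unfolding H_def by (rule integral_continuous_on_param[OF cont_fam[OF B.chart_image[OF W] fam[OF W]]])
  have "isCont H a" for a
  proof -
    obtain W \<psi> where W: "(W, \<psi>) \<in> B" "a \<in> W" by (rule B.chart_at)
    have "continuous_on W (\<lambda>c. H (inv_into W \<psi> (\<psi> c)))"
      by (rule continuous_on_compose2[OF H_chart[OF W(1)] B.chart_continuous[OF W(1)]]) simp
    then have "continuous_on W H"
      by (rule continuous_on_cong[THEN iffD1, OF refl, rotated]) (simp add: W)
    then show ?thesis using B.chart_open[OF W(1)] W(2) continuous_on_eq_continuous_at by blast
  qed
  then have "continuous_on UNIV H" by (simp add: continuous_at_imp_continuous_on)
  moreover have "((\<lambda>t. H (inv_into W \<psi> (\<psi> a + t *\<^sub>R w))) has_real_derivative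
      (transported a (\<gamma> 1) - u (\<gamma> 1)) - (transported a (\<gamma> 0) - u (\<gamma> 0))) (at 0)"
    if w: "velocity W \<psi> a w" for W \<psi> a w
  proof -
    have W: "(W, \<psi>) \<in> B" "a \<in> W" using w by (auto simp: velocity_def)
    note S = B.chart_image[OF W(1)] and F = fam[OF W(1)]
    have b0: "\<psi> a \<in> \<psi> ` W" and b00: "\<psi> a + 0 *\<^sub>R w \<in> \<psi> ` W" using W(2) by auto
    let ?K = "\<lambda>b q. k (inv_into W \<psi> b) q"
    have K': "dir_deriv (\<lambda>b. ?K b q) w (\<psi> a) = Y (\<lambda>q. transported a q - u q) q" for q
    proof -
      interpret d: diffeo A "act a" by (rule act_diffeo)
      let ?h = "\<lambda>i q. \<alpha> [E i] (act a q)" and ?x = "\<lambda>i q. x i (act a q)"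
      have hc: "?h i \<in> cinf A" "?x i \<in> cinf A" if "i \<in> I" for i using that by (auto intro: act_cinf \<alpha>_cinf x_cinf)
      have "((\<lambda>t. ?K (\<psi> a + t *\<^sub>R w) q) has_real_derivative
          (\<Sum>i\<in>I. V (?h i) q * Y (?x i) q + ?h i q * Y (V (?x i)) q)) (at 0)"
        unfolding k_def
      proof (rule DERIV_sum)
        fix i assume i: "i \<in> I"
        note f1 = act_family[OF W(1) \<alpha>_cinf[OF i]] and f2 = act_family[OF W(1) x_cinf[OF i]]
        have d1: "((\<lambda>t. \<alpha> [E i] (act (inv_into W \<psi> (\<psi> a + t *\<^sub>R w)) q)) has_real_derivative V (?h i) q) (at 0)"
          using family_line_derivative[OF S f1 b00, of q] velocity_action[OF w \<alpha>_cinf[OF i], of q] by simp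
        have d2: "((\<lambda>t. Y (\<lambda>q. x i (act (inv_into W \<psi> (\<psi> a + t *\<^sub>R w)) q)) q) has_real_derivative Y (V (?x i)) q) (at 0)"
          using family_line_derivative[OF S family_vf[OF S f2 Y] b00, of q]
            family_vf_deriv[OF S f2 Y b0, of q w] velocity_action[OF w x_cinf[OF i]] by simp
        show "((\<lambda>t. \<alpha> [E i] (act (inv_into W \<psi> (\<psi> a + t *\<^sub>R w)) q) * Y (\<lambda>q. x i (act (inv_into W \<psi> (\<psi> a + t *\<^sub>R w)) q)) q)
            has_real_derivative V (?h i) q * Y (?x i) q + ?h i q * Y (V (?x i)) q) (at 0)"
          by (rule DERIV_cong[OF DERIV_mult[OF d1 d2]]) (simp add: W)
      qed
      moreover have "((\<lambda>t. ?K (\<psi> a + t *\<^sub>R w) q) has_real_derivative dir_deriv (\<lambda>b. ?K b q) w (\<psi> a)) (at 0)"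
        using family_line_derivative[OF S F b00, of q] by simp
      ultimately have "dir_deriv (\<lambda>b. ?K b q) w (\<psi> a)
          = (\<Sum>i\<in>I. V (?h i) q * Y (?x i) q + ?h i q * Y (V (?x i)) q)"
        by (rule DERIV_unique[rotated])
      moreover have "Y (transported a) q = (\<Sum>i\<in>I. Y (?h i) q * V (?x i) q + ?h i q * Y (V (?x i)) q)"
        unfolding transported_def
        by (simp add: vf_sum[OF Y] vf_mult[OF Y] cinf_mult hc vf_cinf[OF V_vfields])
      moreover have "Y u q = - (\<Sum>i\<in>I. V (?h i) q * Y (?x i) q - Y (?h i) q * V (?x i) q)"
        using u_derivative[OF Y, of q] ext_deriv_push[OF V_vfields Y, of a q]
          ext_deriv_expand[OF d.push_vfields[OF V_vfields] d.push_vfields[OF Y], of "act a q"]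
        by (simp add: o_def)
      moreover have "transported a \<in> cinf A"
        unfolding transported_def by (intro cinf_sum cinf_mult hc vf_cinf[OF V_vfields])
      ultimately show ?thesis
        by (simp add: vf_diff[OF Y] u_cinf sum.distrib sum_subtractf)
    qed
    obtain \<epsilon> where \<epsilon>: "\<epsilon> > 0" and "\<And>t. \<bar>t\<bar> < \<epsilon> \<Longrightarrow> \<psi> a + t *\<^sub>R w \<in> \<psi> ` W"
      using line_in_open[OF S b0] by blast
    then have line: "\<psi> a + t *\<^sub>R w \<in> \<psi> ` W" if "t \<in> ball 0 \<epsilon>" for t using that by simp
    have lc: "continuous_on (ball 0 \<epsilon> \<times> cbox 0 1) (\<lambda>(t, s). F' (\<psi> a + t *\<^sub>R w) (\<gamma> s))"
      if "smooth_family (\<psi> ` W) F'" for F'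
    proof -
      have "continuous_on (ball 0 \<epsilon> \<times> cbox 0 1) (\<lambda>z. (\<psi> a + fst z *\<^sub>R w, snd z))"
        by (intro continuous_intros)
      then have "continuous_on (ball 0 \<epsilon> \<times> cbox 0 1) (\<lambda>z. case (\<psi> a + fst z *\<^sub>R w, snd z) of (b, s) \<Rightarrow> F' b (\<gamma> s))"
        by (rule continuous_on_compose2[OF cont_fam[OF S that]]) (use line in auto)
      then show ?thesis by (simp add: split_beta)
    qed
    have "((\<lambda>t. integral (cbox 0 1) (\<lambda>s. ?K (\<psi> a + t *\<^sub>R w) (\<gamma> s))) has_real_derivative
        integral (cbox 0 1) (\<lambda>s. dir_deriv (\<lambda>b. ?K b (\<gamma> s)) w (\<psi> a + 0 *\<^sub>R w))) (at 0 within ball 0 \<epsilon>)"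
    proof (rule leibniz_rule_field_derivative)
      show "((\<lambda>t. ?K (\<psi> a + t *\<^sub>R w) (\<gamma> s)) has_real_derivative dir_deriv (\<lambda>b. ?K b (\<gamma> s)) w (\<psi> a + t *\<^sub>R w)) (at t within ball 0 \<epsilon>)"
        if "t \<in> ball 0 \<epsilon>" for t s
        by (rule has_field_derivative_at_within[OF family_line_derivative[OF S F line[OF that]]])
      show "(\<lambda>s. ?K (\<psi> a + t *\<^sub>R w) (\<gamma> s)) integrable_on cbox 0 1" if t: "t \<in> ball 0 \<epsilon>" for t
      proof (rule integrable_continuous)
        have "continuous_on (cbox 0 1) (\<lambda>s::real. (t, s))" by (intro continuous_intros)
        then have "continuous_on (cbox 0 1) (\<lambda>s. case (t, s) of (t, s) \<Rightarrow> ?K (\<psi> a + t *\<^sub>R w) (\<gamma> s))"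
          by (rule continuous_on_compose2[OF lc[OF F]]) (use t in auto)
        then show "continuous_on (cbox 0 1) (\<lambda>s. ?K (\<psi> a + t *\<^sub>R w) (\<gamma> s))" by simp
      qed
      show "continuous_on (ball 0 \<epsilon> \<times> cbox 0 1) (\<lambda>(t, s). dir_deriv (\<lambda>b. ?K b (\<gamma> s)) w (\<psi> a + t *\<^sub>R w))"
        by (rule lc[OF family_deriv[OF S F]])
    qed (use \<epsilon> in auto)
    moreover have "integral (cbox 0 1) (\<lambda>s. Y (\<lambda>q. transported a q - u q) (\<gamma> s))
        = (transported a (\<gamma> 1) - u (\<gamma> 1)) - (transported a (\<gamma> 0) - u (\<gamma> 0))"
    proof -
      have "transported a \<in> cinf A"
        unfolding transported_def by (intro cinf_sum cinf_mult vf_cinf[OF V_vfields] act_cinf \<alpha>_cinf)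
      then have "(\<lambda>q. transported a q - u q) \<in> cinf A" by (intro cinf_diff u_cinf)
      then have "((\<lambda>s. Y (\<lambda>q. transported a q - u q) (\<gamma> s)) has_integral
          (transported a (\<gamma> 1) - u (\<gamma> 1)) - (transported a (\<gamma> 0) - u (\<gamma> 0))) {0..1}"
        using has_field_derivative_at_within[OF \<gamma>[of _ "\<lambda>q. transported a q - u q"]]
        by (intro fundamental_theorem_of_calculus) (auto simp flip: has_real_derivative_iff_has_vector_derivative)
      then show ?thesis by (simp add: integral_unique cbox_interval)
    qed
    ultimately show ?thesis
      using at_within_open[of "0::real" "ball 0 \<epsilon>"] \<epsilon> by (simp add: H_def K')
  qed
  ultimately show ?thesis by (intro that) (auto simp: xi_derivative_def)
qed

text \<open>An equivalence relation with open classes, by the previous lemma and by unique continuation. It takes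
  the place of the connected components of the manifold: a chain of short curves in charts suffices, and
  the functions \<open>H\<close> of its links add up.\<close>

definition linked :: "'a \<Rightarrow> 'a \<Rightarrow> bool" where
  "linked p q \<longleftrightarrow> (flat_at V p \<longleftrightarrow> flat_at V q) \<and> (\<exists>H. continuous_on UNIV H \<and>
     xi_derivative H (\<lambda>a. (transported a q - u q) - (transported a p - u p)))"

lemma linked_refl: "linked p p"
  unfolding linked_def xi_derivative_def by (intro conjI refl exI[of _ "\<lambda>a. 0"]) auto

lemma linked_sym:
  assumes "linked p q"
  shows "linked q p"
proof -
  obtain H where H: "continuous_on UNIV H"
    "xi_derivative H (\<lambda>a. (transported a q - u q) - (transported a p - u p))"
    using assms unfolding linked_def by blast
  have "xi_derivative (\<lambda>a. - H a) (\<lambda>a. (transported a p - u p) - (transported a q - u q))"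
    unfolding xi_derivative_def
  proof (intro allI impI)
    fix W \<psi> a w assume w: "velocity W \<psi> a w"
    show "((\<lambda>t. - H (inv_into W \<psi> (\<psi> a + t *\<^sub>R w))) has_real_derivative
       (transported a p - u p) - (transported a q - u q)) (at 0)"
      by (rule DERIV_cong[OF DERIV_minus[OF H(2)[unfolded xi_derivative_def, rule_format, OF w]]]) simp
  qed
  then show ?thesis
    using H(1) assms unfolding linked_def by (auto intro!: exI[of _ "\<lambda>a. - H a"] continuous_on_minus)
qed

lemma linked_trans:
  assumes "linked p q" "linked q r"
  shows "linked p r"
proof -
  obtain H where H: "continuous_on UNIV H"
    "xi_derivative H (\<lambda>a. (transported a q - u q) - (transported a p - u p))"
    using assms(1) unfolding linked_def by blast
  obtain H' where H': "continuous_on UNIV H'"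
    "xi_derivative H' (\<lambda>a. (transported a r - u r) - (transported a q - u q))"
    using assms(2) unfolding linked_def by blast
  have "xi_derivative (\<lambda>a. H a + H' a) (\<lambda>a. (transported a r - u r) - (transported a p - u p))"
    unfolding xi_derivative_def
  proof (intro allI impI)
    fix W \<psi> a w assume w: "velocity W \<psi> a w"
    show "((\<lambda>t. H (inv_into W \<psi> (\<psi> a + t *\<^sub>R w)) + H' (inv_into W \<psi> (\<psi> a + t *\<^sub>R w))) has_real_derivative
       (transported a r - u r) - (transported a p - u p)) (at 0)"
      by (rule DERIV_cong[OF DERIV_add[OF H(2)[unfolded xi_derivative_def, rule_format, OF w]
              H'(2)[unfolded xi_derivative_def, rule_format, OF w]]]) simp
  qed
  then show ?thesis
    using H(1) H'(1) assms unfolding linked_def by (auto intro!: exI[of _ "\<lambda>a. H a + H' a"] continuous_on_add)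
qed

context
  assumes compact_M: "compact (UNIV :: 'a set)" and compact_G: "compact (UNIV :: 'g set)"
begin

lemma linked_nearby:
  obtains W where "open W" "p \<in> W" "\<And>q. q \<in> W \<Longrightarrow> linked p q"
proof -
  obtain W where W: "open W" "p \<in> W" "\<And>q. q \<in> W \<Longrightarrow> \<exists>X\<in>vfields A. \<exists>\<gamma>. \<gamma> 0 = p \<and> \<gamma> 1 = q \<and> continuous_on {0..1} \<gamma> \<and>
      (\<forall>s\<in>{0..1}. \<forall>f\<in>cinf A. ((\<lambda>s. f (\<gamma> s)) has_real_derivative X f (\<gamma> s)) (at s))"
    by (rule nearby_curve) blast
  have "linked p q" if q: "q \<in> W" for q
  proof -
    obtain X \<gamma> where X: "X \<in> vfields A" and \<gamma>: "\<gamma> 0 = p" "\<gamma> 1 = q" "continuous_on {0..1} \<gamma>"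
      "\<And>s f. s \<in> {0..1} \<Longrightarrow> f \<in> cinf A \<Longrightarrow> ((\<lambda>s. f (\<gamma> s)) has_real_derivative X f (\<gamma> s)) (at s)"
      using W(3)[OF q] by blast
    have "flat_at V (\<gamma> 0) \<longleftrightarrow> flat_at V (\<gamma> 1)"
      by (rule flat_along_curve[OF V_vfields V_J V_omega compact_M X \<gamma>(4)])
    then have "flat_at V p \<longleftrightarrow> flat_at V q" unfolding \<gamma>(1,2) .
    moreover obtain H where "continuous_on UNIV H"
      "xi_derivative H (\<lambda>a. (transported a q - u q) - (transported a p - u p))"
      using translated_integral[OF X \<gamma>(3,4)] unfolding \<gamma>(1,2) by blast
    ultimately show ?thesis unfolding linked_def by blast
  qed
  then show ?thesis using W that by blast
qed

text \<open>At a maximum of \<open>H\<close> on the compact group the derivative in the direction of \<open>\<xi>\<close> vanishes. This replaces the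
  averaging of \<open>\<alpha>\<close> over the group, and with it the Haar measure.\<close>

lemma linked_zeros:
  assumes "linked p q" and p: "\<And>h. h \<in> cinf A \<Longrightarrow> V h p = 0" and q: "\<And>h. h \<in> cinf A \<Longrightarrow> V h q = 0"
  shows "u p = u q"
proof -
  obtain H where H: "continuous_on UNIV H"
    "xi_derivative H (\<lambda>a. (transported a q - u q) - (transported a p - u p))"
    using assms(1) unfolding linked_def by blast
  obtain a where a: "\<And>b. H b \<le> H a"
    using continuous_attains_sup[OF compact_G _ H(1)] by auto
  obtain W \<psi> w where w: "velocity W \<psi> a w" by (rule velocity_at)
  then have W: "(W, \<psi>) \<in> B" "a \<in> W" by (auto simp: velocity_def)
  have "(transported a q - u q) - (transported a p - u p) = 0"
    by (rule DERIV_local_max[OF H(2)[unfolded xi_derivative_def, rule_format, OF w], of 1]) (use a W in auto)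
  moreover have "transported a p = 0" "transported a q = 0"
    unfolding transported_def by (intro sum.neutral ballI; simp add: p q act_cinf x_cinf)+
  ultimately show ?thesis by simp
qed

text \<open>At a maximum every \<open>e\<^sub>i (e\<^sub>i f)\<close> is \<open>\<le> 0\<close>, and \<open>mu V p \<le> 0\<close> says that their sum is \<open>\<ge> 0\<close>. So the Hessian of \<open>f\<close>, being
  negative semidefinite with vanishing diagonal, vanishes; as \<open>V\<close> is \<open>J\<close> times the gradient of \<open>f\<close>, so does its first jet.\<close>

lemma flat_at_degenerate_maximum:
  assumes n: "DIM('e) = 2 * n" and W: "open W" "p \<in> W" "\<And>q. q \<in> W \<Longrightarrow> f q \<le> f p" and mu: "mu V p \<le> 0"
  shows "flat_at V p"
proof -
  have crit: "\<And>Y. Y \<in> vfields A \<Longrightarrow> Y f p = 0" by (rule local_max(1)[OF f_cinf W])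
  then have zero: "\<And>h. h \<in> cinf A \<Longrightarrow> V h p = 0" using critical_iff_zero[OF ham] by blast
  obtain U e where U: "open U" "p \<in> U" and on: "\<And>q. q \<in> U \<Longrightarrow> orthonormal_at q (DIM('e)) e"
    by (rule orthonormal_frame_exists[OF n, of p]) blast
  have e: "\<And>i. i < DIM('e) \<Longrightarrow> e i \<in> vfields A" using on[OF U(2)] by (auto simp: orthonormal_at_def)
  have neg: "X (X f) p \<le> 0" if "X \<in> vfields A" for X by (rule local_max(2)[OF f_cinf W that])
  have diag: "e i (e i f) p = 0" if "i < DIM('e)" for i
  proof -
    have "(\<Sum>i<DIM('e). - e i (e i f) p) \<le> 0" using mu mu_at_zero[OF ham on[OF U(2)] zero] by (simp add: sum_negf)
    moreover have "- e i (e i f) p \<le> (\<Sum>i<DIM('e). - e i (e i f) p)"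
      by (rule member_le_sum) (use neg e that in auto)
    ultimately show ?thesis using neg[OF e[OF that]] by simp
  qed
  have off: "e i (e j f) p = 0" if "i < DIM('e)" "j < DIM('e)" for i j
  proof -
    note ij = e[OF that(1)] e[OF that(2)]
    have "e i (e j f) p = e j (e i f) p" using crit[OF vf_bracket_vfields[OF ij]] by (simp add: vf_bracket_fun)
    moreover have "e i (e j f) p + e j (e i f) p \<le> 0"
      using neg[OF vf_add_vfields[OF ij]] diag that
      by (simp add: vf_fun_ops[OF ij(1)] vf_fun_ops[OF ij(2)] vf_cinf[OF ij(1)] vf_cinf[OF ij(2)])
    moreover have "e i (e j f) p + e j (e i f) p \<ge> 0"
      using neg[OF vf_diff_vfields[OF ij]] diag that
      by (simp add: vf_fun_ops[OF ij(1)] vf_fun_ops[OF ij(2)] vf_cinf[OF ij(1)] vf_cinf[OF ij(2)])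
    ultimately show ?thesis by simp
  qed
  have hess: "X (Y f) p = 0" if X: "X \<in> vfields A" and Y: "Y \<in> vfields A" for X Y
  proof -
    have "e i (Y f) p = 0" if i: "i < DIM('e)" for i
    proof -
      let ?S = "combination (DIM('e)) (\<lambda>j. g Y (e j) p) e"
      have S: "?S \<in> vfields A" by (rule combination_vfields[OF e])
      have "e i ((Y - ?S) f) p = 0"
        by (rule vf_critical[OF e[OF i] vf_diff_vfields[OF Y S] f_cinf])
          (simp_all add: crit sum_fun_apply orthonormal_expand[OF on[OF U(2)] Y])
      moreover have "e i (?S f) p = (\<Sum>j<DIM('e). g Y (e j) p * e i (e j f) p)"
      proof -
        have "?S f = (\<lambda>q. \<Sum>j<DIM('e). g Y (e j) p * e j f q)" by (simp add: fun_eq_iff sum_fun_apply)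
        then have "e i (?S f) p = (\<Sum>j<DIM('e). e i (\<lambda>q. g Y (e j) p * e j f q) p)"
          by (simp only:) (rule vf_sum[OF e[OF i]], simp add: cinf_cmult vf_cinf[OF e])
        also have "\<dots> = (\<Sum>j<DIM('e). g Y (e j) p * e i (e j f) p)"
          by (intro sum.cong refl vf_cmult[OF e[OF i]] vf_cinf e) simp
        finally show ?thesis .
      qed
      ultimately show ?thesis
        using off[OF i] by (simp add: vf_fun_ops[OF e[OF i]] vf_cinf[OF Y] vf_cinf[OF S])
    qed
    then show ?thesis using orthonormal_expand[OF on[OF U(2)] X vf_cinf[OF Y]] by simp
  qed
  have "X (V h) p = 0" if X: "X \<in> vfields A" and h: "h \<in> cinf A" for X h
  proof -
    have loc: "V h q = (\<Sum>i<DIM('e). - J (e i) f q * e i h q)" if "q \<in> U" for q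
      using orthonormal_expand[OF on[OF that] V_vfields h]
      by (simp add: g_eq omega_ham[OF ham J_vfields[OF e]])
    have Jc: "J (e i) f \<in> cinf A" "e i h \<in> cinf A" if "i < DIM('e)" for i
      using that by (auto intro: vf_cinf J_vfields e)
    have "X (V h) p = X (\<lambda>q. \<Sum>i<DIM('e). - J (e i) f q * e i h q) p"
      by (rule tangent_local[OF vf_tangent[OF X] vf_cinf[OF V_vfields] _ U loc])
        (auto intro!: cinf_sum cinf_mult cinf_minus Jc)
    also have "\<dots> = (\<Sum>i<DIM('e). X (\<lambda>q. - J (e i) f q * e i h q) p)"
      by (rule vf_sum[OF X]) (auto intro!: cinf_mult cinf_minus Jc)
    also have "\<dots> = 0"
    proof (intro sum.neutral ballI)
      fix i assume "i \<in> {..<DIM('e)}"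
      then have i: "i < DIM('e)" by simp
      have "X (\<lambda>q. - J (e i) f q) p = 0"
        using vf_cmult[OF X Jc(1)[OF i], of "-1" p] hess[OF X J_vfields[OF e[OF i]]] by simp
      then show "X (\<lambda>q. - J (e i) f q * e i h q) p = 0"
        using vf_mult[OF X cinf_minus[OF Jc(1)[OF i]] Jc(2)[OF i], of p] crit[OF J_vfields[OF e[OF i]]] by simp
    qed
    finally show ?thesis .
  qed
  then show ?thesis using zero by (simp add: flat_at_def)
qed

lemma mu_at_local_minimum:
  assumes n: "DIM('e) = 2 * n" and W: "open W" "p \<in> W" "\<And>q. q \<in> W \<Longrightarrow> f p \<le> f q"
  shows "mu V p \<le> 0" "\<And>h. h \<in> cinf A \<Longrightarrow> V h p = 0"
proof -
  have nf: "(\<lambda>q. - f q) \<in> cinf A" by (rule cinf_minus[OF f_cinf])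
  have m: "\<And>q. q \<in> W \<Longrightarrow> - f q \<le> - f p" using W(3) by simp
  have neg: "X (\<lambda>q. - k q) r = - X k r" if "X \<in> vfields A" "k \<in> cinf A" for X k r
    using vf_cmult[OF that, of "-1" r] by simp
  have crit: "Y f p = 0" if "Y \<in> vfields A" for Y
    using local_max(1)[OF nf W(1,2) m that] neg[OF that f_cinf] by simp
  then show zero: "\<And>h. h \<in> cinf A \<Longrightarrow> V h p = 0" using critical_iff_zero[OF ham] by blast
  obtain U e where U: "open U" "p \<in> U" and on: "\<And>q. q \<in> U \<Longrightarrow> orthonormal_at q (DIM('e)) e"
    by (rule orthonormal_frame_exists[OF n, of p]) blast
  have "e i (e i f) p \<ge> 0" if "i < DIM('e)" for i
  proof -
    have e: "e i \<in> vfields A" using on[OF U(2)] that by (auto simp: orthonormal_at_def)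
    have "e i (\<lambda>q. - f q) = (\<lambda>q. - e i f q)" using neg[OF e f_cinf] by blast
    then show ?thesis using local_max(2)[OF nf W(1,2) m e] neg[OF e vf_cinf[OF e]] by simp
  qed
  then have "(\<Sum>i<DIM('e). e i (e i f) p) \<ge> 0" by (intro sum_nonneg) simp
  then show "mu V p \<le> 0" using mu_at_zero[OF ham on[OF U(2)] zero] by simp
qed

section \<open>Positivity of the monotonicity constant\<close>

text \<open>Let \<open>p\<close> and \<open>q\<close> be a maximum and a minimum of \<open>f\<close> on the class of a point where \<open>V\<close> does not vanish. As \<open>u p = u q\<close>,
  the difference \<open>mu V p - mu V q\<close> is \<open>lam (f p - f q)\<close>. For \<open>lam \<le> 0\<close> this and the signs of the moment map
  force \<open>mu V p = 0\<close>, and unique continuation from \<open>p\<close> gives a contradiction.\<close>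

lemma monotone_constant_positive:
  assumes n: "DIM('e) = 2 * n" and V: "V \<noteq> 0"
  shows "lam > 0"
proof (rule ccontr)
  assume "\<not> lam > 0"
  then have lam: "lam \<le> 0" by simp
  obtain p0 h where h: "V h p0 \<noteq> 0" using V by (auto simp: fun_eq_iff)
  have "h \<in> cinf A" using h vf_outside[OF V_vfields] by metis
  then have not_flat: "\<not> flat_at V p0" using h by (auto simp: flat_at_def)
  define S where "S = {q. linked p0 q}"
  have "open S"
  proof (rule topological_space_class.openI)
    fix q assume q: "q \<in> S"
    obtain W where "open W" "q \<in> W" "\<And>r. r \<in> W \<Longrightarrow> linked q r" by (rule linked_nearby) blast
    moreover from this(3) q have "W \<subseteq> S" using linked_trans[of p0 q] by (auto simp: S_def)
    ultimately show "\<exists>T. open T \<and> q \<in> T \<and> T \<subseteq> S" by blast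
  qed
  have "open (- S)"
  proof (rule topological_space_class.openI)
    fix q assume q: "q \<in> - S"
    obtain W where "open W" "q \<in> W" "\<And>r. r \<in> W \<Longrightarrow> linked q r" by (rule linked_nearby) blast
    moreover from this(3) q have "W \<subseteq> - S" using linked_trans[OF _ linked_sym, of p0 _ q] by (auto simp: S_def)
    ultimately show "\<exists>T. open T \<and> q \<in> T \<and> T \<subseteq> - S" by blast
  qed
  then have "compact S" using compact_Int_closed[OF compact_M, of S] by (simp add: closed_def)
  moreover have "p0 \<in> S" by (simp add: S_def linked_refl)
  ultimately obtain p q where p: "p \<in> S" "\<And>r. r \<in> S \<Longrightarrow> f r \<le> f p" and q: "q \<in> S" "\<And>r. r \<in> S \<Longrightarrow> f q \<le> f r"
    using continuous_attains_sup[of S f] continuous_attains_inf[of S f] cinf_continuous[OF f_cinf] by blast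
  have "\<And>Y. Y \<in> vfields A \<Longrightarrow> Y f p = 0" by (rule local_max(1)[OF f_cinf \<open>open S\<close> p])
  then have p0: "\<And>h. h \<in> cinf A \<Longrightarrow> V h p = 0" using critical_iff_zero[OF ham] by blast
  note mq = mu_at_local_minimum[OF n \<open>open S\<close> q]
  have "linked p q" using linked_trans[OF linked_sym, of p0 p q] p(1) q(1) by (simp add: S_def)
  then have "u p = u q" by (rule linked_zeros[OF _ p0 mq(2)])
  then have "mu V p = mu V q + lam * (f p - f q)" by (simp add: u_def algebra_simps)
  moreover have "lam * (f p - f q) \<le> 0" using lam p(2)[OF q(1)] by (simp add: mult_le_0_iff)
  ultimately have "mu V p \<le> 0" using mq(1) by simp
  then have "flat_at V p" by (intro flat_at_degenerate_maximum[OF n \<open>open S\<close>] p)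
  then show False using not_flat p(1) by (simp add: S_def linked_def)
qed

end

end

end

theorem proposition5:
  fixes A :: "('a::{t2_space,second_countable_topology}, 'e::euclidean_space) atlas"
    and B :: "('g::{t2_space,second_countable_topology}, 'k::euclidean_space) atlas"
    and n :: nat and \<omega> :: "'a form" and lam :: real
    and mul :: "'g \<Rightarrow> 'g \<Rightarrow> 'g" and one :: 'g and iv :: "'g \<Rightarrow> 'g" and act :: "'g \<Rightarrow> 'a \<Rightarrow> 'a"
    and J :: "'a vf \<Rightarrow> 'a vf" and \<xi> :: "'g vf"
  assumes "symplectic_manifold A n \<omega>"
    and "compact (UNIV :: 'a set)"
    and "two_pi_c1 A n \<omega> = de_rham_class A 2 (form_scale lam \<omega>)"
    and "lie_subgroup_of_Ham A \<omega> B mul one iv act"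
    and "compact (UNIV :: 'g set)"
    and "connected (UNIV :: 'g set)"
    and "J \<in> AK A \<omega> (range act)"
    and "\<xi> \<in> lie_center B mul"
    and "fundamental_vf A one act \<xi> \<noteq> vf_zero"
    and "GeAKRS A n \<omega> J (fundamental_vf A one act \<xi>)"
  shows "lam > 0"
proof -
  let ?V = "fundamental_vf A one act \<xi>"
  interpret M: manifold A using assms(1) by unfold_locales (simp add: symplectic_manifold_def)
  obtain I :: "('a \<times> 'e) set" and x E where basis: "finite I"
    "\<And>i. i \<in> I \<Longrightarrow> x i \<in> cinf A" "\<And>i. i \<in> I \<Longrightarrow> E i \<in> vfields A"
    "\<And>p \<delta> f. M.tangent_at p \<delta> \<Longrightarrow> f \<in> cinf A \<Longrightarrow> \<delta> f = (\<Sum>i\<in>I. \<delta> (x i) * E i f p)"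
    using M.dual_basis[OF assms(2)] by blast
  obtain D f where D: "levi_civita A (ak_metric \<omega> J) D" and f: "hamiltonian_vf A \<omega> f ?V"
    using assms(10) by (auto simp: GeAKRS_def Let_def is_potential_def)
  have n: "DIM('e) = 2 * n" using assms(1) by (simp add: symplectic_manifold_def)
  interpret hamiltonian_action A I x E D \<omega> J B mul one iv act \<xi> ?V f
  proof unfold_locales
    show "is_connection A D" using D by (simp add: levi_civita_def)
    show "closed_form A 2 \<omega>" using assms(1) by (simp add: symplectic_manifold_def)
    show "compatible A \<omega> J" using assms(7) by (simp add: AK_def)
    show "smooth_manifold B" using assms(4) by (simp add: lie_subgroup_of_Ham_def lie_group_def)
    show "\<xi> \<in> lie_algebra B mul" using assms(8) by (simp add: lie_center_def)
  qed (use basis D f assms in auto)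
  let ?\<rho> = "chern_ricci A n \<omega> J N"
  have "?\<rho> \<in> de_rham_class A 2 ?\<rho>"
  proof -
    have "is_form A 1 (\<lambda>Xs p. 0)" by (auto simp: is_form_def M.cinf_const)
    moreover have "ext_deriv A (\<lambda>Xs p. 0) Xs p = 0" for Xs p
      by (auto simp: ext_deriv_def M.vf_const subset_iff intro!: sum.neutral)
    ultimately show ?thesis
      using chern_ricci_closed[OF n] unfolding de_rham_class_def form_add_def by auto
  qed
  also have "de_rham_class A 2 ?\<rho> \<subseteq> two_pi_c1 A n \<omega>"
    unfolding two_pi_c1_def using compatible N_connection N_J by blast
  finally have "?\<rho> \<in> de_rham_class A 2 (form_scale lam \<omega>)" using assms(3) by simp
  then obtain \<alpha> where \<alpha>: "is_form A 1 \<alpha>" "?\<rho> = form_add (form_scale lam \<omega>) (ext_deriv A \<alpha>)"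
    by (auto simp: de_rham_class_def)
  have "rho X Y p = lam * \<omega> [X, Y] p + ext_deriv A \<alpha> [X, Y] p" if "X \<in> vfields A" "Y \<in> vfields A" for X Y p
  proof -
    have "rho X Y p = ?\<rho> [X, Y] p" using that by (simp add: chern_ricci_eq[OF n])
    then show ?thesis using \<alpha>(2) by (simp add: form_add_def form_scale_def)
  qed
  from monotone_constant_positive[OF \<alpha>(1) this assms(2,5) n] assms(9) show ?thesis by simp
qed

end
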